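(* Let $n\ge1$, let $W_n$ be the symmetric group on $\{1,\dots,n\}$ with simple reflections $S=\{s_1,\dots,s_{n-1}\}$ and Hecke algebra $\mathcal H$ over $\mathcal A=\mathbb Z[q,q^{-1}]$, let $\lambda$ be a partition of $n$, and let $S^\lambda$ be the Specht module of $\mathcal H$ associated with $\lambda$. Then $S^\lambda$ has an $\mathcal A$-basis $(b_t\mid t\in\mathrm{STD}(\lambda))$, indexed by the standard $\lambda$-tableaux, such that for all $s\in S$ and $t\in\mathrm{STD}(\lambda)$ $$T_sb_t=\begin{cases}b_{st}&\text{if }s\in\mathrm{SA}(t),\\ b_{st}+(q-q^{-1})b_t&\text{if }s\in\mathrm{SD}(t),\\ -q^{-1}b_t&\text{if }s\in\mathrm{WD}(t),\\ qb_t-\sum_{u\in\mathrm{STD}(\lambda),\,u<t}r^{(s)}_{u,t}b_u&\text{if }s\in\mathrm{WA}(t),\end{cases}$$ for some polynomials $r^{(s)}_{u,t}\in q\mathbb Z[q]$.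
   Context: **Hecke algebra.** $W_n$ is the symmetric group on $\{1,\dots,n\}$ acting on the left, $s_i=(i,i+1)$, $l$ is the length function and $\le$ the Bruhat order. $\mathcal H$ is the associative $\mathcal A$-algebra generated by $T_s$ ($s\in S$) with $T_s^2=1+(q-q^{-1})T_s$ and the braid relations; it has $\mathcal A$-basis $(T_w)_{w\in W_n}$. **Tableaux.** For a partition $\lambda=(\lambda_1\ge\dots\ge\lambda_k)$ of $n$, $[\lambda]=\{(i,j)\mid1\le i\le k,\ 1\le j\le\lambda_i\}$ ($i$ is the row index, $j$ the column index). A $\lambda$-tableau is a bijection $t\colon[\lambda]\to\{1,\dots,n\}$, and $W_n$ acts by $(wt)(i,j)=w(t(i,j))$. A tableau is column standard if its entries increase down columns, and standard if they also increase along rows; $\mathrm{STD}(\lambda)$ is the set of standard $\lambda$-tableaux. $\mathrm t^\lambda$ is the $\lambda$-tableau in which $1,\dots,n$ fill the rows in order, left to right in each row, first row first. $\mathrm t_\lambda$ is the one in which $1,\dots,n$ fill the columns in order, top to bottom in each column, first column first. $J_\lambda$ is the set of $s_i$ with $i,i+1$ in the same column of $\mathrm t_\lambda$, $W_\lambda$ is the parabolic subgroup generated by $J_\lambda$ (the column stabilizer of $\mathrm t_\lambda$), and $D_\lambda=\{d\in W_n\mid l(ds)>l(d)\text{ for all }s\in J_\lambda\}$; $\{d\mathrm t_\lambda\mid d\in D_\lambda\}$ is the set of column standard $\lambda$-tableaux. The Bruhat order is transferred to $\lambda$-tableaux by $w_1\mathrm t_\lambda\le w_2\mathrm t_\lambda$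 iff $w_1\le w_2$. **Ascents and descents.** For $t\in\mathrm{STD}(\lambda)$ write $t=w\mathrm t_\lambda$ with $w\in W_n$. Then $\mathrm{SA}(t)=\{s\in S\mid sw>w,\ st\in\mathrm{STD}(\lambda)\}$, $\mathrm{SD}(t)=\{s\in S\mid sw<w\}$, $\mathrm{WA}(t)=\{s\in S\mid sw>w,\ sw\in D_\lambda,\ st\notin\mathrm{STD}(\lambda)\}$, $\mathrm{WD}(t)=\{s\in S\mid sw>w,\ sw\notin D_\lambda\}$. **Specht module.** Let $v_\lambda\in W_n$ satisfy $v_\lambda\mathrm t_\lambda=\mathrm t^\lambda$, let $R_\lambda$ be the row stabilizer of $\mathrm t^\lambda$, and put $x_\lambda=\sum_{w\in R_\lambda}q^{l(w)}T_w$ and $y_\lambda=\sum_{w\in W_\lambda}(-q)^{-l(w)}T_w$. The Specht module is the left $\mathcal H$-module $S^\lambda=\mathcal H\,y_\lambda T_{v_\lambda^{-1}}x_\lambda$ (Dipper–James). It is known to be isomorphic to the Kazhdan–Lusztig left cell module of the left cell of $W_n$ containing the longest element of $W_\lambda$. *)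

theory Defs
  imports "HOL-Algebra.Sym_Groups" "HOL-Algebra.QuotRing" "HOL-Algebra.Module" "HOL-Library.Poly_Mapping"
begin

section \<open>The coefficient ring\<close>

text \<open>
  The ring of Laurent polynomials over the integers is the monoid algebra over the integers of the
  additive group of integers: the key \<open>k\<close> stands for the monomial of degree \<open>k\<close>.
\<close>

type_synonym laurent = "int \<Rightarrow>\<^sub>0 int"

definition q :: laurent where "q = Poly_Mapping.single 1 1"

definition q_inv :: laurent where "q_inv = Poly_Mapping.single (-1) 1"

text \<open>The polynomials in \<open>q\<close> without constant term.\<close>

definition q_polys :: "laurent set" where
  "q_polys = {f. \<forall>k \<in> Poly_Mapping.keys f. 0 < k}"


section \<open>The symmetric group\<close>

type_synonym perm = "nat \<Rightarrow> nat"

abbreviation Wn :: "nat \<Rightarrow> perm set" where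
  "Wn n \<equiv> carrier (sym_group n)"

definition simple_refl :: "nat \<Rightarrow> perm" where
  "simple_refl i = transpose i (Suc i)"

definition simple_refls :: "nat \<Rightarrow> perm set" where
  "simple_refls n = simple_refl ` {1..<n}"

definition word_prod :: "perm list \<Rightarrow> perm" where
  "word_prod ss = foldr (\<circ>) ss id"

definition len :: "nat \<Rightarrow> perm \<Rightarrow> nat" where
  "len n w = (LEAST k. \<exists>ss. set ss \<subseteq> simple_refls n \<and> word_prod ss = w \<and> length ss = k)"

definition reduced_word :: "nat \<Rightarrow> perm \<Rightarrow> perm list \<Rightarrow> bool" where
  "reduced_word n w ss \<longleftrightarrow> set ss \<subseteq> simple_refls n \<and> word_prod ss = w \<and> length ss = len n w"

definition bruhat_step :: "nat \<Rightarrow> perm \<Rightarrow> perm \<Rightarrow> bool" where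
  "bruhat_step n u w \<longleftrightarrow> u \<in> Wn n \<and>
     (\<exists>a b. 1 \<le> a \<and> a < b \<and> b \<le> n \<and> w = transpose a b \<circ> u) \<and> len n u < len n w"

definition bruhat_le :: "nat \<Rightarrow> perm \<Rightarrow> perm \<Rightarrow> bool" where
  "bruhat_le n = (bruhat_step n)\<^sup>*\<^sup>*"

definition bruhat_less :: "nat \<Rightarrow> perm \<Rightarrow> perm \<Rightarrow> bool" where
  "bruhat_less n u w \<longleftrightarrow> bruhat_le n u w \<and> u \<noteq> w"


section \<open>The Hecke algebra\<close>

text \<open>
  The free monoid, written additively, so that finitely supported functions on it form the
  free associative algebra.
\<close>

datatype 'a free_mon = FM (letters: "'a list")

instantiation free_mon :: (type) monoid_add
begin

definition "0 = FM []"

definition "u + v = FM (letters u @ letters v)"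

instance
  by standard (simp_all add: zero_free_mon_def plus_free_mon_def)

end

type_synonym free_elt = "perm free_mon \<Rightarrow>\<^sub>0 laurent"

text \<open>The free associative algebra on the set \<open>simple_refls n\<close>.\<close>

definition free_alg :: "nat \<Rightarrow> free_elt ring" where
  "free_alg n =
     \<lparr> carrier = {f. \<forall>w \<in> Poly_Mapping.keys f. set (letters w) \<subseteq> simple_refls n},
       mult = (*), one = 1, zero = 0, add = (+) \<rparr>"

definition free_gen :: "perm \<Rightarrow> free_elt" where
  "free_gen s = Poly_Mapping.single (FM [s]) 1"

definition free_const :: "laurent \<Rightarrow> free_elt" where
  "free_const a = Poly_Mapping.single 0 a"

definition hecke_rels :: "nat \<Rightarrow> free_elt set" where
  "hecke_rels n =
     {free_gen s * free_gen s - (1 + free_const (q - q_inv) * free_gen s) | s. s \<in> simple_refls n}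
   \<union> {free_gen (simple_refl i) * free_gen (simple_refl (i + 1)) * free_gen (simple_refl i)
      - free_gen (simple_refl (i + 1)) * free_gen (simple_refl i) * free_gen (simple_refl (i + 1))
      | i. 1 \<le> i \<and> i + 1 < n}
   \<union> {free_gen (simple_refl i) * free_gen (simple_refl j)
      - free_gen (simple_refl j) * free_gen (simple_refl i)
      | i j. 1 \<le> i \<and> i + 1 < j \<and> j < n}"

definition hecke_ideal :: "nat \<Rightarrow> free_elt set" where
  "hecke_ideal n = Idl\<^bsub>free_alg n\<^esub> (hecke_rels n)"

definition hecke_class :: "nat \<Rightarrow> free_elt \<Rightarrow> free_elt set" where
  "hecke_class n f = hecke_ideal n +>\<^bsub>free_alg n\<^esub> f"

text \<open>
  The Hecke algebra is the quotient of the free algebra by the two-sided ideal generated by the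
  relations. The record type of modules adds the scalar multiplication to the ring structure.
\<close>

definition hecke :: "nat \<Rightarrow> (laurent, free_elt set) module" where
  "hecke n = (let Q = free_alg n Quot hecke_ideal n in
     \<lparr> carrier = carrier Q, mult = mult Q, one = one Q, zero = zero Q, add = add Q,
       smult = (\<lambda>a x. hecke_class n (free_const a) \<otimes>\<^bsub>Q\<^esub> x) \<rparr>)"

definition T_gen :: "nat \<Rightarrow> perm \<Rightarrow> free_elt set" where
  "T_gen n s = hecke_class n (free_gen s)"

text \<open>By Matsumoto's theorem the choice of the reduced word does not matter.\<close>

definition T_elt :: "nat \<Rightarrow> perm \<Rightarrow> free_elt set" where
  "T_elt n w = foldr (\<lambda>s x. T_gen n s \<otimes>\<^bsub>hecke n\<^esub> x) (SOME ss. reduced_word n w ss) \<one>\<^bsub>hecke n\<^esub>"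

definition is_basis :: "('a::zero, 'm) module \<Rightarrow> 'm set \<Rightarrow> 'i set \<Rightarrow> ('i \<Rightarrow> 'm) \<Rightarrow> bool" where
  "is_basis H M I b \<longleftrightarrow> finite I \<and> b \<in> I \<rightarrow> M \<and> M \<subseteq> carrier H \<and>
     M = {\<Oplus>\<^bsub>H\<^esub>i\<in>I. a i \<odot>\<^bsub>H\<^esub> b i | a. True} \<and>
     (\<forall>a. (\<Oplus>\<^bsub>H\<^esub>i\<in>I. a i \<odot>\<^bsub>H\<^esub> b i) = \<zero>\<^bsub>H\<^esub> \<longrightarrow> (\<forall>i\<in>I. a i = 0))"


section \<open>Tableaux\<close>

text \<open>A partition is given by the list of its (nonzero) parts in weakly decreasing order.\<close>

definition is_partition :: "nat \<Rightarrow> nat list \<Rightarrow> bool" where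
  "is_partition n lam \<longleftrightarrow> sorted_wrt (\<ge>) lam \<and> 0 \<notin> set lam \<and> sum_list lam = n"

definition diagram :: "nat list \<Rightarrow> (nat \<times> nat) set" where
  "diagram lam = {(i, j). 1 \<le> i \<and> i \<le> length lam \<and> 1 \<le> j \<and> j \<le> lam ! (i - 1)}"

text \<open>
  A tableau is represented by a function that is zero outside the diagram. As permutations in
  \<open>Wn n\<close> fix zero, they act on tableaux by composition.
\<close>

type_synonym tableau = "nat \<times> nat \<Rightarrow> nat"

definition is_tableau :: "nat list \<Rightarrow> tableau \<Rightarrow> bool" where
  "is_tableau lam t \<longleftrightarrow>
     bij_betw t (diagram lam) {1..sum_list lam} \<and> (\<forall>c. c \<notin> diagram lam \<longrightarrow> t c = 0)"

definition STD :: "nat list \<Rightarrow> tableau set" where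
  "STD lam = {t. is_tableau lam t \<and>
     (\<forall>i i' j. (i, j) \<in> diagram lam \<and> (i', j) \<in> diagram lam \<and> i < i' \<longrightarrow> t (i, j) < t (i', j)) \<and>
     (\<forall>i j j'. (i, j) \<in> diagram lam \<and> (i, j') \<in> diagram lam \<and> j < j' \<longrightarrow> t (i, j) < t (i, j'))}"

text \<open>
  In a tableau filled in order, the entry of a cell is the number of cells up to and including it.
\<close>

definition row_tab :: "nat list \<Rightarrow> tableau" where
  "row_tab lam = (\<lambda>(i, j). if (i, j) \<in> diagram lam
     then card {(i', j') \<in> diagram lam. i' < i \<or> i' = i \<and> j' \<le> j} else 0)"

definition col_tab :: "nat list \<Rightarrow> tableau" where
  "col_tab lam = (\<lambda>(i, j). if (i, j) \<in> diagram lam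
     then card {(i', j') \<in> diagram lam. j' < j \<or> j' = j \<and> i' \<le> i} else 0)"

definition J_par :: "nat \<Rightarrow> nat list \<Rightarrow> perm set" where
  "J_par n lam = {simple_refl k | k. 1 \<le> k \<and> k < n \<and>
     (\<exists>i i' j. (i, j) \<in> diagram lam \<and> (i', j) \<in> diagram lam \<and>
        col_tab lam (i, j) = k \<and> col_tab lam (i', j) = k + 1)}"

definition W_par :: "nat \<Rightarrow> nat list \<Rightarrow> perm set" where
  "W_par n lam = generate (sym_group n) (J_par n lam)"

definition D_par :: "nat \<Rightarrow> nat list \<Rightarrow> perm set" where
  "D_par n lam = {d \<in> Wn n. \<forall>s \<in> J_par n lam. len n d < len n (d \<circ> s)}"

definition tab_perm :: "nat \<Rightarrow> nat list \<Rightarrow> tableau \<Rightarrow> perm" where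
  "tab_perm n lam t = (THE w. w \<in> Wn n \<and> w \<circ> col_tab lam = t)"

definition tab_less :: "nat \<Rightarrow> nat list \<Rightarrow> tableau \<Rightarrow> tableau \<Rightarrow> bool" where
  "tab_less n lam u t \<longleftrightarrow> bruhat_less n (tab_perm n lam u) (tab_perm n lam t)"

definition SA :: "nat \<Rightarrow> nat list \<Rightarrow> tableau \<Rightarrow> perm set" where
  "SA n lam t = (let w = tab_perm n lam t in
     {s \<in> simple_refls n. bruhat_less n w (s \<circ> w) \<and> s \<circ> t \<in> STD lam})"

definition SD :: "nat \<Rightarrow> nat list \<Rightarrow> tableau \<Rightarrow> perm set" where
  "SD n lam t = (let w = tab_perm n lam t in {s \<in> simple_refls n. bruhat_less n (s \<circ> w) w})"

definition WA :: "nat \<Rightarrow> nat list \<Rightarrow> tableau \<Rightarrow> perm set" where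
  "WA n lam t = (let w = tab_perm n lam t in
     {s \<in> simple_refls n. bruhat_less n w (s \<circ> w) \<and> s \<circ> w \<in> D_par n lam \<and> s \<circ> t \<notin> STD lam})"

definition WD :: "nat \<Rightarrow> nat list \<Rightarrow> tableau \<Rightarrow> perm set" where
  "WD n lam t = (let w = tab_perm n lam t in
     {s \<in> simple_refls n. bruhat_less n w (s \<circ> w) \<and> s \<circ> w \<notin> D_par n lam})"


section \<open>The Specht module\<close>

definition row_stab :: "nat \<Rightarrow> nat list \<Rightarrow> perm set" where
  "row_stab n lam = {w \<in> Wn n. \<forall>i j. (i, j) \<in> diagram lam \<longrightarrow>
     (\<exists>j'. (i, j') \<in> diagram lam \<and> w (row_tab lam (i, j)) = row_tab lam (i, j'))}"

definition x_elt :: "nat \<Rightarrow> nat list \<Rightarrow> free_elt set" where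
  "x_elt n lam = (\<Oplus>\<^bsub>hecke n\<^esub>w\<in>row_stab n lam. q ^ len n w \<odot>\<^bsub>hecke n\<^esub> T_elt n w)"

text \<open>Note that \<open>- q_inv\<close> is the inverse of \<open>- q\<close>.\<close>

definition y_elt :: "nat \<Rightarrow> nat list \<Rightarrow> free_elt set" where
  "y_elt n lam = (\<Oplus>\<^bsub>hecke n\<^esub>w\<in>W_par n lam. (- q_inv) ^ len n w \<odot>\<^bsub>hecke n\<^esub> T_elt n w)"

definition v_perm :: "nat \<Rightarrow> nat list \<Rightarrow> perm" where
  "v_perm n lam = tab_perm n lam (row_tab lam)"

definition specht :: "nat \<Rightarrow> nat list \<Rightarrow> free_elt set set" where
  "specht n lam =
     {h \<otimes>\<^bsub>hecke n\<^esub> (y_elt n lam \<otimes>\<^bsub>hecke n\<^esub> T_elt n (inv\<^bsub>sym_group n\<^esub> v_perm n lam) \<otimes>\<^bsub>hecke n\<^esub> x_elt n lam)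
      | h. h \<in> carrier (hecke n)}"

end

theory Submission
  imports Defs
begin

text \<open>
  Each column standard tableau \<open>d t\<^sub>\<lambda>\<close> gives the vector \<open>T\<^sub>d z\<close>, where \<open>z\<close> is the generator of the Specht
  module; we encode the tableau by the word of the columns of \<open>1, \<dots>, n\<close>. In the regular representation,
  \<open>z\<close> is an eigenvector of sign type for the column stabiliser and of trivial type for the row
  stabiliser, and an element that is of sign type on blocks larger than the columns and of trivial
  type on the rows is \<open>0\<close> by the pigeonhole principle. This yields two sorts of relations between the
  word vectors: Garnir relations, which straighten every word into lattice words that dominate it,
  that is, into standard tableaux below in the Bruhat order, and relations obtained by turning one
  letter \<open>j\<close> into \<open>j + 1\<close> in all possible ways. Applying the latter at the first minimum of the lattice
  path, as for crystal operators, shows that a word that is not a lattice word straightens with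
  coefficients in \<open>q \<int>[q]\<close>; the quadratic relation of \<open>T\<^sub>s\<close> forces the diagonal one to be \<open>q\<close>. The
  standard word vectors are linearly independent, because they are so at \<open>q = 1\<close> and a linear
  relation can be divided by \<open>q - 1\<close>.
\<close>

section \<open>Laurent polynomials\<close>

text \<open>The obstacle is the degree bound: straightening by Garnir relations yields mere Laurent
  polynomials. The weighted relation that turns a letter \<open>j\<close> into \<open>j + 1\<close>
  contains two kinds of words besides the given one: those changed further left, whose path is
  deeper, so that induction reaches them, and those changed further right, about which nothing
  better is known than about the given word, but which carry a factor of order at least one. So one
  pass gains one degree over a bound valid for all words. Words are finite in number, which gives a
  first common bound \<open>- int k\<close>; lattice words have coefficients 0 and 1, so passes lift
  the bound to 0, and a last pass lifts it to 1 for the other words. For a weak ascent the diagonal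
  coefficient is a root of \<open>x * x = 1 + q_diff * x\<close>, that is \<open>q\<close> or
  \<open>- q_inv\<close>, and the degree bound excludes the second root. All vanishing statements
  rest on one fact: two values of a function on the group are related by a factor
  \<open>- (q ^ a)\<close> through antisymmetry and by \<open>q ^ b\<close> through symmetry, and
  \<open>q ^ a + q ^ b\<close> is nonzero already at \<open>q = 1\<close>.\<close>

definition q_diff :: laurent where "q_diff = q - q_inv"

lemma q_mult_q_inv: "q * q_inv = 1"
  by (simp add: q_def q_inv_def mult_single)

lemma q_inv_mult_q: "q_inv * q = 1"
  by (simp add: q_def q_inv_def mult_single)

text \<open>The power \<open>(- q) ^ k\<close> for integers \<open>k\<close>. Relations of sign type
  carry such weights, which change by a factor \<open>- q\<close> or \<open>- q_inv\<close> when
  neighbouring places are exchanged.\<close>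

definition mq :: "int \<Rightarrow> laurent" where
  "mq k = Poly_Mapping.single k (if even k then 1 else - 1)"

lemma mq_0: "mq 0 = 1"
  by (simp add: mq_def)

lemma mq_add: "mq (k + l) = mq k * mq l"
  by (auto simp: mq_def mult_single)

lemma mq_1: "mq 1 = - q"
  by (simp add: mq_def q_def single_uminus)

lemma mq_minus_1: "mq (- 1) = - q_inv"
  by (simp add: mq_def q_inv_def single_uminus)

lemma mq_Suc: "mq (k + 1) = - q * mq k"
  by (simp add: mq_add mq_1 mult.commute)

lemma mq_pred: "mq (k - 1) = - q_inv * mq k"
  using mq_add[of k "- 1"] by (simp add: mq_minus_1 mult.commute)

lemma mq_inverse: "mq k * mq (- k) = 1"
  by (metis mq_0 mq_add add.right_inverse)

text \<open>The filtration by order at \<open>q = 0\<close>. It turns membership in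
  \<open>q_polys\<close> into a bound that can be raised one step at a time.\<close>

definition val_ge :: "int \<Rightarrow> laurent set" where
  "val_ge m = {f. \<forall>k \<in> Poly_Mapping.keys f. m \<le> k}"

lemma val_ge_0 [simp]: "0 \<in> val_ge m"
  by (simp add: val_ge_def)

lemma val_ge_add: "f \<in> val_ge m \<Longrightarrow> g \<in> val_ge m \<Longrightarrow> f + g \<in> val_ge m"
  using keys_add[of f g] by (auto simp: val_ge_def)

lemma val_ge_uminus: "f \<in> val_ge m \<Longrightarrow> - f \<in> val_ge m"
  by (simp add: val_ge_def in_keys_iff)

lemma val_ge_sum: "(\<And>i. i \<in> I \<Longrightarrow> f i \<in> val_ge m) \<Longrightarrow> sum f I \<in> val_ge m"
  by (induction I rule: infinite_finite_induct) (auto intro: val_ge_add)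

lemma val_ge_mult: "f \<in> val_ge m \<Longrightarrow> g \<in> val_ge l \<Longrightarrow> f * g \<in> val_ge (m + l)"
  using keys_mult[of f g] by (force simp: val_ge_def)

lemma val_ge_mono: "f \<in> val_ge m \<Longrightarrow> l \<le> m \<Longrightarrow> f \<in> val_ge l"
  by (force simp: val_ge_def)

lemma mq_val_ge: "mq k \<in> val_ge k"
  by (simp add: val_ge_def mq_def)

lemma ex_val_ge: "\<exists>k::nat. f \<in> val_ge (- int k)"
proof -
  have "\<exists>m::int. \<forall>k \<in> Poly_Mapping.keys f. m \<le> k"
    by (meson finite_keys bdd_below_finite bdd_below.unfold)
  then obtain m where m: "\<forall>k \<in> Poly_Mapping.keys f. m \<le> k" by blast
  then have "f \<in> val_ge (- int (nat (- m)))" by (force simp: val_ge_def)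
  then show ?thesis ..
qed

lemma q_polys_val_ge: "q_polys = val_ge 1"
  by (auto simp: q_polys_def val_ge_def)

text \<open>Specialisation at \<open>q = 1\<close>, where \<open>q_diff\<close> vanishes and the
  Hecke algebra becomes the group ring.\<close>

definition at_one :: "laurent \<Rightarrow> int" where
  "at_one f = (\<Sum>k \<in> Poly_Mapping.keys f. Poly_Mapping.lookup f k)"

lemma at_one_superset:
  "finite K \<Longrightarrow> Poly_Mapping.keys f \<subseteq> K \<Longrightarrow> at_one f = (\<Sum>k \<in> K. Poly_Mapping.lookup f k)"
  unfolding at_one_def by (rule sum.mono_neutral_left) (auto simp: in_keys_iff)

lemma at_one_single [simp]: "at_one (Poly_Mapping.single k c) = c"
  by (simp add: at_one_def)

lemma at_one_0 [simp]: "at_one 0 = 0"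
  by (simp add: at_one_def)

lemma at_one_1 [simp]: "at_one 1 = 1"
  using at_one_single[of 0 1] by simp

lemma at_one_add: "at_one (f + g) = at_one f + at_one g"
proof -
  let ?K = "Poly_Mapping.keys f \<union> Poly_Mapping.keys g"
  have "at_one (f + g) = (\<Sum>k \<in> ?K. Poly_Mapping.lookup (f + g) k)"
    by (rule at_one_superset) (use keys_add[of f g] in auto)
  also have "\<dots> = at_one f + at_one g"
    by (simp add: lookup_add sum.distrib at_one_superset[of ?K f] at_one_superset[of ?K g])
  finally show ?thesis .
qed

lemma at_one_uminus: "at_one (- f) = - at_one f"
  using at_one_add[of f "- f"] by simp

lemma at_one_diff: "at_one (f - g) = at_one f - at_one g"
  using at_one_add[of f "- g"] by (simp add: at_one_uminus)

lemma at_one_sum: "at_one (sum f I) = (\<Sum>i\<in>I. at_one (f i))"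
  by (induction I rule: infinite_finite_induct) (auto simp: at_one_add)

lemma sum_singles:
  "(\<Sum>k \<in> Poly_Mapping.keys f. Poly_Mapping.single k (Poly_Mapping.lookup f k)) = f"
  by (rule poly_mapping_eqI)
    (auto simp: lookup_sum lookup_single when_def in_keys_iff)

lemma at_one_mult: "at_one (f * g) = at_one f * at_one g"
proof -
  have "at_one (f * g) = at_one
      ((\<Sum>k \<in> Poly_Mapping.keys f. Poly_Mapping.single k (Poly_Mapping.lookup f k)) *
       (\<Sum>k \<in> Poly_Mapping.keys g. Poly_Mapping.single k (Poly_Mapping.lookup g k)))"
    by (simp add: sum_singles)
  also have "\<dots> = at_one f * at_one g"
    by (simp add: sum_product mult_single at_one_sum) (simp add: at_one_def sum_product)
  finally show ?thesis .
qed

lemma at_one_q_diff: "at_one q_diff = 0"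
  by (simp add: q_diff_def at_one_diff q_def q_inv_def)

text \<open>
  The coefficients of the quotient of \<open>f\<close> by \<open>q - 1\<close> are the negatives of the partial sums of the
  coefficients of \<open>f\<close>.
\<close>

lemma at_one_eq_0_divisible:
  assumes "at_one f = 0" and keys: "Poly_Mapping.keys f \<subseteq> {lo..lo + int d}"
  obtains g where "f = (q - 1) * g" "Poly_Mapping.keys g \<subseteq> {lo..<lo + int d}"
proof -
  define c where "c k = - (\<Sum>l \<in> {lo..k}. Poly_Mapping.lookup f l)" for k
  define g where "g = (\<Sum>k \<in> {lo..<lo + int d}. Poly_Mapping.single k (c k))"
  have lg: "Poly_Mapping.lookup g k = (if k \<in> {lo..<lo + int d} then c k else 0)" for k
    by (simp add: g_def lookup_sum lookup_single when_def)
  have c0: "c k = 0" if "k < lo" for k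
    using that by (simp add: c_def)
  have c1: "c k = 0" if "k \<ge> lo + int d" for k
    using assms(1) at_one_superset[of "{lo..k}" f] keys that by (force simp: c_def)
  have lg: "Poly_Mapping.lookup g k = c k" for k
    using lg[of k] c0[of k] c1[of k] by auto
  have step: "c (k - 1) - c k = Poly_Mapping.lookup f k" for k
  proof (cases "k < lo")
    case True
    then have "k \<notin> Poly_Mapping.keys f" using keys by auto
    then show ?thesis using True by (simp add: c_def in_keys_iff)
  next
    case False
    then have "{lo..k} = insert k {lo..k - 1}" by auto
    then show ?thesis by (simp add: c_def)
  qed
  have "Poly_Mapping.lookup ((q - 1) * g) k = Poly_Mapping.lookup f k" for k
  proof -
    have "q * g = (\<Sum>l \<in> {lo..<lo + int d}. Poly_Mapping.single (l + 1) (c l))"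
      by (simp add: g_def q_def sum_distrib_left mult_single add.commute)
    then have "Poly_Mapping.lookup (q * g) k
        = (\<Sum>l \<in> {lo..<lo + int d}. if l = k - 1 then c l else 0)"
      by (simp add: lookup_sum lookup_single when_def eq_diff_eq)
    also have "\<dots> = c (k - 1)"
      using lg[of "k - 1"] by (auto simp: c0 c1)
    finally show ?thesis
      by (simp add: left_diff_distrib lookup_minus lg step)
  qed
  then have "f = (q - 1) * g"
    by (metis poly_mapping_eqI)
  moreover have "Poly_Mapping.keys g \<subseteq> {lo..<lo + int d}"
  proof
    fix k assume "k \<in> Poly_Mapping.keys g"
    then have "c k \<noteq> 0" by (simp add: in_keys_iff lg)
    then show "k \<in> {lo..<lo + int d}" using c0[of k] c1[of k] by force
  qed
  ultimately show ?thesis using that by blast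
qed

lemma q_minus_1_nonzero: "q - 1 \<noteq> 0"
proof
  assume "q - 1 = 0"
  then have "Poly_Mapping.lookup q 1 = Poly_Mapping.lookup 1 (1::int)" by simp
  then show False by (simp add: q_def lookup_one)
qed

section \<open>Inversions\<close>

text \<open>The map \<open>c\<close> may repeat values: for permutations the count is the length,
  for words it is the measure of sorting inductions and the exponent in alternating sums.\<close>

definition invs :: "nat \<Rightarrow> (nat \<Rightarrow> nat) \<Rightarrow> (nat \<times> nat) set" where
  "invs n c = {(a, b). 1 \<le> a \<and> a < b \<and> b \<le> n \<and> c b < c a}"

definition ninv :: "nat \<Rightarrow> (nat \<Rightarrow> nat) \<Rightarrow> nat" where
  "ninv n c = card (invs n c)"

lemma finite_invs: "finite (invs n c)"
  by (rule finite_subset[of _ "{1..n} \<times> {1..n}"]) (auto simp: invs_def)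

lemma simple_refl_apply:
  "simple_refl i x = (if x = i then Suc i else if x = Suc i then i else x)"
  by (auto simp: simple_refl_def transpose_def)

lemma simple_refl_invol [simp]: "simple_refl i (simple_refl i x) = x"
  by (simp add: simple_refl_def)

lemma simple_refl_comp [simp]: "simple_refl i \<circ> simple_refl i = id"
  by (simp add: fun_eq_iff)

text \<open>Applying the exchange to both members of a pair carries the old inversions bijectively
  to new ones, and \<open>(i, Suc i)\<close> is the only inversion not reached.\<close>

lemma ninv_ascent:
  assumes i: "1 \<le> i" "i < n" and asc: "c i < c (Suc i)"
  shows "ninv n (c \<circ> simple_refl i) = Suc (ninv n c)"
proof -
  let ?s = "simple_refl i"
  let ?f = "\<lambda>(a, b). (?s a, ?s b)"
  have "invs n (c \<circ> ?s) = insert (i, Suc i) (?f ` invs n c)" (is "?A = insert _ ?B")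
  proof (rule Set.set_eqI)
    fix x :: "nat \<times> nat"
    obtain a b where x: "x = (a, b)" by (cases x)
    have inB: "(a, b) \<in> ?B \<longleftrightarrow> (?s a, ?s b) \<in> invs n c"
      by (auto simp: image_iff intro!: bexI[of _ "(?s a, ?s b)"])
    show "x \<in> ?A \<longleftrightarrow> x \<in> insert (i, Suc i) ?B"
      unfolding x insert_iff inB using i asc
      by (auto simp: invs_def simple_refl_apply split: if_splits)
  qed
  moreover have "(i, Suc i) \<notin> ?f ` invs n c"
    using asc by (auto simp: invs_def simple_refl_apply split: if_splits)
  moreover have "inj_on ?f (invs n c)"
    by (rule inj_on_inverseI[where g = ?f]) auto
  ultimately show ?thesis
    by (simp add: ninv_def card_image finite_invs)
qed

lemma ninv_descent:
  assumes i: "1 \<le> i" "i < n" and desc: "c (Suc i) < c i"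
  shows "ninv n c = Suc (ninv n (c \<circ> simple_refl i))"
proof -
  have "ninv n ((c \<circ> simple_refl i) \<circ> simple_refl i) = Suc (ninv n (c \<circ> simple_refl i))"
    by (rule ninv_ascent) (use i desc in \<open>auto simp: simple_refl_apply\<close>)
  then show ?thesis by (simp add: comp_assoc)
qed

lemma comp_simple_refl_eq: "c i = c (Suc i) \<Longrightarrow> c \<circ> simple_refl i = c"
  by (auto simp: fun_eq_iff simple_refl_apply)

text \<open>Conjugation by \<open>simple_refl a\<close> reduces to a transposition over a shorter
  distance. Comparing \<open>c a\<close> with \<open>c (Suc a)\<close> shows that the two outer
  exchanges cannot undo the gain of the inner one.\<close>

lemma ninv_transpose:
  assumes "1 \<le> a" "a < b" "b \<le> n" "c a < c b"
  shows "ninv n c < ninv n (c \<circ> transpose a b)"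
  using assms
proof (induction "b - a" arbitrary: a c)
  case 0
  then show ?case by simp
next
  case (Suc k)
  show ?case
  proof (cases "b = Suc a")
    case True
    then show ?thesis using Suc.prems ninv_ascent[of a n c] by (simp add: simple_refl_def)
  next
    case False
    let ?s = "simple_refl a"
    let ?g = "c \<circ> ?s"
    let ?h = "?g \<circ> transpose (Suc a) b"
    have less: "ninv n ?g < ninv n ?h"
      by (rule Suc.hyps(1)) (use Suc.prems Suc.hyps(2) False in \<open>auto simp: simple_refl_apply\<close>)
    have eq: "c \<circ> transpose a b = ?h \<circ> ?s"
      using Suc.prems False by (auto simp: fun_eq_iff simple_refl_apply transpose_def)
    have ha: "?h a = c (Suc a)" "?h (Suc a) = c b"
      using Suc.prems False by (auto simp: simple_refl_apply transpose_def)
    have a: "1 \<le> a" "a < n" using Suc.prems by auto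
    consider "c a < c (Suc a)" | "c (Suc a) < c a" | "c a = c (Suc a)" by linarith
    then show ?thesis
    proof cases
      case 1
      have "ninv n ?h \<le> Suc (ninv n (?h \<circ> ?s))"
      proof (cases "?h a < ?h (Suc a)")
        case True
        then show ?thesis using ninv_ascent[OF a True] by linarith
      next
        case False
        then consider "?h (Suc a) < ?h a" | "?h a = ?h (Suc a)" by linarith
        then show ?thesis
        proof cases
          case 1
          show ?thesis using ninv_descent[OF a 1] by linarith
        next
          case 2
          show ?thesis unfolding comp_simple_refl_eq[OF 2] by simp
        qed
      qed
      then show ?thesis using less ninv_ascent[OF a 1] unfolding eq by linarith
    next
      case 2
      have "ninv n (?h \<circ> ?s) = Suc (ninv n ?h)"
        by (rule ninv_ascent[OF a]) (use ha 2 Suc.prems in linarith)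
      then show ?thesis using less ninv_descent[OF a 2] unfolding eq by linarith
    next
      case 3
      have "ninv n (?h \<circ> ?s) = Suc (ninv n ?h)"
        by (rule ninv_ascent[OF a]) (use ha 3 Suc.prems in linarith)
      then show ?thesis using less comp_simple_refl_eq[OF 3] unfolding eq by simp
    qed
  qed
qed

section \<open>The length function\<close>

lemma Wn_iff: "w \<in> Wn n \<longleftrightarrow> w permutes {1..n}"
  by (rule sym_group_carrier)

lemma Wn_id [simp]: "id \<in> Wn n"
  by (simp add: Wn_iff permutes_id)

lemma Wn_comp: "u \<in> Wn n \<Longrightarrow> w \<in> Wn n \<Longrightarrow> u \<circ> w \<in> Wn n"
  by (simp add: Wn_iff permutes_compose)

lemma Wn_inv: "w \<in> Wn n \<Longrightarrow> inv' w \<in> Wn n"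
  by (simp add: Wn_iff permutes_inv)

lemma Wn_inv_apply: "w \<in> Wn n \<Longrightarrow> w (inv' w x) = x" "w \<in> Wn n \<Longrightarrow> inv' w (w x) = x"
  by (auto simp: Wn_iff permutes_inverses)

lemma Wn_inv_comp: "w \<in> Wn n \<Longrightarrow> w \<circ> inv' w = id" "w \<in> Wn n \<Longrightarrow> inv' w \<circ> w = id"
  by (auto simp: Wn_iff permutes_inv_o)

lemma Wn_inv_inv: "w \<in> Wn n \<Longrightarrow> inv' (inv' w) = w"
  by (simp add: Wn_iff permutes_inv_inv)

lemma Wn_comp_inv: "u \<in> Wn n \<Longrightarrow> w \<in> Wn n \<Longrightarrow> inv' (u \<circ> w) = inv' w \<circ> inv' u"
  by (simp add: Wn_iff permutes_bij o_inv_distrib)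

lemma Wn_inj: "w \<in> Wn n \<Longrightarrow> w x = w y \<longleftrightarrow> x = y"
  by (metis Wn_inv_apply(2))

lemma Wn_in: "w \<in> Wn n \<Longrightarrow> w x \<in> {1..n} \<longleftrightarrow> x \<in> {1..n}"
  unfolding Wn_iff by (rule permutes_in_image)

lemma finite_Wn [simp]: "finite (Wn n)"
  by (simp add: sym_group_def finite_permutations)

lemma simple_reflsE:
  assumes "s \<in> simple_refls n"
  obtains i where "s = simple_refl i" "1 \<le> i" "i < n"
  using assms by (auto simp: simple_refls_def)

lemma simple_refl_in: "1 \<le> i \<Longrightarrow> i < n \<Longrightarrow> simple_refl i \<in> simple_refls n"
  by (auto simp: simple_refls_def)

lemma simple_refl_Wn: "1 \<le> i \<Longrightarrow> i < n \<Longrightarrow> simple_refl i \<in> Wn n"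
  by (simp add: Wn_iff simple_refl_def permutes_swap_id)

lemma simple_refls_Wn: "s \<in> simple_refls n \<Longrightarrow> s \<in> Wn n"
  by (auto elim!: simple_reflsE intro: simple_refl_Wn)

lemma inv_simple_refl [simp]: "inv' (simple_refl i) = simple_refl i"
  by (rule inv_unique_comp) simp_all

lemma word_prod_simps [simp]: "word_prod [] = id" "word_prod (s # ss) = s \<circ> word_prod ss"
  by (simp_all add: word_prod_def)

lemma word_prod_append: "word_prod (ss @ ts) = word_prod ss \<circ> word_prod ts"
  by (induction ss) (auto simp: comp_assoc)

lemma word_prod_Wn: "set ss \<subseteq> simple_refls n \<Longrightarrow> word_prod ss \<in> Wn n"
  by (induction ss) (auto intro: Wn_comp simple_refls_Wn)

lemma ninv_inv:
  assumes w: "w \<in> Wn n"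
  shows "ninv n (inv' w) = ninv n w"
proof -
  have "bij_betw (\<lambda>(a, b). (w b, w a)) (invs n w) (invs n (inv' w))"
  proof (rule bij_betwI[where g = "\<lambda>(a, b). (inv' w b, inv' w a)"])
    have "1 \<le> w x" "w x \<le> n" "1 \<le> inv' w x" "inv' w x \<le> n" if "1 \<le> x" "x \<le> n" for x
      using Wn_in[OF w, of x] Wn_in[OF Wn_inv[OF w], of x] that by simp_all
    then show "(\<lambda>(a, b). (w b, w a)) \<in> invs n w \<rightarrow> invs n (inv' w)"
      and "(\<lambda>(a, b). (inv' w b, inv' w a)) \<in> invs n (inv' w) \<rightarrow> invs n w"
      by (auto simp: invs_def Wn_inv_apply[OF w])
  qed (auto simp: Wn_inv_apply[OF w])
  then show ?thesis by (simp add: ninv_def bij_betw_same_card)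
qed

lemma Wn_adjacent_neq: "w \<in> Wn n \<Longrightarrow> w i < w (Suc i) \<or> w (Suc i) < w i"
  using Wn_inj[of w n i "Suc i"] by auto

lemma ninv_comp_le: "1 \<le> i \<Longrightarrow> i < n \<Longrightarrow> ninv n (c \<circ> simple_refl i) \<le> Suc (ninv n c)"
proof (cases "c i" "c (Suc i)" rule: linorder_cases)
  case equal
  show ?thesis unfolding comp_simple_refl_eq[of c i, OF equal] by simp
qed (use ninv_ascent[of i n c] ninv_descent[of i n c] in linarith)+

lemma ninv_word_prod: "set ss \<subseteq> simple_refls n \<Longrightarrow> ninv n (word_prod ss) \<le> length ss"
proof (induction ss rule: rev_induct)
  case Nil
  have "invs n id = {}" by (auto simp: invs_def)
  then show ?case by (simp only: word_prod_simps ninv_def) simp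
next
  case (snoc s ss)
  then obtain i where i: "s = simple_refl i" "1 \<le> i" "i < n"
    by (auto elim: simple_reflsE)
  have "ninv n (word_prod ss \<circ> simple_refl i) \<le> Suc (ninv n (word_prod ss))"
    using i by (intro ninv_comp_le)
  moreover have "word_prod (ss @ [s]) = word_prod ss \<circ> simple_refl i"
    unfolding word_prod_append word_prod_simps o_id i by (rule refl)
  ultimately have "ninv n (word_prod (ss @ [s])) \<le> Suc (ninv n (word_prod ss))"
    by (simp only:)
  then show ?case using snoc by (simp del: word_prod_simps)
qed

lemma no_descent_mono:
  fixes c :: "nat \<Rightarrow> nat"
  assumes "\<And>i. lo \<le> i \<Longrightarrow> i < hi \<Longrightarrow> c i \<le> c (Suc i)" "lo \<le> x" "x \<le> y" "y \<le> hi"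
  shows "c x \<le> c y"
  using assms(3,4)
proof (induction y rule: dec_induct)
  case (step y)
  have "c y \<le> c (Suc y)" by (rule assms(1)) (use step assms(2) in auto)
  then show ?case using step by simp
qed simp

lemma Wn_no_descent_id:
  assumes w: "w \<in> Wn n" and "\<And>i. 1 \<le> i \<Longrightarrow> i < n \<Longrightarrow> w i < w (Suc i)"
  shows "w = id"
proof -
  have ge: "x \<le> w x" if "1 \<le> x" "x \<le> n" for x
    using that
  proof (induction x rule: dec_induct)
    case base
    then show ?case using Wn_in[OF w, of 1] by simp
  next
    case (step x)
    then show ?case using assms(2)[of x] by simp
  qed
  show ?thesis
    by (rule permutes_natset_ge[of w "{1..n}"]) (use w ge in \<open>simp_all add: Wn_iff\<close>)
qed

lemma ex_word_ninv:
  "w \<in> Wn n \<Longrightarrow> \<exists>ss. set ss \<subseteq> simple_refls n \<and> word_prod ss = w \<and> length ss = ninv n w"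
proof (induction "ninv n w" arbitrary: w rule: less_induct)
  case less
  show ?case
  proof (cases "\<exists>i. 1 \<le> i \<and> i < n \<and> w (Suc i) < w i")
    case True
    then obtain i where i: "1 \<le> i" "i < n" "w (Suc i) < w i" by blast
    let ?u = "w \<circ> simple_refl i"
    have u: "ninv n w = Suc (ninv n ?u)" by (rule ninv_descent) (use i in auto)
    have "?u \<in> Wn n" using less.prems i by (intro Wn_comp simple_refl_Wn)
    with u less.hyps[of ?u] obtain ss where
      "set ss \<subseteq> simple_refls n" "word_prod ss = ?u" "length ss = ninv n ?u" by auto
    with u i show ?thesis
      by (intro exI[of _ "ss @ [simple_refl i]"]) (auto simp: word_prod_append comp_assoc simple_refl_in)
  next
    case False
    then have "w = id"
      using Wn_adjacent_neq[OF less.prems] by (intro Wn_no_descent_id[OF less.prems]) blast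
    then have "invs n w = {}" by (auto simp: invs_def)
    with \<open>w = id\<close> show ?thesis by (intro exI[of _ "[]"]) (simp add: ninv_def)
  qed
qed

text \<open>One letter changes the number of inversions by at most one, and sorting by adjacent
  exchanges uses exactly one letter per inversion.\<close>

lemma len_eq_ninv:
  assumes w: "w \<in> Wn n"
  shows "len n w = ninv n w"
  unfolding len_def
proof (rule Least_equality)
  show "\<exists>ss. set ss \<subseteq> simple_refls n \<and> word_prod ss = w \<and> length ss = ninv n w"
    using ex_word_ninv[OF w] .
qed (use ninv_word_prod in auto)

lemma len_comp_right:
  assumes "w \<in> Wn n" "1 \<le> i" "i < n"
  shows "w i < w (Suc i) \<Longrightarrow> len n (w \<circ> simple_refl i) = Suc (len n w)"
    and "w (Suc i) < w i \<Longrightarrow> len n w = Suc (len n (w \<circ> simple_refl i))"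
  using assms ninv_ascent[of i n w] ninv_descent[of i n w]
  by (simp_all add: len_eq_ninv Wn_comp simple_refl_Wn)

lemma len_inv: "w \<in> Wn n \<Longrightarrow> len n (inv' w) = len n w"
  by (simp add: len_eq_ninv Wn_inv ninv_inv)

lemma inv_comp_left: "w \<in> Wn n \<Longrightarrow> 1 \<le> i \<Longrightarrow> i < n \<Longrightarrow> inv' (simple_refl i \<circ> w) = inv' w \<circ> simple_refl i"
  using Wn_comp_inv[OF simple_refl_Wn, of i n w] by simp

lemma len_comp_left:
  assumes "w \<in> Wn n" "1 \<le> i" "i < n"
  shows "inv' w i < inv' w (Suc i) \<Longrightarrow> len n (simple_refl i \<circ> w) = Suc (len n w)"
    and "inv' w (Suc i) < inv' w i \<Longrightarrow> len n w = Suc (len n (simple_refl i \<circ> w))"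
  using len_comp_right[OF Wn_inv[OF assms(1)] assms(2,3)] assms
  by (simp_all add: inv_comp_left[symmetric] len_inv Wn_comp simple_refl_Wn)

lemma len_left_less_iff:
  assumes "w \<in> Wn n" "1 \<le> i" "i < n"
  shows "len n w < len n (simple_refl i \<circ> w) \<longleftrightarrow> inv' w i < inv' w (Suc i)"
    and "len n (simple_refl i \<circ> w) < len n w \<longleftrightarrow> inv' w (Suc i) < inv' w i"
  using len_comp_left[OF assms] Wn_adjacent_neq[OF Wn_inv[OF assms(1)], of i] by fastforce+

lemma len_right_less_iff:
  assumes "w \<in> Wn n" "1 \<le> i" "i < n"
  shows "len n w < len n (w \<circ> simple_refl i) \<longleftrightarrow> w i < w (Suc i)"
    and "len n (w \<circ> simple_refl i) < len n w \<longleftrightarrow> w (Suc i) < w i"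
  using len_comp_right[OF assms] Wn_adjacent_neq[OF assms(1), of i] by fastforce+

lemma ex_reduced_word: "w \<in> Wn n \<Longrightarrow> \<exists>ss. reduced_word n w ss"
  using ex_word_ninv by (force simp: reduced_word_def len_eq_ninv)

lemma len_word_prod: "set ss \<subseteq> simple_refls n \<Longrightarrow> len n (word_prod ss) \<le> length ss"
  by (simp add: len_eq_ninv word_prod_Wn ninv_word_prod)

lemma len_id: "len n id = 0"
  using len_word_prod[of "[]"] by simp

section \<open>The free algebra modulo the Hecke relations\<close>

abbreviation FC :: "nat \<Rightarrow> free_elt set" where
  "FC n \<equiv> carrier (free_alg n)"

lemma free_alg_simps [simp]:
  "f \<otimes>\<^bsub>free_alg n\<^esub> g = f * g" "f \<oplus>\<^bsub>free_alg n\<^esub> g = f + g"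
  "\<one>\<^bsub>free_alg n\<^esub> = 1" "\<zero>\<^bsub>free_alg n\<^esub> = 0"
  by (simp_all add: free_alg_def)

lemma letters_plus [simp]: "letters (u + v) = letters u @ letters v"
  by (simp add: plus_free_mon_def)

lemma letters_0 [simp]: "letters 0 = []"
  by (simp add: zero_free_mon_def)

lemma FC_iff: "f \<in> FC n \<longleftrightarrow> (\<forall>w \<in> Poly_Mapping.keys f. set (letters w) \<subseteq> simple_refls n)"
  by (simp add: free_alg_def)

lemma FC_add: "f \<in> FC n \<Longrightarrow> g \<in> FC n \<Longrightarrow> f + g \<in> FC n"
  using keys_add[of f g] by (auto simp: FC_iff)

lemma FC_uminus: "f \<in> FC n \<Longrightarrow> - f \<in> FC n"
  by (simp add: FC_iff in_keys_iff)

lemma FC_diff: "f \<in> FC n \<Longrightarrow> g \<in> FC n \<Longrightarrow> f - g \<in> FC n"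
  using FC_add[OF _ FC_uminus, of f n g] by simp

lemma FC_0: "0 \<in> FC n"
  by (simp add: FC_iff)

lemma FC_1: "1 \<in> FC n"
  by (simp add: FC_iff)

lemma FC_mult: "f \<in> FC n \<Longrightarrow> g \<in> FC n \<Longrightarrow> f * g \<in> FC n"
  using keys_mult[of f g] by (fastforce simp: FC_iff)

lemma FC_single: "set (letters w) \<subseteq> simple_refls n \<Longrightarrow> Poly_Mapping.single w c \<in> FC n"
  by (simp add: FC_iff)

lemma FC_const: "free_const a \<in> FC n"
  by (simp add: free_const_def FC_single)

lemma FC_gen: "s \<in> simple_refls n \<Longrightarrow> free_gen s \<in> FC n"
  by (simp add: free_gen_def FC_single)

lemma FC_sum: "(\<And>i. i \<in> I \<Longrightarrow> f i \<in> FC n) \<Longrightarrow> sum f I \<in> FC n"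
  by (induction I rule: infinite_finite_induct) (auto intro: FC_add FC_0)

lemma free_alg_ring: "ring (free_alg n)"
proof (rule ringI)
  show "abelian_group (free_alg n)"
    by (rule abelian_groupI)
      (auto intro: FC_add FC_0 FC_uminus simp: ac_simps intro!: bexI[of _ "- _"])
  show "Group.monoid (free_alg n)"
    by (rule Group.monoidI) (auto intro: FC_mult FC_1 simp: mult.assoc)
qed (auto simp: algebra_simps)

lemma hecke_rels_FC: "hecke_rels n \<subseteq> FC n"
  unfolding hecke_rels_def
  by (auto intro!: FC_diff FC_mult FC_add FC_1 FC_const FC_gen simple_refl_in)

lemma hecke_ideal: "ideal (hecke_ideal n) (free_alg n)"
  unfolding hecke_ideal_def by (rule ring.genideal_ideal[OF free_alg_ring hecke_rels_FC])

lemma hecke_rels_ideal: "hecke_rels n \<subseteq> hecke_ideal n"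
  unfolding hecke_ideal_def by (rule ring.genideal_self[OF free_alg_ring hecke_rels_FC])

lemma ideal_add: "f \<in> hecke_ideal n \<Longrightarrow> g \<in> hecke_ideal n \<Longrightarrow> f + g \<in> hecke_ideal n"
  using additive_subgroup.a_closed[OF ideal.axioms(1)[OF hecke_ideal]] by force

lemma ideal_0: "0 \<in> hecke_ideal n"
  using additive_subgroup.zero_closed[OF ideal.axioms(1)[OF hecke_ideal]] by force

lemma ideal_left: "f \<in> hecke_ideal n \<Longrightarrow> h \<in> FC n \<Longrightarrow> h * f \<in> hecke_ideal n"
  using ideal.I_l_closed[OF hecke_ideal, of f n h] by simp

lemma ideal_right: "f \<in> hecke_ideal n \<Longrightarrow> h \<in> FC n \<Longrightarrow> f * h \<in> hecke_ideal n"
  using ideal.I_r_closed[OF hecke_ideal, of f n h] by simp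

lemma ideal_uminus: "f \<in> hecke_ideal n \<Longrightarrow> - f \<in> hecke_ideal n"
  using ideal_left[of f n "- 1"] FC_uminus[OF FC_1, of n] by simp

text \<open>Computing with representatives modulo the ideal keeps the arithmetic in the free
  algebra; \<open>hecke_class_eq_iff\<close> carries the results over to cosets.\<close>

definition hcong :: "nat \<Rightarrow> free_elt \<Rightarrow> free_elt \<Rightarrow> bool" where
  "hcong n f g \<longleftrightarrow> f \<in> FC n \<and> g \<in> FC n \<and> f - g \<in> hecke_ideal n"

lemma hcong_refl: "f \<in> FC n \<Longrightarrow> hcong n f f"
  by (simp add: hcong_def ideal_0)

lemma hcong_sym: "hcong n f g \<Longrightarrow> hcong n g f"
  using ideal_uminus[of "f - g" n] by (simp add: hcong_def)

lemma hcong_trans [trans]: "hcong n f g \<Longrightarrow> hcong n g h \<Longrightarrow> hcong n f h"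
  using ideal_add[of "f - g" n "g - h"] by (simp add: hcong_def)

lemma hcong_add: "hcong n f f' \<Longrightarrow> hcong n g g' \<Longrightarrow> hcong n (f + g) (f' + g')"
  using ideal_add[of "f - f'" n "g - g'"] by (simp add: hcong_def FC_add algebra_simps)

lemma hcong_left: "hcong n f g \<Longrightarrow> h \<in> FC n \<Longrightarrow> hcong n (h * f) (h * g)"
  using ideal_left[of "f - g" n h] by (simp add: hcong_def FC_mult algebra_simps)

lemma hcong_right: "hcong n f g \<Longrightarrow> h \<in> FC n \<Longrightarrow> hcong n (f * h) (g * h)"
  using ideal_right[of "f - g" n h] by (simp add: hcong_def FC_mult algebra_simps)

lemma hcong_sum: "(\<And>i. i \<in> I \<Longrightarrow> hcong n (f i) (g i)) \<Longrightarrow> hcong n (sum f I) (sum g I)"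
  by (induction I rule: infinite_finite_induct) (auto intro: hcong_add hcong_refl FC_0)

lemma hecke_class_eq_iff:
  assumes "f \<in> FC n" "g \<in> FC n"
  shows "hecke_class n f = hecke_class n g \<longleftrightarrow> hcong n f g"
proof -
  interpret I: ideal "hecke_ideal n" "free_alg n" by (rule hecke_ideal)
  have minus: "f \<ominus>\<^bsub>free_alg n\<^esub> g = f - g"
  proof -
    have "\<ominus>\<^bsub>free_alg n\<^esub> g = - g"
      by (rule I.minus_equality) (use assms in \<open>auto intro: FC_uminus\<close>)
    then show ?thesis by (simp add: a_minus_def)
  qed
  show ?thesis
    unfolding hecke_class_def hcong_def
    using I.quotient_eq_iff_same_a_r_cos[OF hecke_ideal assms] assms by (simp add: minus)
qed

lemma hecke_class_in:
  "f \<in> FC n \<Longrightarrow> hecke_class n f \<in> carrier (hecke n)"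
  unfolding hecke_def hecke_class_def Let_def
  using ring_hom_closed[OF ideal.rcos_ring_hom[OF hecke_ideal]] by simp

lemma hecke_carrier: "carrier (hecke n) = hecke_class n ` FC n"
  by (auto simp: hecke_def hecke_class_def Let_def FactRing_def A_RCOSETS_def'
      RCOSETS_def a_r_coset_def)

lemma hecke_class_mult:
  "f \<in> FC n \<Longrightarrow> g \<in> FC n \<Longrightarrow>
    hecke_class n f \<otimes>\<^bsub>hecke n\<^esub> hecke_class n g = hecke_class n (f * g)"
  unfolding hecke_def hecke_class_def Let_def
  using ring_hom_mult[OF ideal.rcos_ring_hom[OF hecke_ideal], of f n g] by simp

lemma hecke_class_add:
  "f \<in> FC n \<Longrightarrow> g \<in> FC n \<Longrightarrow>
    hecke_class n f \<oplus>\<^bsub>hecke n\<^esub> hecke_class n g = hecke_class n (f + g)"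
  unfolding hecke_def hecke_class_def Let_def
  using ring_hom_add[OF ideal.rcos_ring_hom[OF hecke_ideal], of f n g] by simp

lemma hecke_class_smult:
  "f \<in> FC n \<Longrightarrow> a \<odot>\<^bsub>hecke n\<^esub> hecke_class n f = hecke_class n (free_const a * f)"
  using hecke_class_mult[OF FC_const[of a n], of f] by (simp add: hecke_def Let_def)

lemma hecke_one: "\<one>\<^bsub>hecke n\<^esub> = hecke_class n 1"
  using ring_hom_one[OF ideal.rcos_ring_hom[OF hecke_ideal, of n]]
  by (simp add: hecke_def Let_def hecke_class_def)

lemma hecke_zero: "\<zero>\<^bsub>hecke n\<^esub> = hecke_class n 0"
proof -
  interpret I: ideal "hecke_ideal n" "free_alg n" by (rule hecke_ideal)
  have "hecke_ideal n +>\<^bsub>free_alg n\<^esub> \<zero>\<^bsub>free_alg n\<^esub> = hecke_ideal n"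
    using I.a_rcos_const[of 0] ideal_0[of n] by simp
  then show ?thesis by (simp add: hecke_def Let_def hecke_class_def FactRing_def)
qed

lemma hecke_abelian_group: "abelian_group (hecke n)"
proof (rule abelian_groupI)
  fix x assume "x \<in> carrier (hecke n)"
  then obtain f where f: "f \<in> FC n" "x = hecke_class n f" by (auto simp: hecke_carrier)
  then have "hecke_class n (- f) \<oplus>\<^bsub>hecke n\<^esub> x = \<zero>\<^bsub>hecke n\<^esub>"
    by (simp add: hecke_class_add hecke_zero FC_uminus)
  then show "\<exists>y\<in>carrier (hecke n). y \<oplus>\<^bsub>hecke n\<^esub> x = \<zero>\<^bsub>hecke n\<^esub>"
    using f by (auto intro: hecke_class_in FC_uminus)
qed (auto simp: hecke_carrier hecke_class_add hecke_zero FC_add FC_0 ac_simps)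

lemma hecke_monoid: "Group.monoid (hecke n)"
  by (rule Group.monoidI)
    (auto simp: hecke_carrier hecke_class_mult hecke_one FC_mult FC_1 mult.assoc)

lemma free_const_commute: "free_const a * f = f * free_const a"
proof -
  have "free_const a * (\<Sum>k \<in> Poly_Mapping.keys f. Poly_Mapping.single k (Poly_Mapping.lookup f k))
    = (\<Sum>k \<in> Poly_Mapping.keys f. Poly_Mapping.single k (Poly_Mapping.lookup f k)) * free_const a"
    by (simp add: sum_distrib_left sum_distrib_right free_const_def mult_single mult.commute)
  then show ?thesis by (simp add: sum_singles)
qed

lemma free_const_mult: "free_const (a * b) = free_const a * free_const b"
  by (simp add: free_const_def mult_single)

lemma free_const_add: "free_const (a + b) = free_const a + free_const b"
  by (simp add: free_const_def single_add)

lemma free_const_0 [simp]: "free_const 0 = 0"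
  by (simp add: free_const_def)

lemma free_const_1 [simp]: "free_const 1 = 1"
  by (simp add: free_const_def)

lemma free_const_left_commute: "f * (free_const a * g) = free_const a * (f * g)"
  by (metis free_const_commute mult.assoc)

section \<open>Matsumoto's theorem\<close>

definition Tword :: "perm list \<Rightarrow> free_elt" where
  "Tword ss = Poly_Mapping.single (FM ss) 1"

lemma Tword_Nil: "Tword [] = 1"
  unfolding Tword_def by (metis zero_free_mon_def single_one)

lemma Tword_append: "Tword (ss @ ts) = Tword ss * Tword ts"
  by (simp add: Tword_def mult_single plus_free_mon_def)

lemma Tword_Cons: "Tword (s # ss) = free_gen s * Tword ss"
  using Tword_append[of "[s]" ss] by (simp add: Tword_def free_gen_def)

lemma Tword_FC: "set ss \<subseteq> simple_refls n \<Longrightarrow> Tword ss \<in> FC n"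
  by (simp add: Tword_def FC_single)

lemma rel_quadratic:
  "s \<in> simple_refls n \<Longrightarrow> hcong n (free_gen s * free_gen s) (1 + free_const q_diff * free_gen s)"
  unfolding hcong_def using hecke_rels_ideal[of n]
  by (auto simp: hecke_rels_def q_diff_def intro!: FC_mult FC_add FC_1 FC_const FC_gen)

lemma rel_braid:
  assumes "1 \<le> i" "Suc i < n"
  shows "hcong n (free_gen (simple_refl i) * free_gen (simple_refl (Suc i)) * free_gen (simple_refl i))
    (free_gen (simple_refl (Suc i)) * free_gen (simple_refl i) * free_gen (simple_refl (Suc i)))"
  unfolding hcong_def using hecke_rels_ideal[of n] assms
  by (auto simp: hecke_rels_def intro!: FC_mult FC_gen simple_refl_in)

lemma rel_commute:
  assumes "1 \<le> i" "Suc i < j" "j < n"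
  shows "hcong n (free_gen (simple_refl i) * free_gen (simple_refl j))
    (free_gen (simple_refl j) * free_gen (simple_refl i))"
proof -
  have "free_gen (simple_refl i) * free_gen (simple_refl j)
    - free_gen (simple_refl j) * free_gen (simple_refl i) \<in> hecke_rels n"
    unfolding hecke_rels_def using assms by auto
  then show ?thesis
    unfolding hcong_def using hecke_rels_ideal[of n] assms
    by (auto intro!: FC_mult FC_gen simple_refl_in)
qed

lemma reduced_word_Wn: "reduced_word n w ss \<Longrightarrow> w \<in> Wn n"
  using word_prod_Wn by (auto simp: reduced_word_def)

lemma simple_refls_comp_comp: "s \<in> simple_refls n \<Longrightarrow> s \<circ> (s \<circ> w) = w"
  by (auto elim!: simple_reflsE simp: comp_assoc[symmetric] simp del: comp_apply)

lemma len_simple_le: "s \<in> simple_refls n \<Longrightarrow> w \<in> Wn n \<Longrightarrow> len n (s \<circ> w) \<le> Suc (len n w)"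
proof (elim simple_reflsE)
  fix i assume "w \<in> Wn n" and s: "s = simple_refl i" and "1 \<le> i" "i < n"
  from len_comp_left[OF this(1,3,4)] Wn_adjacent_neq[OF Wn_inv[OF this(1)], of i]
  show "len n (s \<circ> w) \<le> Suc (len n w)" unfolding s by linarith
qed

lemma reduced_word_ConsD:
  assumes "reduced_word n w (s # ss)"
  shows "s \<in> simple_refls n" "reduced_word n (s \<circ> w) ss" "len n w = Suc (len n (s \<circ> w))"
proof -
  have s: "s \<in> simple_refls n" and ss: "set ss \<subseteq> simple_refls n"
    and w: "s \<circ> word_prod ss = w" and l: "Suc (length ss) = len n w"
    using assms by (auto simp: reduced_word_def)
  have sw: "s \<circ> w = word_prod ss"
    using simple_refls_comp_comp[OF s] w by metis
  have "len n w \<le> Suc (len n (s \<circ> w))"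
    using len_simple_le[OF s word_prod_Wn[OF ss]] unfolding sw w .
  moreover have "len n (s \<circ> w) \<le> length ss"
    using len_word_prod[OF ss] unfolding sw .
  ultimately show "len n w = Suc (len n (s \<circ> w))" "reduced_word n (s \<circ> w) ss"
    using l ss sw by (auto simp: reduced_word_def)
  show "s \<in> simple_refls n" by fact
qed

lemma reduced_word_ConsI:
  assumes "s \<in> simple_refls n" "reduced_word n (s \<circ> w) ss" "len n w = Suc (len n (s \<circ> w))"
  shows "reduced_word n w (s # ss)"
  using assms simple_refls_comp_comp[OF assms(1), of w] by (auto simp: reduced_word_def)

lemma simple_refl_commute:
  "Suc i < j \<Longrightarrow> simple_refl i \<circ> (simple_refl j \<circ> w) = simple_refl j \<circ> (simple_refl i \<circ> w)"
  by (auto simp: fun_eq_iff simple_refl_apply)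

lemma simple_refl_braid:
  "simple_refl i \<circ> (simple_refl (Suc i) \<circ> (simple_refl i \<circ> w)) =
   simple_refl (Suc i) \<circ> (simple_refl i \<circ> (simple_refl (Suc i) \<circ> w))"
  by (auto simp: fun_eq_iff simple_refl_apply)

text \<open>Both reflections are left descents of \<open>w\<close>, so \<open>w\<close> also has
  reduced words beginning with either side of the braid or commutation relation between them. These
  two words agree modulo the relation, and the induction hypothesis connects each with the given
  word that has the same first letter.\<close>

lemma matsumoto_less:
  assumes IH: "\<And>u ss ts. len n u < len n w \<Longrightarrow> reduced_word n u ss \<Longrightarrow> reduced_word n u ts \<Longrightarrow>
      hcong n (Tword ss) (Tword ts)"
    and i: "1 \<le> i" and ij: "i < j" and j: "j < n"
    and ss: "reduced_word n w (simple_refl i # ss)" and ts: "reduced_word n w (simple_refl j # ts)"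
  shows "hcong n (Tword (simple_refl i # ss)) (Tword (simple_refl j # ts))"
proof -
  let ?si = "simple_refl i" and ?sj = "simple_refl j"
  have w: "w \<in> Wn n" using reduced_word_Wn[OF ss] .
  have i': "i < n" and j': "1 \<le> j" using i ij j by auto
  note si = reduced_word_ConsD[OF ss] and sj = reduced_word_ConsD[OF ts]
  have siW: "?si \<circ> w \<in> Wn n" and sjW: "?sj \<circ> w \<in> Wn n"
    using w i i' j j' by (auto intro!: Wn_comp simple_refl_Wn)
  have invi: "inv' w (Suc i) < inv' w i" using len_left_less_iff(2)[OF w i i'] si(3) by simp
  have invj: "inv' w (Suc j) < inv' w j" using len_left_less_iff(2)[OF w j' j] sj(3) by simp
  have FCi: "free_gen ?si \<in> FC n" and FCj: "free_gen ?sj \<in> FC n"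
    using si(1) sj(1) by (auto intro: FC_gen)
  note invs_si = inv_comp_left[OF w i i'] and invs_sj = inv_comp_left[OF w j' j]
  have step: "hcong n (Tword (s # ss')) (Tword (s # us))"
    if "s \<in> simple_refls n" "len n w = Suc (len n (s \<circ> w))"
      "reduced_word n (s \<circ> w) ss'" "reduced_word n (s \<circ> w) us" for s ss' us
    unfolding Tword_Cons by (rule hcong_left[OF IH]) (use that in \<open>auto intro: FC_gen\<close>)
  show ?thesis
  proof (cases "j = Suc i")
    case True
    let ?u1 = "?sj \<circ> (?si \<circ> w)" and ?u2 = "?si \<circ> (?sj \<circ> w)"
    \<comment> \<open>\<open>?u\<close> is \<open>w\<close> with a braid word of length three
      removed; the descents of \<open>inv' w\<close> at \<open>i\<close> and \<open>i + 1\<close>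
      make each removal shorten the permutation.\<close>
    let ?u = "?si \<circ> ?u1"
    have u1W: "?u1 \<in> Wn n" and u2W: "?u2 \<in> Wn n" and uW: "?u \<in> Wn n"
      using siW sjW i i' j j' by (auto intro!: Wn_comp simple_refl_Wn)
    have u: "?u = ?sj \<circ> ?u2" unfolding True by (rule simple_refl_braid)
    have l1: "len n (?si \<circ> w) = Suc (len n ?u1)"
      by (rule len_comp_left(2)[OF siW j' j])
        (use invi invj True in \<open>simp add: invs_si simple_refl_apply\<close>)
    have l2: "len n (?sj \<circ> w) = Suc (len n ?u2)"
      by (rule len_comp_left(2)[OF sjW i i'])
        (use invi invj True in \<open>simp add: invs_sj[unfolded True] simple_refl_apply\<close>)
    have l3: "len n ?u1 = Suc (len n ?u)"
      by (rule len_comp_left(2)[OF u1W i i'])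
        (use invi invj True in \<open>simp add: inv_comp_left[OF siW j' j, unfolded True] invs_si simple_refl_apply\<close>)
    have l4: "len n ?u2 = Suc (len n (?sj \<circ> ?u2))"
      by (rule len_comp_left(2)[OF u2W j' j])
        (use invi invj True in \<open>simp add: inv_comp_left[OF sjW i i', unfolded True] invs_sj[unfolded True] simple_refl_apply\<close>)
    obtain us where us: "reduced_word n ?u us" using ex_reduced_word[OF uW] by blast
    have usFC: "Tword us \<in> FC n" using us by (intro Tword_FC) (simp add: reduced_word_def)
    have r1: "reduced_word n (?si \<circ> w) (?sj # ?si # us)"
      using us by (intro reduced_word_ConsI si(1) sj(1) l1 l3)
    have r2: "reduced_word n (?sj \<circ> w) (?si # ?sj # us)"
      using us unfolding u by (intro reduced_word_ConsI si(1) sj(1) l2 l4)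
    have "hcong n (Tword (?si # ss)) (Tword (?si # ?sj # ?si # us))"
      by (rule step[OF si(1,3,2) r1])
    also have "hcong n \<dots> (Tword (?sj # ?si # ?sj # us))"
      using hcong_right[OF rel_braid[of i n] usFC] i j True by (simp add: Tword_Cons mult.assoc)
    also have "hcong n \<dots> (Tword (?sj # ts))"
      by (rule hcong_sym[OF step[OF sj(1,3,2) r2]])
    finally show ?thesis .
  next
    case False
    then have ij: "Suc i < j" using ij by simp
    let ?u = "?sj \<circ> (?si \<circ> w)"
    have uW: "?u \<in> Wn n" using siW j j' by (auto intro!: Wn_comp simple_refl_Wn)
    have u: "?u = ?si \<circ> (?sj \<circ> w)" by (rule simple_refl_commute[OF ij, symmetric])
    have l1: "len n (?si \<circ> w) = Suc (len n ?u)"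
      by (rule len_comp_left(2)[OF siW j' j])
        (use invi invj ij in \<open>simp add: invs_si simple_refl_apply\<close>)
    have l2: "len n (?sj \<circ> w) = Suc (len n (?si \<circ> (?sj \<circ> w)))"
      by (rule len_comp_left(2)[OF sjW i i'])
        (use invi invj ij in \<open>simp add: invs_sj simple_refl_apply\<close>)
    obtain us where us: "reduced_word n ?u us" using ex_reduced_word[OF uW] by blast
    have usFC: "Tword us \<in> FC n" using us by (intro Tword_FC) (simp add: reduced_word_def)
    have r1: "reduced_word n (?si \<circ> w) (?sj # us)"
      using us by (intro reduced_word_ConsI sj(1) l1)
    have r2: "reduced_word n (?sj \<circ> w) (?si # us)"
      using us unfolding u by (intro reduced_word_ConsI si(1) l2)
    have "hcong n (Tword (?si # ss)) (Tword (?si # ?sj # us))"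
      by (rule step[OF si(1,3,2) r1])
    also have "hcong n \<dots> (Tword (?sj # ?si # us))"
      using hcong_right[OF rel_commute[OF i ij j] usFC] by (simp add: Tword_Cons mult.assoc)
    also have "hcong n \<dots> (Tword (?sj # ts))"
      by (rule hcong_sym[OF step[OF sj(1,3,2) r2]])
    finally show ?thesis .
  qed
qed

theorem matsumoto:
  "reduced_word n w ss \<Longrightarrow> reduced_word n w ts \<Longrightarrow> hcong n (Tword ss) (Tword ts)"
proof (induction "len n w" arbitrary: w ss ts rule: less_induct)
  case less
  show ?case
  proof (cases ss)
    case Nil
    then show ?thesis using less.prems
      by (auto simp: reduced_word_def len_id intro!: hcong_refl Tword_FC)
  next
    case ss: (Cons s ss')
    obtain t ts' where ts: "ts = t # ts'"
      using less.prems ss by (cases ts) (auto simp: reduced_word_def)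
    note rs = less.prems[unfolded ss ts]
    note s = reduced_word_ConsD[OF rs(1)] and t = reduced_word_ConsD[OF rs(2)]
    obtain i where i: "s = simple_refl i" "1 \<le> i" "i < n" using s(1) by (rule simple_reflsE)
    obtain j where j: "t = simple_refl j" "1 \<le> j" "j < n" using t(1) by (rule simple_reflsE)
    have IH: "hcong n (Tword ss) (Tword ts)"
      if "len n u < len n w" "reduced_word n u ss" "reduced_word n u ts" for u ss ts
      using less.hyps that by blast
    consider "i = j" | "i < j" | "j < i" by linarith
    then show ?thesis
    proof cases
      case 1
      then have "t = s" using i j by simp
      have "hcong n (Tword ss') (Tword ts')"
        by (rule IH[of "s \<circ> w"]) (use s t \<open>t = s\<close> in auto)
      then show ?thesis unfolding ss ts \<open>t = s\<close> Tword_Cons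
        using s(1) by (intro hcong_left FC_gen)
    next
      case 2
      show ?thesis unfolding ss ts i(1) j(1)
        by (rule matsumoto_less[OF IH i(2) 2 j(3)]) (use rs i(1) j(1) in auto)
    next
      case 3
      show ?thesis unfolding ss ts i(1) j(1)
        by (rule hcong_sym, rule matsumoto_less[OF IH j(2) 3 i(3)]) (use rs i(1) j(1) in auto)
    qed
  qed
qed

definition T_rep :: "nat \<Rightarrow> perm \<Rightarrow> free_elt" where
  "T_rep n w = Tword (SOME ss. reduced_word n w ss)"

lemma some_reduced_word: "w \<in> Wn n \<Longrightarrow> reduced_word n w (SOME ss. reduced_word n w ss)"
  using someI_ex[OF ex_reduced_word] .

lemma T_rep_FC: "w \<in> Wn n \<Longrightarrow> T_rep n w \<in> FC n"
  using some_reduced_word[of w n] by (simp add: T_rep_def Tword_FC reduced_word_def)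

lemma T_rep_cong: "reduced_word n w ss \<Longrightarrow> hcong n (T_rep n w) (Tword ss)"
  unfolding T_rep_def by (rule matsumoto[OF some_reduced_word]) (auto intro: reduced_word_Wn)

lemma T_elt_class:
  assumes w: "w \<in> Wn n"
  shows "T_elt n w = hecke_class n (T_rep n w)"
proof -
  have "foldr (\<lambda>s x. T_gen n s \<otimes>\<^bsub>hecke n\<^esub> x) ss \<one>\<^bsub>hecke n\<^esub> = hecke_class n (Tword ss)"
    if "set ss \<subseteq> simple_refls n" for ss
    using that
    by (induction ss)
      (auto simp: hecke_one Tword_Nil Tword_Cons T_gen_def hecke_class_mult FC_gen Tword_FC)
  then show ?thesis
    using some_reduced_word[OF w] by (simp add: T_elt_def T_rep_def reduced_word_def)
qed

lemma gen_T_rep_up: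
  assumes "s \<in> simple_refls n" "w \<in> Wn n" "len n w < len n (s \<circ> w)"
  shows "hcong n (free_gen s * T_rep n w) (T_rep n (s \<circ> w))"
proof -
  have l: "len n (s \<circ> w) = Suc (len n w)"
    using len_simple_le[OF assms(1,2)] assms(3) by linarith
  have "reduced_word n (s \<circ> w) (s # (SOME ss. reduced_word n w ss))"
    by (rule reduced_word_ConsI[OF assms(1)], unfold simple_refls_comp_comp[OF assms(1)])
      (rule some_reduced_word[OF assms(2)] l)+
  from hcong_sym[OF T_rep_cong[OF this]] show ?thesis
    by (simp add: Tword_Cons T_rep_def)
qed

lemma gen_T_rep:
  assumes s: "s \<in> simple_refls n" and w: "w \<in> Wn n"
  shows "hcong n (free_gen s * T_rep n w)
    (T_rep n (s \<circ> w) + free_const (if len n (s \<circ> w) < len n w then q_diff else 0) * T_rep n w)"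
proof (cases "len n (s \<circ> w) < len n w")
  case True
  have sw: "s \<circ> w \<in> Wn n" by (rule Wn_comp[OF simple_refls_Wn[OF s] w])
  have eq: "hcong n (free_gen s * T_rep n (s \<circ> w)) (T_rep n w)"
    using gen_T_rep_up[OF s sw] True unfolding simple_refls_comp_comp[OF s] by blast
  have "hcong n (free_gen s * T_rep n w) (free_gen s * (free_gen s * T_rep n (s \<circ> w)))"
    using s by (intro hcong_left hcong_sym[OF eq] FC_gen)
  also have "hcong n \<dots> ((1 + free_const q_diff * free_gen s) * T_rep n (s \<circ> w))"
    using hcong_right[OF rel_quadratic[OF s] T_rep_FC[OF sw]] by (simp add: mult.assoc)
  also have "hcong n \<dots> (T_rep n (s \<circ> w) + free_const q_diff * T_rep n w)"
    using hcong_add[OF hcong_refl[OF T_rep_FC[OF sw]] hcong_left[OF eq FC_const]]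
    by (simp add: distrib_right mult.assoc)
  finally show ?thesis using True by simp
next
  case False
  obtain i where i: "s = simple_refl i" "1 \<le> i" "i < n" using s by (rule simple_reflsE)
  have "len n w < len n (s \<circ> w)"
    using False len_left_less_iff[OF w i(2,3)] Wn_adjacent_neq[OF Wn_inv[OF w], of i]
    unfolding i(1) by blast
  with gen_T_rep_up[OF s w this] False show ?thesis by simp
qed

lemma T_rep_gen_up:
  assumes s: "s \<in> simple_refls n" and w: "w \<in> Wn n" and up: "len n w < len n (w \<circ> s)"
  shows "hcong n (T_rep n w * free_gen s) (T_rep n (w \<circ> s))"
proof -
  let ?ss = "SOME ss. reduced_word n w ss"
  obtain i where i: "s = simple_refl i" "1 \<le> i" "i < n" using s by (rule simple_reflsE)
  have "len n (w \<circ> s) = Suc (len n w)"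
    using up len_right_less_iff(1)[OF w i(2,3)] len_comp_right(1)[OF w i(2,3)]
    unfolding i(1) by blast
  then have "reduced_word n (w \<circ> s) (?ss @ [s])"
    using s some_reduced_word[OF w] by (simp add: reduced_word_def word_prod_append)
  from hcong_sym[OF T_rep_cong[OF this]] show ?thesis
    by (simp add: Tword_append Tword_Cons Tword_Nil T_rep_def)
qed

lemma T_rep_gen:
  assumes s: "s \<in> simple_refls n" and w: "w \<in> Wn n"
  shows "hcong n (T_rep n w * free_gen s)
    (T_rep n (w \<circ> s) + free_const (if len n (w \<circ> s) < len n w then q_diff else 0) * T_rep n w)"
proof -
  obtain i where i: "s = simple_refl i" "1 \<le> i" "i < n" using s by (rule simple_reflsE)
  have ss: "s \<circ> s = id" unfolding i(1) by (rule simple_refl_comp)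
  show ?thesis
  proof (cases "len n (w \<circ> s) < len n w")
    case True
    have ws: "w \<circ> s \<in> Wn n" by (rule Wn_comp[OF w simple_refls_Wn[OF s]])
    have eq: "hcong n (T_rep n (w \<circ> s) * free_gen s) (T_rep n w)"
      using T_rep_gen_up[OF s ws] True unfolding comp_assoc ss o_id by blast
    have "hcong n (T_rep n w * free_gen s) (T_rep n (w \<circ> s) * free_gen s * free_gen s)"
      using s by (intro hcong_right hcong_sym[OF eq] FC_gen)
    also have "hcong n \<dots> (T_rep n (w \<circ> s) * (1 + free_const q_diff * free_gen s))"
      using hcong_left[OF rel_quadratic[OF s] T_rep_FC[OF ws]] by (simp add: mult.assoc)
    also have "hcong n \<dots> (T_rep n (w \<circ> s) + free_const q_diff * T_rep n w)"
      using hcong_add[OF hcong_refl[OF T_rep_FC[OF ws]] hcong_left[OF eq FC_const]]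
      by (simp add: distrib_left free_const_left_commute)
    finally show ?thesis using True by simp
  next
    case False
    have "len n w < len n (w \<circ> s)"
      using False len_right_less_iff[OF w i(2,3)] Wn_adjacent_neq[OF w, of i]
      unfolding i(1) by blast
    with T_rep_gen_up[OF s w this] False show ?thesis by simp
  qed
qed

section \<open>The regular representation\<close>

definition coord_fns :: "nat \<Rightarrow> (perm \<Rightarrow> laurent) set" where
  "coord_fns n = {f. \<forall>w. w \<notin> Wn n \<longrightarrow> f w = 0}"

text \<open>
  The operators of left and right multiplication by \<open>T\<^sub>s\<close>, in coordinates with respect to the \<open>T\<^sub>w\<close>,
  whose linear independence follows from these operators.
\<close>

definition left_op :: "nat \<Rightarrow> perm \<Rightarrow> (perm \<Rightarrow> laurent) \<Rightarrow> perm \<Rightarrow> laurent" where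
  "left_op n s f w = (if w \<in> Wn n
     then f (s \<circ> w) + (if len n (s \<circ> w) < len n w then q_diff else 0) * f w else 0)"

definition right_op :: "nat \<Rightarrow> perm \<Rightarrow> (perm \<Rightarrow> laurent) \<Rightarrow> perm \<Rightarrow> laurent" where
  "right_op n s f w = (if w \<in> Wn n
     then f (w \<circ> s) + (if len n (w \<circ> s) < len n w then q_diff else 0) * f w else 0)"

definition act :: "nat \<Rightarrow> perm list \<Rightarrow> (perm \<Rightarrow> laurent) \<Rightarrow> perm \<Rightarrow> laurent" where
  "act n ss f = foldr (left_op n) ss f"

text \<open>The free algebra acts on coordinate functions through \<open>left_op\<close>; by
  \<open>ev_ideal\<close> the action descends to the Hecke algebra.\<close>

definition ev :: "nat \<Rightarrow> free_elt \<Rightarrow> (perm \<Rightarrow> laurent) \<Rightarrow> perm \<Rightarrow> laurent" where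
  "ev n F f w = (\<Sum>m\<in>Poly_Mapping.keys F. Poly_Mapping.lookup F m * act n (letters m) f w)"

lemma act_simps [simp]: "act n [] f = f" "act n (s # ss) f = left_op n s (act n ss f)"
  by (simp_all add: act_def)

lemma act_append: "act n (ss @ ts) f = act n ss (act n ts f)"
  by (simp add: act_def)

lemma left_op_coord_fns: "left_op n s f \<in> coord_fns n"
  by (simp add: left_op_def coord_fns_def)

lemma act_coord_fns: "f \<in> coord_fns n \<Longrightarrow> act n ss f \<in> coord_fns n"
  by (cases ss) (simp_all add: left_op_coord_fns)

lemma ev_coord_fns: "f \<in> coord_fns n \<Longrightarrow> ev n F f \<in> coord_fns n"
  using act_coord_fns[of f n] by (simp add: coord_fns_def ev_def)

lemma left_op_linear:
  "left_op n s (\<lambda>w. \<Sum>i\<in>I. a i * f i w) = (\<lambda>w. \<Sum>i\<in>I. a i * left_op n s (f i) w)"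
  by (rule ext) (simp add: left_op_def distrib_left sum.distrib sum_distrib_left mult.left_commute
      del: comp_apply)

lemma act_linear:
  "act n ss (\<lambda>w. \<Sum>i\<in>I. a i * f i w) = (\<lambda>w. \<Sum>i\<in>I. a i * act n ss (f i) w)"
  by (induction ss) (simp_all add: left_op_linear)

lemma ev_superset:
  assumes "finite K" "Poly_Mapping.keys F \<subseteq> K"
  shows "ev n F f w = (\<Sum>m\<in>K. Poly_Mapping.lookup F m * act n (letters m) f w)"
  unfolding ev_def by (rule sum.mono_neutral_left) (use assms in \<open>auto simp: in_keys_iff\<close>)

lemma ev_add: "ev n (F + G) f w = ev n F f w + ev n G f w"
proof -
  let ?K = "Poly_Mapping.keys F \<union> Poly_Mapping.keys G"
  have "ev n (F + G) f w = (\<Sum>m\<in>?K. Poly_Mapping.lookup (F + G) m * act n (letters m) f w)"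
    by (rule ev_superset) (use keys_add[of F G] in auto)
  then show ?thesis
    by (simp add: lookup_add distrib_right sum.distrib ev_superset[of ?K F] ev_superset[of ?K G])
qed

lemma ev_0 [simp]: "ev n 0 f w = 0"
  by (simp add: ev_def)

lemma ev_uminus: "ev n (- F) f w = - ev n F f w"
  using ev_add[of n F "- F" f w] by (simp add: eq_neg_iff_add_eq_0 add.commute)

lemma ev_diff: "ev n (F - G) f w = ev n F f w - ev n G f w"
  using ev_add[of n F "- G" f w] by (simp add: ev_uminus)

lemma ev_sum: "ev n (sum F I) f w = (\<Sum>i\<in>I. ev n (F i) f w)"
  by (induction I rule: infinite_finite_induct) (auto simp: ev_add)

lemma ev_single: "ev n (Poly_Mapping.single m c) f w = c * act n (letters m) f w"
  by (cases "c = 0") (simp_all add: ev_def)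

lemma ev_mult: "ev n (F * G) f = ev n F (ev n G f)"
proof (rule ext)
  fix w
  let ?sum = "\<lambda>F. (\<Sum>k \<in> Poly_Mapping.keys F. Poly_Mapping.single k (Poly_Mapping.lookup F k))"
  have "ev n (?sum F * ?sum G) f w = ev n F (ev n G f) w"
    unfolding sum_product
    by (simp add: mult_single ev_sum ev_single act_append)
      (simp add: ev_def[abs_def] act_linear sum_distrib_left mult.assoc)
  then show "ev n (F * G) f w = ev n F (ev n G f) w" by (simp add: sum_singles)
qed

lemma ev_gen: "ev n (free_gen s) f = left_op n s f"
  by (rule ext) (simp add: free_gen_def ev_single)

lemma ev_const: "ev n (free_const a) f w = a * f w"
  by (simp add: free_const_def ev_single)

lemma ev_1: "ev n 1 f = f"
  using ev_const[of n 1 f] by (simp add: fun_eq_iff)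

lemma left_op_simple:
  assumes w: "w \<in> Wn n" "1 \<le> i" "i < n"
  shows "left_op n (simple_refl i) f w
    = f (simple_refl i \<circ> w) + (if inv' w (Suc i) < inv' w i then q_diff else 0) * f w"
  unfolding left_op_def if_P[OF w(1)] len_left_less_iff(2)[OF w] ..

lemma left_op_quadratic:
  assumes s: "s \<in> simple_refls n" and w: "w \<in> Wn n"
  shows "left_op n s (left_op n s f) w = f w + q_diff * left_op n s f w"
proof -
  obtain i where i: "s = simple_refl i" "1 \<le> i" "i < n" using s by (rule simple_reflsE)
  let ?s = "simple_refl i"
  have sw: "?s \<circ> w \<in> Wn n" by (rule Wn_comp[OF simple_refl_Wn[OF i(2,3)] w])
  have ssw: "?s \<circ> (?s \<circ> w) = w" using simple_refls_comp_comp[OF s, of w] unfolding i(1) .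
  have "left_op n ?s (left_op n ?s f) w = f w + q_diff * left_op n ?s f w"
    unfolding left_op_simple[OF w i(2,3)] left_op_simple[OF sw i(2,3)] ssw inv_comp_left[OF w i(2,3)]
    using Wn_adjacent_neq[OF Wn_inv[OF w], of i]
    by (auto simp: simple_refl_apply algebra_simps)
  then show ?thesis by (simp only: i(1))
qed

lemma left_op_commute:
  assumes ij: "1 \<le> i" "Suc i < j" "j < n" and w: "w \<in> Wn n"
  shows "left_op n (simple_refl i) (left_op n (simple_refl j) f) w
    = left_op n (simple_refl j) (left_op n (simple_refl i) f) w"
proof -
  have i: "1 \<le> i" "i < n" and j: "1 \<le> j" "j < n" using ij by auto
  let ?si = "simple_refl i" and ?sj = "simple_refl j"
  have siw: "?si \<circ> w \<in> Wn n" and sjw: "?sj \<circ> w \<in> Wn n"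
    by (rule Wn_comp[OF simple_refl_Wn[OF i] w] Wn_comp[OF simple_refl_Wn[OF j] w])+
  show ?thesis
    unfolding left_op_simple[OF w i] left_op_simple[OF w j] left_op_simple[OF siw j] left_op_simple[OF sjw i]
      inv_comp_left[OF w i] inv_comp_left[OF w j] simple_refl_commute[OF ij(2)]
    using ij by (auto simp: simple_refl_apply algebra_simps)
qed

text \<open>All length comparisons reduce to the relative order of the three values
  \<open>?x\<close>, \<open>?y\<close>, \<open>?z\<close>, so the relation becomes a finite
  check.\<close>

lemma left_op_braid:
  assumes ij: "1 \<le> i" "Suc i < n" and w: "w \<in> Wn n"
  shows "left_op n (simple_refl i) (left_op n (simple_refl (Suc i)) (left_op n (simple_refl i) f)) w
    = left_op n (simple_refl (Suc i)) (left_op n (simple_refl i) (left_op n (simple_refl (Suc i)) f)) w"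
proof -
  have i: "1 \<le> i" "i < n" and j: "1 \<le> Suc i" "Suc i < n" using ij by auto
  let ?si = "simple_refl i" and ?sj = "simple_refl (Suc i)"
  have W: "?si \<circ> u \<in> Wn n" "?sj \<circ> u \<in> Wn n" if "u \<in> Wn n" for u
    by (rule Wn_comp[OF simple_refl_Wn[OF i] that] Wn_comp[OF simple_refl_Wn[OF j] that])+
  have c: "?si \<circ> (?si \<circ> u) = u" "?sj \<circ> (?sj \<circ> u) = u" for u
    using simple_refls_comp_comp[OF simple_refl_in] i j by blast+
  let ?x = "inv' w i" and ?y = "inv' w (Suc i)" and ?z = "inv' w (Suc (Suc i))"
  have neq: "?x \<noteq> ?y" "?y \<noteq> ?z" "?x \<noteq> ?z"
    using Wn_inj[OF Wn_inv[OF w]] by auto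
  note L = left_op_simple[OF _ i] left_op_simple[OF _ j]
  note I = inv_comp_left[OF _ i] inv_comp_left[OF _ j]
  show ?thesis
    unfolding L[OF w] L[OF W(1)[OF w]] L[OF W(2)[OF w]] L[OF W(1)[OF W(2)[OF w]]]
      L[OF W(2)[OF W(1)[OF w]]] I[OF w] I[OF W(1)[OF w]] I[OF W(2)[OF w]] c simple_refl_braid
    using neq by (auto simp: simple_refl_apply algebra_simps)
qed

text \<open>The elements annihilating every coordinate function form a two-sided ideal. It contains
  the defining relations because the operators satisfy them, hence it contains the ideal they
  generate.\<close>

lemma ev_ideal:
  assumes "F \<in> hecke_ideal n" "f \<in> coord_fns n"
  shows "ev n F f w = 0"
proof -
  define K where "K = {F \<in> FC n. \<forall>f \<in> coord_fns n. \<forall>w. ev n F f w = 0}"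
  have z: "ev n F (\<lambda>w. 0) w = 0" for F w
    using act_linear[of n _ _ _ "{}"] by (simp add: ev_def)
  have "ideal K (free_alg n)"
  proof (rule idealI[OF free_alg_ring])
    interpret R: ring "free_alg n" by (rule free_alg_ring)
    have minus: "\<ominus>\<^bsub>free_alg n\<^esub> F = - F" if "F \<in> FC n" for F
      by (rule R.minus_equality) (use that in \<open>auto intro: FC_uminus\<close>)
    show "subgroup K (add_monoid (free_alg n))"
      by (rule R.add.subgroupI)
        (auto simp: K_def FC_0 FC_add ev_add minus FC_uminus ev_uminus
          intro!: exI[of _ 0])
    fix F G assume FK: "F \<in> K" and G: "G \<in> FC n"
    then have F: "F \<in> FC n" "\<And>f. f \<in> coord_fns n \<Longrightarrow> ev n F f = (\<lambda>w. 0)"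
      by (auto simp: K_def)
    show "G \<otimes>\<^bsub>free_alg n\<^esub> F \<in> K" "F \<otimes>\<^bsub>free_alg n\<^esub> G \<in> K"
      using F G by (auto simp: K_def FC_mult ev_mult z ev_coord_fns)
  qed
  moreover have "hecke_rels n \<subseteq> K"
  proof
    fix F assume F: "F \<in> hecke_rels n"
    have "ev n F f w = 0" if f: "f \<in> coord_fns n" for f w
    proof (cases "w \<in> Wn n")
      case True
      from F consider
        (quad) s where "s \<in> simple_refls n"
          "F = free_gen s * free_gen s - (1 + free_const (q - q_inv) * free_gen s)"
        | (braid) i where "1 \<le> i" "Suc i < n"
          "F = free_gen (simple_refl i) * free_gen (simple_refl (Suc i)) * free_gen (simple_refl i)
            - free_gen (simple_refl (Suc i)) * free_gen (simple_refl i) * free_gen (simple_refl (Suc i))"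
        | (comm) i j where "1 \<le> i" "Suc i < j" "j < n"
          "F = free_gen (simple_refl i) * free_gen (simple_refl j)
            - free_gen (simple_refl j) * free_gen (simple_refl i)"
        unfolding hecke_rels_def by auto
      then show ?thesis
      proof cases
        case quad
        then show ?thesis using left_op_quadratic[OF quad(1) True, of f]
          by (simp add: ev_diff ev_add ev_mult ev_gen ev_const ev_1 q_diff_def)
      next
        case braid
        then show ?thesis using left_op_braid[OF braid(1,2) True, of f]
          by (simp add: ev_diff ev_mult ev_gen)
      next
        case comm
        then show ?thesis using left_op_commute[OF comm(1-3) True, of f]
          by (simp add: ev_diff ev_mult ev_gen)
      qed
    qed (use ev_coord_fns[OF f] in \<open>simp add: coord_fns_def\<close>)
    then show "F \<in> K" using F hecke_rels_FC by (auto simp: K_def)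
  qed
  ultimately have "hecke_ideal n \<subseteq> K"
    unfolding hecke_ideal_def by (rule ring.genideal_minimal[OF free_alg_ring])
  then show ?thesis using assms by (auto simp: K_def)
qed

lemma ev_hcong: "hcong n F G \<Longrightarrow> f \<in> coord_fns n \<Longrightarrow> ev n F f = ev n G f"
  using ev_ideal[of "F - G" n f] by (simp add: hcong_def ev_diff fun_eq_iff)

section \<open>The basis of the Hecke algebra\<close>

definition delta :: "perm \<Rightarrow> perm \<Rightarrow> laurent" where
  "delta u w = (if w = u then 1 else 0)"

lemma delta_coord_fns: "u \<in> Wn n \<Longrightarrow> delta u \<in> coord_fns n"
  by (auto simp: delta_def coord_fns_def)

lemma simple_refls_comp_eq_iff: "s \<in> simple_refls n \<Longrightarrow> s \<circ> w = u \<longleftrightarrow> w = s \<circ> u"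
  using simple_refls_comp_comp by metis

lemma left_op_delta:
  assumes s: "s \<in> simple_refls n" and u: "u \<in> Wn n" and up: "len n u < len n (s \<circ> u)"
  shows "left_op n s (delta u) = delta (s \<circ> u)"
proof (rule ext)
  fix w
  have su: "s \<circ> u \<in> Wn n" by (rule Wn_comp[OF simple_refls_Wn[OF s] u])
  have "delta u (s \<circ> w) = delta (s \<circ> u) w"
    unfolding delta_def simple_refls_comp_eq_iff[OF s] ..
  moreover have "(if len n (s \<circ> w) < len n w then q_diff else 0) * delta u w = 0"
    using up by (auto simp: delta_def)
  moreover have "w \<notin> Wn n \<Longrightarrow> delta (s \<circ> u) w = 0"
    using su by (auto simp: delta_def)
  ultimately show "left_op n s (delta u) w = delta (s \<circ> u) w"
    by (simp add: left_op_def)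
qed

lemma act_delta: "reduced_word n w ss \<Longrightarrow> act n ss (delta id) = delta w"
proof (induction ss arbitrary: w)
  case Nil
  then show ?case by (simp add: reduced_word_def)
next
  case (Cons s ss)
  note r = reduced_word_ConsD[OF Cons.prems]
  have "act n (s # ss) (delta id) = left_op n s (delta (s \<circ> w))"
    unfolding act_simps Cons.IH[OF r(2)] ..
  also have "\<dots> = delta (s \<circ> (s \<circ> w))"
    by (rule left_op_delta[OF r(1) reduced_word_Wn[OF r(2)]])
      (unfold simple_refls_comp_comp[OF r(1)] r(3), rule lessI)
  finally show ?case unfolding simple_refls_comp_comp[OF r(1)] .
qed

lemma ev_T_rep_delta: "w \<in> Wn n \<Longrightarrow> ev n (T_rep n w) (delta id) = delta w"
  using act_delta[OF some_reduced_word]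
  by (simp add: T_rep_def Tword_def ev_single fun_eq_iff)

definition Psi_rep :: "nat \<Rightarrow> (perm \<Rightarrow> laurent) \<Rightarrow> free_elt" where
  "Psi_rep n f = (\<Sum>w\<in>Wn n. free_const (f w) * T_rep n w)"

text \<open>The passage from coordinates to the algebra. It is bijective from
  \<open>coord_fns n\<close> to the carrier, by \<open>Psi_inj\<close> and
  \<open>hecke_carrier_Psi\<close>, so later identities can be proved for functions on the
  group.\<close>

definition Psi :: "nat \<Rightarrow> (perm \<Rightarrow> laurent) \<Rightarrow> free_elt set" where
  "Psi n f = hecke_class n (Psi_rep n f)"

lemma Psi_rep_FC: "Psi_rep n f \<in> FC n"
  unfolding Psi_rep_def by (intro FC_sum FC_mult FC_const T_rep_FC)

lemma Psi_in: "Psi n f \<in> carrier (hecke n)"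
  by (simp add: Psi_def hecke_class_in Psi_rep_FC)

lemma ev_Psi_rep: 
  assumes "f \<in> coord_fns n"
  shows "ev n (Psi_rep n f) (delta id) = f"
proof (rule ext)
  fix w
  have "ev n (Psi_rep n f) (delta id) w = (\<Sum>u\<in>Wn n. f u * delta u w)"
    by (simp add: Psi_rep_def ev_sum ev_mult ev_const ev_T_rep_delta)
  also have "\<dots> = (\<Sum>u\<in>Wn n. if u = w then f u else 0)"
    by (rule sum.cong) (auto simp: delta_def)
  also have "\<dots> = f w"
    using assms by (simp add: coord_fns_def)
  finally show "ev n (Psi_rep n f) (delta id) w = f w" .
qed

text \<open>The action on \<open>delta id\<close> recovers the coordinates of an element; this is
  the linear independence of the \<open>T\<^sub>w\<close>.\<close>

lemma Psi_inj:
  assumes "f \<in> coord_fns n" "g \<in> coord_fns n" "Psi n f = Psi n g"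
  shows "f = g"
proof -
  have "hcong n (Psi_rep n f) (Psi_rep n g)"
    using assms(3) by (simp add: Psi_def hecke_class_eq_iff Psi_rep_FC)
  from ev_hcong[OF this delta_coord_fns[OF Wn_id]] show ?thesis
    using assms by (simp add: ev_Psi_rep)
qed

lemma Psi_rep_linear:
  "Psi_rep n (\<lambda>w. \<Sum>i\<in>I. a i * f i w) = (\<Sum>i\<in>I. free_const (a i) * Psi_rep n (f i))"
proof -
  have "free_const (\<Sum>i\<in>I. g i) = (\<Sum>i\<in>I. free_const (g i))" for g :: "_ \<Rightarrow> laurent"
    by (induction I rule: infinite_finite_induct) (auto simp: free_const_add)
  then have "Psi_rep n (\<lambda>w. \<Sum>i\<in>I. a i * f i w)
      = (\<Sum>w\<in>Wn n. \<Sum>i\<in>I. free_const (a i) * (free_const (f i w) * T_rep n w))"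
    by (simp add: Psi_rep_def sum_distrib_right free_const_mult mult.assoc)
  also have "\<dots> = (\<Sum>i\<in>I. free_const (a i) * Psi_rep n (f i))"
    unfolding Psi_rep_def sum_distrib_left by (rule sum.swap)
  finally show ?thesis .
qed

lemma Psi_rep_add: "Psi_rep n (\<lambda>w. f w + g w) = Psi_rep n f + Psi_rep n g"
  by (simp add: Psi_rep_def free_const_add distrib_right sum.distrib)

lemma Psi_rep_smult: "Psi_rep n (\<lambda>w. a * f w) = free_const a * Psi_rep n f"
  by (simp add: Psi_rep_def free_const_mult sum_distrib_left mult.assoc)

lemma Psi_add: "Psi n f \<oplus>\<^bsub>hecke n\<^esub> Psi n g = Psi n (\<lambda>w. f w + g w)"
  by (simp add: Psi_def hecke_class_add Psi_rep_FC Psi_rep_add)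

lemma Psi_smult: "a \<odot>\<^bsub>hecke n\<^esub> Psi n f = Psi n (\<lambda>w. a * f w)"
  by (simp add: Psi_def hecke_class_smult Psi_rep_FC Psi_rep_smult)

lemma Psi_zero: "\<zero>\<^bsub>hecke n\<^esub> = Psi n (\<lambda>w. 0)"
  by (simp add: Psi_def hecke_zero Psi_rep_def)

lemma Psi_uminus: "\<ominus>\<^bsub>hecke n\<^esub> Psi n f = Psi n (\<lambda>w. - f w)"
  by (rule abelian_group.minus_equality[OF hecke_abelian_group])
    (simp_all add: Psi_in Psi_add Psi_zero)

lemma Psi_diff: "Psi n f \<ominus>\<^bsub>hecke n\<^esub> Psi n g = Psi n (\<lambda>w. f w - g w)"
  by (simp add: a_minus_def Psi_uminus Psi_add)

lemma Psi_finsum: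
  assumes "finite I"
  shows "(\<Oplus>\<^bsub>hecke n\<^esub>i\<in>I. Psi n (f i)) = Psi n (\<lambda>w. \<Sum>i\<in>I. f i w)"
proof -
  interpret abelian_group "hecke n" by (rule hecke_abelian_group)
  show ?thesis using assms
    by (induction I rule: finite_induct) (auto simp: Psi_zero Psi_in Psi_add)
qed

text \<open>The common part of left and right multiplication by a generator: \<open>p\<close> is the
  involution \<open>w \<mapsto> s w\<close> or \<open>w \<mapsto> w s\<close>, and \<open>c\<close>
  records where the length drops.\<close>

lemma hcong_reindex:
  assumes "bij_betw p (Wn n) (Wn n)"
    and "\<And>w. w \<in> Wn n \<Longrightarrow> p (p w) = w"
    and step: "\<And>w. w \<in> Wn n \<Longrightarrow> hcong n (g w) (T_rep n (p w) + free_const (c w) * T_rep n w)"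
  shows "hcong n (\<Sum>w\<in>Wn n. free_const (f w) * g w) (Psi_rep n (\<lambda>w. f (p w) + c w * f w))"
proof -
  have "hcong n (\<Sum>w\<in>Wn n. free_const (f w) * g w)
      (\<Sum>w\<in>Wn n. free_const (f w) * (T_rep n (p w) + free_const (c w) * T_rep n w))"
    by (intro hcong_sum hcong_left step FC_const)
  moreover have "(\<Sum>w\<in>Wn n. free_const (f w) * T_rep n (p w))
      = (\<Sum>w\<in>Wn n. free_const (f (p w)) * T_rep n w)"
    using sum.reindex_bij_betw[OF assms(1), of "\<lambda>w. free_const (f (p w)) * T_rep n w"]
    by (simp add: assms(2))
  moreover have "free_const (f w) * (free_const (c w) * T_rep n w)
      = free_const (c w * f w) * T_rep n w" for w
    by (simp add: free_const_mult[symmetric] mult.assoc[symmetric] mult.commute)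
  ultimately show ?thesis
    by (simp add: Psi_rep_def distrib_left distrib_right sum.distrib free_const_add)
qed

lemma Psi_rep_cong: "(\<And>w. w \<in> Wn n \<Longrightarrow> f w = g w) \<Longrightarrow> Psi_rep n f = Psi_rep n g"
  by (simp add: Psi_rep_def)

lemma gen_Psi_rep:
  assumes s: "s \<in> simple_refls n"
  shows "hcong n (free_gen s * Psi_rep n f) (Psi_rep n (left_op n s f))"
proof -
  have inv: "s \<circ> (s \<circ> w) = w" for w by (rule simple_refls_comp_comp[OF s])
  have W: "s \<circ> w \<in> Wn n" if "w \<in> Wn n" for w by (rule Wn_comp[OF simple_refls_Wn[OF s] that])
  have "hcong n (\<Sum>w\<in>Wn n. free_const (f w) * (free_gen s * T_rep n w))
    (Psi_rep n (\<lambda>w. f (s \<circ> w) + (if len n (s \<circ> w) < len n w then q_diff else 0) * f w))"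
    by (rule hcong_reindex)
      (intro bij_betwI[where g = "\<lambda>w. s \<circ> w"] Pi_I W inv gen_T_rep[OF s] | assumption)+
  also have "Psi_rep n (\<lambda>w. f (s \<circ> w) + (if len n (s \<circ> w) < len n w then q_diff else 0) * f w)
      = Psi_rep n (left_op n s f)"
    by (rule Psi_rep_cong) (simp add: left_op_def del: comp_apply)
  finally show ?thesis by (simp add: Psi_rep_def sum_distrib_left free_const_left_commute)
qed

lemma Psi_rep_gen:
  assumes s: "s \<in> simple_refls n"
  shows "hcong n (Psi_rep n f * free_gen s) (Psi_rep n (right_op n s f))"
proof -
  obtain i where i: "s = simple_refl i" using s by (rule simple_reflsE)
  have inv: "w \<circ> s \<circ> s = w" for w unfolding i comp_assoc simple_refl_comp by (rule o_id)
  have W: "w \<circ> s \<in> Wn n" if "w \<in> Wn n" for w by (rule Wn_comp[OF that simple_refls_Wn[OF s]])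
  have "hcong n (\<Sum>w\<in>Wn n. free_const (f w) * (T_rep n w * free_gen s))
    (Psi_rep n (\<lambda>w. f (w \<circ> s) + (if len n (w \<circ> s) < len n w then q_diff else 0) * f w))"
    by (rule hcong_reindex)
      (intro bij_betwI[where g = "\<lambda>w. w \<circ> s"] Pi_I W inv T_rep_gen[OF s] | assumption)+
  also have "Psi_rep n (\<lambda>w. f (w \<circ> s) + (if len n (w \<circ> s) < len n w then q_diff else 0) * f w)
      = Psi_rep n (right_op n s f)"
    by (rule Psi_rep_cong) (simp add: right_op_def del: comp_apply)
  finally show ?thesis by (simp add: Psi_rep_def sum_distrib_right mult.assoc)
qed

lemma T_gen_Psi: "s \<in> simple_refls n \<Longrightarrow> T_gen n s \<otimes>\<^bsub>hecke n\<^esub> Psi n f = Psi n (left_op n s f)"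
  by (simp add: T_gen_def Psi_def hecke_class_mult FC_gen Psi_rep_FC hecke_class_eq_iff
      FC_mult gen_Psi_rep)

lemma Psi_T_gen: "s \<in> simple_refls n \<Longrightarrow> Psi n f \<otimes>\<^bsub>hecke n\<^esub> T_gen n s = Psi n (right_op n s f)"
  by (simp add: T_gen_def Psi_def hecke_class_mult FC_gen Psi_rep_FC hecke_class_eq_iff
      FC_mult Psi_rep_gen)

lemma Tword_Psi_rep: "set ss \<subseteq> simple_refls n \<Longrightarrow> hcong n (Tword ss) (Psi_rep n (act n ss (delta id)))"
proof (induction ss)
  case Nil
  have "hcong n (Tword []) (T_rep n id)"
    by (rule hcong_sym[OF T_rep_cong]) (simp add: reduced_word_def len_id)
  moreover have "Psi_rep n (delta id) = (\<Sum>w\<in>Wn n. if w = id then T_rep n w else 0)"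
    unfolding Psi_rep_def by (rule sum.cong) (auto simp: delta_def)
  then have "Psi_rep n (delta id) = T_rep n id" by simp
  ultimately show ?case by (simp only: act_simps)
next
  case (Cons s ss)
  then have s: "s \<in> simple_refls n" and ss: "set ss \<subseteq> simple_refls n" by auto
  have "hcong n (free_gen s * Tword ss) (free_gen s * Psi_rep n (act n ss (delta id)))"
    by (rule hcong_left[OF Cons.IH[OF ss] FC_gen[OF s]])
  also have "hcong n \<dots> (Psi_rep n (left_op n s (act n ss (delta id))))"
    by (rule gen_Psi_rep[OF s])
  finally show ?case by (simp only: act_simps Tword_Cons)
qed

lemma hcong_Psi_rep_ev:
  assumes F: "F \<in> FC n"
  shows "hcong n F (Psi_rep n (ev n F (delta id)))"
proof -
  have eq: "Poly_Mapping.single k c = free_const c * Tword (letters k)" for k c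
    by (simp add: free_const_def Tword_def mult_single)
  have "hcong n (\<Sum>k \<in> Poly_Mapping.keys F. free_const (Poly_Mapping.lookup F k) * Tword (letters k))
    (\<Sum>k \<in> Poly_Mapping.keys F.
      free_const (Poly_Mapping.lookup F k) * Psi_rep n (act n (letters k) (delta id)))"
    using F by (intro hcong_sum hcong_left Tword_Psi_rep FC_const) (simp add: FC_iff)
  then show ?thesis
    unfolding eq[symmetric] sum_singles Psi_rep_linear[symmetric]
    by (simp add: ev_def[abs_def])
qed

lemma hecke_class_Psi: "F \<in> FC n \<Longrightarrow> hecke_class n F = Psi n (ev n F (delta id))"
  unfolding Psi_def by (simp add: hecke_class_eq_iff Psi_rep_FC hcong_Psi_rep_ev)

lemma hecke_carrier_Psi: "carrier (hecke n) = Psi n ` coord_fns n"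
proof
  show "carrier (hecke n) \<subseteq> Psi n ` coord_fns n"
  proof
    fix x assume "x \<in> carrier (hecke n)"
    then obtain F where "F \<in> FC n" "x = hecke_class n F" unfolding hecke_carrier by blast
    then show "x \<in> Psi n ` coord_fns n"
      using hecke_class_Psi ev_coord_fns[OF delta_coord_fns[OF Wn_id]] by blast
  qed
qed (use Psi_in in blast)

lemma hecke_class_mult_Psi:
  assumes "F \<in> FC n" "f \<in> coord_fns n"
  shows "hecke_class n F \<otimes>\<^bsub>hecke n\<^esub> Psi n f = Psi n (ev n F f)"
proof -
  have "hecke_class n F \<otimes>\<^bsub>hecke n\<^esub> Psi n f = Psi n (ev n (F * Psi_rep n f) (delta id))"
    unfolding Psi_def[of n f] hecke_class_mult[OF assms(1) Psi_rep_FC]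
    by (rule hecke_class_Psi[OF FC_mult[OF assms(1) Psi_rep_FC]])
  then show ?thesis using assms by (simp add: ev_mult ev_Psi_rep)
qed

section \<open>Left multiplication by the basis elements in coordinates\<close>

definition TT :: "nat \<Rightarrow> perm \<Rightarrow> (perm \<Rightarrow> laurent) \<Rightarrow> perm \<Rightarrow> laurent" where
  "TT n w = ev n (T_rep n w)"

lemma TT_coord_fns: "f \<in> coord_fns n \<Longrightarrow> TT n w f \<in> coord_fns n"
  by (simp add: TT_def ev_coord_fns)

lemma T_elt_Psi: "w \<in> Wn n \<Longrightarrow> T_elt n w = Psi n (delta w)"
  by (simp add: T_elt_class hecke_class_Psi T_rep_FC ev_T_rep_delta)

lemma T_elt_mult_Psi:
  "w \<in> Wn n \<Longrightarrow> f \<in> coord_fns n \<Longrightarrow> T_elt n w \<otimes>\<^bsub>hecke n\<^esub> Psi n f = Psi n (TT n w f)"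
  by (simp add: T_elt_class hecke_class_mult_Psi T_rep_FC TT_def)

lemma Psi_mult_Psi:
  assumes "f \<in> coord_fns n" "g \<in> coord_fns n"
  shows "Psi n f \<otimes>\<^bsub>hecke n\<^esub> Psi n g = Psi n (\<lambda>v. \<Sum>w\<in>Wn n. f w * TT n w g v)"
proof -
  have "ev n (Psi_rep n f) g = (\<lambda>v. \<Sum>w\<in>Wn n. f w * TT n w g v)"
    by (rule ext) (simp add: Psi_rep_def ev_sum ev_mult ev_const TT_def)
  then show ?thesis
    using hecke_class_mult_Psi[OF Psi_rep_FC assms(2), of f] by (simp add: Psi_def)
qed

lemma left_op_TT:
  assumes "s \<in> simple_refls n" "w \<in> Wn n" "f \<in> coord_fns n"
  shows "left_op n s (TT n w f) v
    = TT n (s \<circ> w) f v + (if len n (s \<circ> w) < len n w then q_diff else 0) * TT n w f v"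
  using fun_cong[OF ev_hcong[OF gen_T_rep[OF assms(1,2)] assms(3)], of v]
  unfolding ev_mult ev_gen ev_add ev_const TT_def .

lemma TT_left_op:
  assumes "s \<in> simple_refls n" "w \<in> Wn n" "f \<in> coord_fns n"
  shows "TT n w (left_op n s f) v
    = TT n (w \<circ> s) f v + (if len n (w \<circ> s) < len n w then q_diff else 0) * TT n w f v"
  using fun_cong[OF ev_hcong[OF T_rep_gen[OF assms(1,2)] assms(3)], of v]
  unfolding ev_mult ev_gen ev_add ev_const TT_def .

lemma TT_linear: "TT n w (\<lambda>v. \<Sum>i\<in>I. a i * f i v) v = (\<Sum>i\<in>I. a i * TT n w (f i) v)"
  by (simp add: TT_def T_rep_def Tword_def ev_single act_linear)

lemma TT_smult: "TT n w (\<lambda>v. a * f v) v = a * TT n w f v"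
  using TT_linear[where I = "{()}" and a = "\<lambda>_. a" and f = "\<lambda>_. f"] by simp

lemma at_one_left_op:
  "w \<in> Wn n \<Longrightarrow> at_one (left_op n s f w) = at_one (f (s \<circ> w))"
  by (simp add: left_op_def at_one_add at_one_mult at_one_q_diff del: comp_apply)

text \<open>At \<open>q = 1\<close> the summand with \<open>q_diff\<close> disappears, so each
  operator reduces to a translation of the argument.\<close>

lemma at_one_TT:
  assumes w: "w \<in> Wn n" and v: "v \<in> Wn n"
  shows "at_one (TT n w f v) = at_one (f (inv' w \<circ> v))"
proof -
  have "at_one (act n ss f v) = at_one (f (inv' (word_prod ss) \<circ> v))"
    if "set ss \<subseteq> simple_refls n" "v \<in> Wn n" for ss v
    using that
  proof (induction ss arbitrary: v)
    case Nil
    show ?case unfolding act_simps word_prod_simps inv_id id_o ..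
  next
    case (Cons s ss)
    have s: "s \<in> simple_refls n" and ss: "set ss \<subseteq> simple_refls n" using Cons.prems by auto
    obtain i where i: "s = simple_refl i" using s by (rule simple_reflsE)
    have sv: "s \<circ> v \<in> Wn n" by (rule Wn_comp[OF simple_refls_Wn[OF s] Cons.prems(2)])
    have "at_one (act n (s # ss) f v) = at_one (f (inv' (word_prod ss) \<circ> (s \<circ> v)))"
      unfolding act_simps at_one_left_op[OF Cons.prems(2)] by (rule Cons.IH[OF ss sv])
    also have "inv' (word_prod ss) \<circ> (s \<circ> v) = inv' (word_prod (s # ss)) \<circ> v"
      unfolding word_prod_simps Wn_comp_inv[OF simple_refls_Wn[OF s] word_prod_Wn[OF ss]]
      unfolding i inv_simple_refl by (rule comp_assoc[symmetric])
    finally show ?case .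
  qed
  from this[of "SOME ss. reduced_word n w ss" v] some_reduced_word[OF w] v
  have "at_one (act n (SOME ss. reduced_word n w ss) f v) = at_one (f (inv' w \<circ> v))"
    by (simp add: reduced_word_def del: comp_apply)
  then show ?thesis by (simp add: TT_def T_rep_def Tword_def ev_single del: comp_apply)
qed

section \<open>Words and dominance\<close>

definition cnt :: "(nat \<Rightarrow> nat) \<Rightarrow> nat \<Rightarrow> nat \<Rightarrow> nat" where
  "cnt c j m = card {x \<in> {1..m}. c x = j}"

definition cnt_le :: "(nat \<Rightarrow> nat) \<Rightarrow> nat \<Rightarrow> nat \<Rightarrow> nat" where
  "cnt_le c k m = card {x \<in> {1..m}. c x \<le> k}"

lemma card_filter_Suc:
  "card {x \<in> {1..Suc m}. P x} = card {x \<in> {1..m}. P x} + (if P (Suc m) then 1 else 0)"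
proof -
  have "{x \<in> {1..Suc m}. P x} = (if P (Suc m) then insert (Suc m) {x \<in> {1..m}. P x} else {x \<in> {1..m}. P x})"
    by (auto simp: le_Suc_eq)
  then show ?thesis by simp
qed

lemma cnt_0 [simp]: "cnt c j 0 = 0"
  by (simp add: cnt_def)

lemma cnt_le_0 [simp]: "cnt_le c k 0 = 0"
  by (simp add: cnt_le_def)

lemma cnt_Suc: "cnt c j (Suc m) = cnt c j m + (if c (Suc m) = j then 1 else 0)"
  unfolding cnt_def by (rule card_filter_Suc)

lemma cnt_le_Suc: "cnt_le c k (Suc m) = cnt_le c k m + (if c (Suc m) \<le> k then 1 else 0)"
  unfolding cnt_le_def by (rule card_filter_Suc)

lemma cnt_le_cnt: "cnt_le c (Suc k) m = cnt_le c k m + cnt c (Suc k) m"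
  by (induction m) (auto simp: cnt_le_Suc cnt_Suc)

lemma cnt_cong: "(\<And>x. 1 \<le> x \<Longrightarrow> x \<le> m \<Longrightarrow> c x = c' x) \<Longrightarrow> cnt c j m = cnt c' j m"
  by (induction m) (auto simp: cnt_Suc)

lemma cnt_le_cong: "(\<And>x. 1 \<le> x \<Longrightarrow> x \<le> m \<Longrightarrow> c x = c' x) \<Longrightarrow> cnt_le c j m = cnt_le c' j m"
  by (induction m) (auto simp: cnt_le_Suc)

lemma cnt_mono: "m \<le> m' \<Longrightarrow> cnt c j m \<le> cnt c j m'"
  by (induction m' rule: dec_induct) (auto simp: cnt_Suc)

text \<open>Exchanging the letters in the places \<open>i\<close> and \<open>i + 1\<close> affects only the prefix of length \<open>i\<close>.\<close>

lemma cnt_swap: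
  assumes i: "1 \<le> i"
  shows "m \<noteq> i \<Longrightarrow> cnt (c \<circ> simple_refl i) j m = cnt c j m"
    and "cnt (c \<circ> simple_refl i) j i = cnt c j (i - 1) + (if c (Suc i) = j then 1 else 0)"
proof -
  obtain p where p: "i = Suc p" using i by (cases i) auto
  have less: "cnt (c \<circ> simple_refl i) j m = cnt c j m" if "m < i" for m
    by (rule cnt_cong) (use that in \<open>auto simp: simple_refl_apply\<close>)
  show at: "cnt (c \<circ> simple_refl i) j i = cnt c j (i - 1) + (if c (Suc i) = j then 1 else 0)"
    using less[of p] cnt_Suc[of "c \<circ> simple_refl i" j p] by (simp add: p simple_refl_apply del: comp_apply)
      (simp add: simple_refl_apply)
  assume "m \<noteq> i"
  then consider "m < i" | "Suc i \<le> m" by linarith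
  then show "cnt (c \<circ> simple_refl i) j m = cnt c j m"
  proof cases
    case 2
    then show ?thesis
    proof (induction m rule: dec_induct)
      case base
      show ?case
        using at cnt_Suc[of "c \<circ> simple_refl i" j i] cnt_Suc[of c j i] cnt_Suc[of c j p]
        unfolding comp_apply simple_refl_apply by (simp add: p del: comp_apply)
    next
      case (step m)
      then have "(c \<circ> simple_refl i) (Suc m) = c (Suc m)" by (simp add: simple_refl_apply)
      then show ?case
        using step cnt_Suc[of "c \<circ> simple_refl i" j m] cnt_Suc[of c j m] by (simp del: comp_apply)
    qed
  qed (rule less)
qed

lemma cnt_le_swap:
  assumes i: "1 \<le> i"
  shows "m \<noteq> i \<Longrightarrow> cnt_le (c \<circ> simple_refl i) j m = cnt_le c j m"
    and "cnt_le (c \<circ> simple_refl i) j i = cnt_le c j (i - 1) + (if c (Suc i) \<le> j then 1 else 0)"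
proof -
  obtain p where p: "i = Suc p" using i by (cases i) auto
  have less: "cnt_le (c \<circ> simple_refl i) j m = cnt_le c j m" if "m < i" for m
    by (rule cnt_le_cong) (use that in \<open>auto simp: simple_refl_apply\<close>)
  show at: "cnt_le (c \<circ> simple_refl i) j i = cnt_le c j (i - 1) + (if c (Suc i) \<le> j then 1 else 0)"
    using less[of p] cnt_le_Suc[of "c \<circ> simple_refl i" j p] by (simp add: p simple_refl_apply del: comp_apply)
      (simp add: simple_refl_apply)
  assume "m \<noteq> i"
  then consider "m < i" | "Suc i \<le> m" by linarith
  then show "cnt_le (c \<circ> simple_refl i) j m = cnt_le c j m"
  proof cases
    case 2
    then show ?thesis
    proof (induction m rule: dec_induct)
      case base
      show ?case
        using at cnt_le_Suc[of "c \<circ> simple_refl i" j i] cnt_le_Suc[of c j i] cnt_le_Suc[of c j p]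
        unfolding comp_apply simple_refl_apply by (simp add: p del: comp_apply)
    next
      case (step m)
      then have "(c \<circ> simple_refl i) (Suc m) = c (Suc m)" by (simp add: simple_refl_apply)
      then show ?case
        using step cnt_le_Suc[of "c \<circ> simple_refl i" j m] cnt_le_Suc[of c j m] by (simp del: comp_apply)
    qed
  qed (rule less)
qed

lemma cnt_pred: "1 \<le> i \<Longrightarrow> cnt c j i = cnt c j (i - 1) + (if c i = j then 1 else 0)"
  using cnt_Suc[of c j "i - 1"] by simp

lemma cnt_le_pred: "1 \<le> i \<Longrightarrow> cnt_le c j i = cnt_le c j (i - 1) + (if c i \<le> j then 1 else 0)"
  using cnt_le_Suc[of c j "i - 1"] by simp

text \<open>The corrections are added on both sides because subtraction on \<open>nat\<close>
  truncates.\<close>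

lemma cnt_le_transpose:
  assumes "1 \<le> a" "a < b"
  shows "cnt_le (c \<circ> transpose a b) k m + (if a \<le> m \<and> m < b \<and> c a \<le> k then 1 else 0)
    = cnt_le c k m + (if a \<le> m \<and> m < b \<and> c b \<le> k then 1 else 0)"
proof (induction m)
  case (Suc m)
  have "(c \<circ> transpose a b) (Suc m) = (if Suc m = a then c b else if Suc m = b then c a else c (Suc m))"
    by (simp add: transpose_def)
  then show ?case
    using Suc assms cnt_le_Suc[of "c \<circ> transpose a b" k m] cnt_le_Suc[of c k m]
    by (auto simp del: comp_apply split: if_splits)
qed (use assms in simp)

text \<open>
  A column standard tableau is encoded by the word \<open>c\<close> with letter \<open>c x\<close> the column of the entry \<open>x\<close>.
  The tableau is standard iff the word is a lattice word, and \<open>dominates n u c\<close> implies that \<open>u\<close> is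
  below \<open>c\<close> in the Bruhat order.
\<close>

definition dominates :: "nat \<Rightarrow> (nat \<Rightarrow> nat) \<Rightarrow> (nat \<Rightarrow> nat) \<Rightarrow> bool" where
  "dominates n u c \<longleftrightarrow> (\<forall>m \<le> n. \<forall>k. cnt_le c k m \<le> cnt_le u k m)"

definition lattice_word :: "nat \<Rightarrow> (nat \<Rightarrow> nat) \<Rightarrow> bool" where
  "lattice_word n c \<longleftrightarrow> (\<forall>m \<le> n. \<forall>j \<ge> 1. cnt c (Suc j) m \<le> cnt c j m)"

lemma dom_refl: "dominates n c c"
  by (simp add: dominates_def)

lemma dom_trans: "dominates n u v \<Longrightarrow> dominates n v w \<Longrightarrow> dominates n u w"
  unfolding dominates_def by (meson le_trans)

text \<open>The lifting property of the Bruhat order, read off from counts: only the prefix of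
  length \<open>i\<close> changes, and its new counts are controlled by those at
  \<open>i - 1\<close>, \<open>i\<close> and \<open>i + 1\<close>.\<close>

lemma dom_swap:
  assumes d: "dominates n u c" and i: "1 \<le> i" "i < n" and asc: "c i < c (Suc i)"
  shows "dominates n (u \<circ> simple_refl i) (c \<circ> simple_refl i)" "dominates n u (c \<circ> simple_refl i)"
proof -
  have le: "cnt_le c k m \<le> cnt_le u k m" if "m \<le> n" for k m
    using d that by (simp add: dominates_def)
  have key: "cnt_le (c \<circ> simple_refl i) k i \<le> cnt_le u k (i - 1) + (if u (Suc i) \<le> k then 1 else 0)"
    "cnt_le (c \<circ> simple_refl i) k i \<le> cnt_le u k i" for k
    using le[of "i - 1" k] le[of i k] le[of "Suc i" k] i asc
    unfolding cnt_le_swap(2)[OF i(1)] cnt_le_Suc cnt_le_pred[OF i(1), of c] cnt_le_pred[OF i(1), of u]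
    by (auto split: if_splits)
  show "dominates n (u \<circ> simple_refl i) (c \<circ> simple_refl i)"
    unfolding dominates_def
  proof (intro allI impI)
    fix m k assume "m \<le> n"
    then show "cnt_le (c \<circ> simple_refl i) k m \<le> cnt_le (u \<circ> simple_refl i) k m"
      using le[of m k] key[of k] by (cases "m = i") (simp_all add: cnt_le_swap[OF i(1)])
  qed
  show "dominates n u (c \<circ> simple_refl i)"
    unfolding dominates_def
  proof (intro allI impI)
    fix m k assume "m \<le> n"
    then show "cnt_le (c \<circ> simple_refl i) k m \<le> cnt_le u k m"
      using le[of m k] key[of k] by (cases "m = i") (simp_all add: cnt_le_swap(1)[OF i(1)])
  qed
qed

text \<open>Counts change in the prefix of length \<open>i\<close> only. To break the lattice
  condition there, the exchanged letters have to be \<open>j\<close> and \<open>j + 1\<close>, with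
  no surplus of \<open>j\<close> before them.\<close>

lemma lattice_swap_ascentE:
  assumes l: "lattice_word n c" and i: "1 \<le> i" "i < n" and nl: "\<not> lattice_word n (c \<circ> simple_refl i)"
  obtains j where "1 \<le> j" "c i = j" "c (Suc i) = Suc j" "cnt c j (i - 1) = cnt c (Suc j) (i - 1)"
proof -
  obtain m j where m: "m \<le> n" and j: "1 \<le> j"
    and v: "cnt (c \<circ> simple_refl i) j m < cnt (c \<circ> simple_refl i) (Suc j) m"
    using nl by (auto simp: lattice_word_def not_le)
  have le: "cnt c (Suc j) m \<le> cnt c j m" if "m \<le> n" for m
    using l j that by (simp add: lattice_word_def)
  have "m = i" using v le[OF m] cnt_swap(1)[OF i(1)] by (metis not_le)
  have "cnt c (Suc j) (i - 1) \<le> cnt c j (i - 1)" "cnt c (Suc j) (Suc i) \<le> cnt c j (Suc i)"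
    by (rule le; use i in simp)+
  then have "c i = j \<and> c (Suc i) = Suc j \<and> cnt c j (i - 1) = cnt c (Suc j) (i - 1)"
    using v unfolding \<open>m = i\<close> cnt_swap(2)[OF i(1)] cnt_Suc cnt_pred[OF i(1), of c]
    by (auto split: if_splits)
  with j that show ?thesis by blast
qed

text \<open>
  The words below a weak ascent \<open>c \<circ> s\<close> of \<open>c\<close> that belong to standard tableaux are already below
  \<open>c\<close>: the prefixes differ at \<open>i\<close> only, and a tableau violating dominance there would have equally
  many letters \<open>j\<close> and \<open>j + 1\<close> before the place \<open>i\<close> and a letter \<open>j + 1\<close> in it.
\<close>

lemma dom_weak_ascent:
  assumes c: "lattice_word n c" and u: "lattice_word n u" and i: "1 \<le> i" "i < n"
    and nl: "\<not> lattice_word n (c \<circ> simple_refl i)" and d: "dominates n u (c \<circ> simple_refl i)"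
  shows "dominates n u c"
proof -
  obtain j where j: "1 \<le> j" "c i = j" "c (Suc i) = Suc j"
    "cnt c j (i - 1) = cnt c (Suc j) (i - 1)"
    by (rule lattice_swap_ascentE[OF c i nl])
  obtain l where l: "j = Suc l" using j(1) by (cases j) auto
  have le: "cnt_le (c \<circ> simple_refl i) k m \<le> cnt_le u k m" if "m \<le> n" for k m
    using d that by (simp add: dominates_def)
  have lei: "cnt_le c k (i - 1) + (if Suc j \<le> k then 1 else 0) \<le> cnt_le u k i" for k
    using le[of i k] i j by (simp add: cnt_le_swap(2)[OF i(1)])
  have le0: "cnt_le c k (i - 1) \<le> cnt_le u k (i - 1)" for k
    using le[of "i - 1" k] i by (simp add: cnt_le_swap(1)[OF i(1)])
  have le1: "cnt_le c k (Suc i) \<le> cnt_le u k (Suc i)" for k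
    using le[of "Suc i" k] i by (simp add: cnt_le_swap(1)[OF i(1)])
  have main: "cnt_le c j i \<le> cnt_le u j i"
  proof (rule ccontr)
    assume n: "\<not> ?thesis"
    then have eq: "cnt_le u j i = cnt_le c j (i - 1)"
      using lei[of j] j by (simp add: cnt_le_pred[OF i(1)])
    have uj: "cnt u (Suc j) (i - 1) \<le> cnt u j (i - 1)" "cnt u (Suc j) i \<le> cnt u j i"
      using u i j(1) by (simp_all add: lattice_word_def)
    have ui: "\<not> u i \<le> j" and eq0: "cnt_le u j (i - 1) = cnt_le c j (i - 1)"
      using eq le0[of j] by (auto simp: cnt_le_pred[OF i(1)] split: if_splits)
    have c1: "cnt_le c j (i - 1) = cnt_le c l (i - 1) + cnt c j (i - 1)"
      "cnt_le u j (i - 1) = cnt_le u l (i - 1) + cnt u j (i - 1)"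
      "cnt_le c (Suc j) (i - 1) = cnt_le c j (i - 1) + cnt c (Suc j) (i - 1)"
      "cnt_le u (Suc j) (i - 1) = cnt_le u j (i - 1) + cnt u (Suc j) (i - 1)"
      unfolding l cnt_le_cnt by simp_all
    have e1: "cnt u j (i - 1) = cnt c j (i - 1)" "cnt u (Suc j) (i - 1) = cnt u j (i - 1)"
      "cnt_le u (Suc j) (i - 1) = cnt_le c (Suc j) (i - 1)"
      using c1 eq0 le0[of l] le0[of "Suc j"] uj(1) j(4) by linarith+
    have "u i \<le> Suc j"
      using le1[of "Suc j"] e1(3) j by (simp add: cnt_le_Suc cnt_le_pred[OF i(1)] split: if_splits)
    then have "u i = Suc j" using ui by simp
    then show False using uj(2) e1 by (simp add: cnt_pred[OF i(1)])
  qed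
  show ?thesis
    unfolding dominates_def
  proof (intro allI impI)
    fix m k assume m: "m \<le> n"
    show "cnt_le c k m \<le> cnt_le u k m"
    proof (cases "m = i")
      case True
      consider "k < j" | "k = j" | "j < k" by linarith
      then show ?thesis
        by cases (use lei[of k] main j True in \<open>simp_all add: cnt_le_pred[OF i(1)]\<close>)
    qed (use le[OF m, of k] in \<open>simp add: cnt_le_swap(1)[OF i(1)]\<close>)
  qed
qed

section \<open>Words as distinguished coset representatives\<close>

locale col_index =
  fixes n :: nat and K :: "nat \<Rightarrow> nat"
  assumes K_mono: "1 \<le> x \<Longrightarrow> x \<le> y \<Longrightarrow> y \<le> n \<Longrightarrow> K x \<le> K y"
    and K_pos: "1 \<le> x \<Longrightarrow> x \<le> n \<Longrightarrow> 1 \<le> K x"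
begin

text \<open>The inverse appears because in \<open>w t\<^sub>\<lambda>\<close> the entry
  \<open>x\<close> sits where \<open>t\<^sub>\<lambda>\<close> has \<open>inv' w x\<close>, so its
  column is \<open>K (inv' w x)\<close>.\<close>

definition words :: "(nat \<Rightarrow> nat) set" where
  "words = {K \<circ> inv' w | w. w \<in> Wn n}"

text \<open>An order condition in place of the length condition of \<open>D_par\<close>; the two
  agree by \<open>D_par_eq\<close>.\<close>

definition Dset :: "perm set" where
  "Dset = {d \<in> Wn n. \<forall>x y. 1 \<le> x \<and> x < y \<and> y \<le> n \<and> K x = K y \<longrightarrow> d x < d y}"

definition word_perm :: "(nat \<Rightarrow> nat) \<Rightarrow> perm" where
  "word_perm c = (THE d. d \<in> Dset \<and> K \<circ> inv' d = c)"

lemma finite_words: "finite words"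
proof -
  have "words = (\<lambda>w. K \<circ> inv' w) ` Wn n" by (auto simp: words_def)
  then show ?thesis by (simp only: finite_imageI[OF finite_Wn])
qed

lemma words_comp:
  assumes "c \<in> words" "p \<in> Wn n"
  shows "c \<circ> p \<in> words"
proof -
  obtain w where w: "w \<in> Wn n" "c = K \<circ> inv' w" using assms by (auto simp: words_def)
  have "inv' (inv' p \<circ> w) = inv' w \<circ> p"
    unfolding Wn_comp_inv[OF Wn_inv[OF assms(2)] w(1)] Wn_inv_inv[OF assms(2)] ..
  then have "c \<circ> p = K \<circ> inv' (inv' p \<circ> w)" unfolding w(2) comp_assoc by (simp only:)
  then show ?thesis
    unfolding words_def using Wn_comp[OF Wn_inv[OF assms(2)] w(1)] by blast
qed

lemma words_swap: "c \<in> words \<Longrightarrow> 1 \<le> i \<Longrightarrow> i < n \<Longrightarrow> c \<circ> simple_refl i \<in> words"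
  by (rule words_comp[OF _ simple_refl_Wn])

lemma words_transpose: "c \<in> words \<Longrightarrow> a \<in> {1..n} \<Longrightarrow> b \<in> {1..n} \<Longrightarrow> c \<circ> transpose a b \<in> words"
  by (rule words_comp) (auto simp: Wn_iff intro: permutes_swap_id)

lemma words_pos: "c \<in> words \<Longrightarrow> 1 \<le> x \<Longrightarrow> x \<le> n \<Longrightarrow> 1 \<le> c x"
proof -
  assume "c \<in> words" and x: "1 \<le> x" "x \<le> n"
  then obtain w where w: "w \<in> Wn n" "c = K \<circ> inv' w" by (auto simp: words_def)
  have "inv' w x \<in> {1..n}" using Wn_in[OF Wn_inv[OF w(1)], of x] x by simp
  then show "1 \<le> c x" using K_pos[of "inv' w x"] by (simp add: w(2))
qed

lemma words_outside: "c \<in> words \<Longrightarrow> x \<notin> {1..n} \<Longrightarrow> c x = K x"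
proof -
  assume "c \<in> words" and x: "x \<notin> {1..n}"
  then obtain w where w: "w \<in> Wn n" "c = K \<circ> inv' w" by (auto simp: words_def)
  have "inv' w x = x" by (rule permutes_not_in[OF _ x]) (use Wn_inv[OF w(1)] in \<open>simp add: Wn_iff\<close>)
  then show "c x = K x" by (simp add: w(2))
qed

lemma words_card:
  assumes c: "c \<in> words"
  shows "card {x \<in> {1..n}. P (c x)} = card {x \<in> {1..n}. P (K x)}"
proof -
  obtain w where w: "w \<in> Wn n" "c = K \<circ> inv' w" using c by (auto simp: words_def)
  have "bij_betw w {x \<in> {1..n}. P (K x)} {x \<in> {1..n}. P (c x)}"
  proof (rule bij_betwI[where g = "inv' w"])
    have cw: "c (w x) = K x" "c x = K (inv' w x)" for x
      by (simp_all add: w(2) Wn_inv_apply[OF w(1)])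
    show "w \<in> {x \<in> {1..n}. P (K x)} \<rightarrow> {x \<in> {1..n}. P (c x)}"
    proof (rule Pi_I)
      fix x assume "x \<in> {x \<in> {1..n}. P (K x)}"
      then show "w x \<in> {x \<in> {1..n}. P (c x)}"
        unfolding mem_Collect_eq cw(1) Wn_in[OF w(1)] .
    qed
    show "inv' w \<in> {x \<in> {1..n}. P (c x)} \<rightarrow> {x \<in> {1..n}. P (K x)}"
    proof (rule Pi_I)
      fix x assume "x \<in> {x \<in> {1..n}. P (c x)}"
      then show "inv' w x \<in> {x \<in> {1..n}. P (K x)}"
        unfolding mem_Collect_eq cw(2) Wn_in[OF Wn_inv[OF w(1)]] .
    qed
  qed (auto simp: Wn_inv_apply[OF w(1)])
  then show ?thesis by (simp add: bij_betw_same_card)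
qed

lemma words_cnt: "c \<in> words \<Longrightarrow> cnt c j n = cnt K j n"
  unfolding cnt_def by (rule words_card)

lemma words_cnt_le: "c \<in> words \<Longrightarrow> cnt_le c k n = cnt_le K k n"
  unfolding cnt_le_def by (rule words_card)

lemma dom_antisym:
  assumes "u \<in> words" "c \<in> words" "dominates n u c" "dominates n c u"
  shows "u = c"
proof (rule ext)
  fix x
  show "u x = c x"
  proof (cases "x \<in> {1..n}")
    case True
    have eq: "cnt_le u k m = cnt_le c k m" if "m \<le> n" for k m
      using assms(3,4) that by (simp add: dominates_def le_antisym)
    have iff: "u x \<le> k \<longleftrightarrow> c x \<le> k" for k
    proof -
      have "cnt_le u k x = cnt_le c k x" "cnt_le u k (x - 1) = cnt_le c k (x - 1)"
        by (rule eq; use True in auto)+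
      moreover have "1 \<le> x" using True by simp
      ultimately have "(if u x \<le> k then 1 else 0) = (if c x \<le> k then 1 else (0::nat))"
        unfolding cnt_le_pred[OF \<open>1 \<le> x\<close>] by linarith
      then show ?thesis by (simp split: if_splits)
    qed
    show ?thesis using iff[of "u x"] iff[of "c x"] le_antisym by blast
  qed (simp add: words_outside assms)
qed

lemma Dset_Wn: "d \<in> Dset \<Longrightarrow> d \<in> Wn n"
  by (simp add: Dset_def)

lemma Dset_words: "d \<in> Dset \<Longrightarrow> K \<circ> inv' d \<in> words"
  using Dset_Wn unfolding words_def by blast

lemma Dset_less:
  assumes "d \<in> Dset" "x \<in> {1..n}" "y \<in> {1..n}" "K x = K y"
  shows "d x < d y \<longleftrightarrow> x < y"
proof (cases x y rule: linorder_cases)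
  case greater
  then have "d y < d x" using assms by (simp add: Dset_def)
  then show ?thesis using greater by simp
qed (use assms in \<open>auto simp: Dset_def\<close>)

text \<open>At the first place \<open>k\<close> where they differ, say with
  \<open>d k < e k\<close>, the value \<open>d k\<close> is taken by \<open>e\<close> in the same
  column, hence at an earlier place. There \<open>d\<close> and \<open>e\<close> agree, against the
  injectivity of \<open>d\<close>.\<close>

lemma Dset_unique:
  assumes d: "d \<in> Dset" and e: "e \<in> Dset" and eq: "K \<circ> inv' d = K \<circ> inv' e"
  shows "d = e"
proof -
  have aux: "d k = e k" if "\<And>y. y < k \<Longrightarrow> d y = e y" "1 \<le> k" "k \<le> n" "d k \<le> e k"
    and d: "d \<in> Dset" and e: "e \<in> Dset" and eq: "K \<circ> inv' d = K \<circ> inv' e" for d e k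
  proof (rule ccontr)
    assume "d k \<noteq> e k"
    then have less: "d k < e k" using that by simp
    note dW = Dset_Wn[OF d] and eW = Dset_Wn[OF e]
    let ?l = "inv' e (d k)"
    have el: "e ?l = d k" by (simp add: Wn_inv_apply[OF eW])
    have l: "?l \<in> {1..n}" using Wn_in[OF Wn_inv[OF eW], of "d k"] Wn_in[OF dW, of k] that by simp
    have "K ?l = K k"
      using fun_cong[OF eq, of "d k"] by (simp add: Wn_inv_apply[OF dW])
    then have "?l < k" using Dset_less[OF e l, of k] that less el by simp
    then have "d ?l = d k" using that el by simp
    then have "?l = k" by (simp only: Wn_inj[OF dW])
    then show False using \<open>?l < k\<close> by simp
  qed
  have "d k = e k" for k
  proof (induction k rule: less_induct)
    case (less k)
    show ?case
    proof (cases "1 \<le> k \<and> k \<le> n")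
      case True
      then show ?thesis
        using aux[of k d e] aux[of k e d] less d e eq by (metis nle_le)
    next
      case False
      then show ?thesis using Dset_Wn[OF d] Dset_Wn[OF e] by (auto simp: Wn_iff permutes_def)
    qed
  qed
  then show ?thesis by (rule ext)
qed

text \<open>Columns are intervals since \<open>K\<close> is weakly increasing, so comparing
  neighbours is enough.\<close>

lemma Dset_adjacent:
  assumes w: "w \<in> Wn n" and adj: "\<And>k. 1 \<le> k \<Longrightarrow> k < n \<Longrightarrow> K k = K (Suc k) \<Longrightarrow> w k < w (Suc k)"
  shows "w \<in> Dset"
proof -
  have "w x < w y" if "1 \<le> x" "x < y" "y \<le> n" "K x = K y" for x y
    using that
  proof (induction y)
    case (Suc y)
    show ?case
    proof (cases "x = y")
      case True
      then show ?thesis using adj[of x] Suc.prems by simp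
    next
      case False
      have "K x \<le> K y" "K y \<le> K (Suc y)"
        by (rule K_mono; use Suc.prems False in simp)+
      then have "K y = K x" using Suc.prems by simp
      then show ?thesis using Suc adj[of y] False by simp
    qed
  qed simp
  then show ?thesis using w by (auto simp: Dset_def)
qed

text \<open>A descent inside a column can be removed by a reflection on the right, which leaves the
  word unchanged and shortens the permutation.\<close>

lemma Dset_exists: "w \<in> Wn n \<Longrightarrow> \<exists>d \<in> Dset. K \<circ> inv' d = K \<circ> inv' w"
proof (induction "len n w" arbitrary: w rule: less_induct)
  case less
  show ?case
  proof (cases "\<exists>k. 1 \<le> k \<and> k < n \<and> K k = K (Suc k) \<and> w (Suc k) < w k")
    case True
    then obtain k where k: "1 \<le> k" "k < n" "K k = K (Suc k)" "w (Suc k) < w k" by blast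
    let ?u = "w \<circ> simple_refl k"
    have "len n ?u < len n w" using len_comp_right(2)[OF less.prems k(1,2,4)] by linarith
    moreover have "?u \<in> Wn n" by (rule Wn_comp[OF less.prems simple_refl_Wn[OF k(1,2)]])
    ultimately obtain d where "d \<in> Dset" "K \<circ> inv' d = K \<circ> inv' ?u"
      using less.hyps[of ?u] by blast
    moreover have "K \<circ> inv' ?u = K \<circ> inv' w"
      unfolding Wn_comp_inv[OF less.prems simple_refl_Wn[OF k(1,2)]] inv_simple_refl
        comp_assoc[symmetric] comp_simple_refl_eq[OF k(3)] ..
    ultimately show ?thesis by metis
  next
    case False
    then have "w \<in> Dset"
      using Wn_adjacent_neq[OF less.prems] by (intro Dset_adjacent less.prems) blast
    then show ?thesis by blast
  qed
qed

lemma word_perm_eq: "d \<in> Dset \<Longrightarrow> word_perm (K \<circ> inv' d) = d"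
  unfolding word_perm_def by (rule the_equality) (auto intro: Dset_unique)

lemma word_perm:
  assumes "c \<in> words"
  shows "word_perm c \<in> Dset" "K \<circ> inv' (word_perm c) = c"
proof -
  obtain w where "w \<in> Wn n" "c = K \<circ> inv' w" using assms by (auto simp: words_def)
  then obtain d where "d \<in> Dset" "K \<circ> inv' d = c" using Dset_exists[of w] by auto
  with word_perm_eq[of d] show "word_perm c \<in> Dset" "K \<circ> inv' (word_perm c) = c" by auto
qed

lemma word_perm_Wn: "c \<in> words \<Longrightarrow> word_perm c \<in> Wn n"
  by (rule Dset_Wn[OF word_perm(1)])

lemma word_perm_apply: "c \<in> words \<Longrightarrow> c x = K (inv' (word_perm c) x)"
  using fun_cong[OF word_perm(2), of c x] by simp

lemma word_perm_less_inv:
  assumes c: "c \<in> words" and xy: "x \<in> {1..n}" "y \<in> {1..n}" "c x < c y"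
  shows "inv' (word_perm c) x < inv' (word_perm c) y"
proof (rule ccontr)
  assume "\<not> ?thesis"
  then have "inv' (word_perm c) y \<le> inv' (word_perm c) x" by simp
  then have "K (inv' (word_perm c) y) \<le> K (inv' (word_perm c) x)"
    using Wn_in[OF Wn_inv[OF word_perm_Wn[OF c]]] xy by (intro K_mono) auto
  then show False using xy by (simp add: word_perm_apply[OF c])
qed

lemma word_perm_swap:
  assumes c: "c \<in> words" and i: "1 \<le> i" "i < n" and neq: "c i \<noteq> c (Suc i)"
  shows "word_perm (c \<circ> simple_refl i) = simple_refl i \<circ> word_perm c"
proof -
  let ?s = "simple_refl i"
  have dW: "word_perm c \<in> Wn n" by (rule word_perm_Wn[OF c])
  have "?s \<circ> word_perm c \<in> Dset"
    unfolding Dset_def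
  proof (safe intro!: Wn_comp[OF simple_refl_Wn[OF i] dW])
    fix x y assume xy: "1 \<le> x" "x < y" "y \<le> n" "K x = K y"
    have "word_perm c x < word_perm c y" using word_perm(1)[OF c] xy by (simp add: Dset_def)
    moreover have "c (word_perm c x) = c (word_perm c y)" using xy by (simp add: word_perm_apply[OF c] Wn_inv_apply[OF dW])
    then have "\<not> (word_perm c x = i \<and> word_perm c y = Suc i)" using neq by auto
    ultimately show "(?s \<circ> word_perm c) x < (?s \<circ> word_perm c) y" by (auto simp: simple_refl_apply)
  qed
  moreover have "K \<circ> inv' (?s \<circ> word_perm c) = c \<circ> ?s"
    unfolding inv_comp_left[OF dW i] comp_assoc[symmetric] word_perm(2)[OF c] ..
  ultimately show ?thesis using word_perm_eq by metis
qed

lemma word_perm_ascent: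
  assumes c: "c \<in> words" and i: "1 \<le> i" "i < n" and asc: "c i < c (Suc i)"
  shows "len n (word_perm c) < len n (simple_refl i \<circ> word_perm c)"
  unfolding len_left_less_iff(1)[OF word_perm_Wn[OF c] i] by (rule word_perm_less_inv[OF c]) (use i asc in auto)

lemma word_perm_descent:
  assumes c: "c \<in> words" and i: "1 \<le> i" "i < n" and desc: "c (Suc i) < c i"
  shows "len n (simple_refl i \<circ> word_perm c) < len n (word_perm c)"
  unfolding len_left_less_iff(2)[OF word_perm_Wn[OF c] i] by (rule word_perm_less_inv[OF c]) (use i desc in auto)

text \<open>The remaining case of Deodhar's lemma. Two consecutive entries of one column are
  neighbours in it, since an entry between them would have a value strictly between \<open>i\<close>
  and \<open>i + 1\<close>; so the reflection passes to the right as one of the column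
  stabiliser.\<close>

lemma word_perm_equal:
  assumes c: "c \<in> words" and i: "1 \<le> i" "i < n" and eq: "c i = c (Suc i)"
  obtains k where "1 \<le> k" "k < n" "K k = K (Suc k)"
    "simple_refl i \<circ> word_perm c = word_perm c \<circ> simple_refl k" "len n (word_perm c) < len n (word_perm c \<circ> simple_refl k)"
    "simple_refl i \<circ> word_perm c \<notin> Dset"
proof -
  let ?d = "word_perm c"
  have d: "?d \<in> Dset" and dW: "?d \<in> Wn n" using word_perm(1)[OF c] word_perm_Wn[OF c] by auto
  let ?k = "inv' ?d i" and ?l = "inv' ?d (Suc i)"
  have dk: "?d ?k = i" "?d ?l = Suc i" by (simp_all add: Wn_inv_apply[OF dW])
  have k: "?k \<in> {1..n}" and l: "?l \<in> {1..n}" using Wn_in[OF Wn_inv[OF dW]] i by auto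
  have K: "K ?k = K ?l" using eq by (simp add: word_perm_apply[OF c])
  have "?k < ?l" using Dset_less[OF d k l K] dk by simp
  have lk: "?l = Suc ?k"
  proof (rule ccontr)
    assume "?l \<noteq> Suc ?k"
    then have m: "Suc ?k < ?l" using \<open>?k < ?l\<close> by simp
    have m': "Suc ?k \<in> {1..n}" using m l by auto
    have "K ?k \<le> K (Suc ?k)" "K (Suc ?k) \<le> K ?l"
      using k l m by (auto intro!: K_mono)
    then have "K (Suc ?k) = K ?k" "K (Suc ?k) = K ?l" using K by auto
    then have "?d ?k < ?d (Suc ?k)" "?d (Suc ?k) < ?d ?l"
      using Dset_less[OF d k m'] Dset_less[OF d m' l] m by auto
    then show False using dk by simp
  qed
  then have l': "?d (Suc ?k) = Suc i" using dk by simp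
  have kk: "1 \<le> ?k" "?k < n" "K ?k = K (Suc ?k)" using k l K lk by auto
  have comm: "simple_refl i \<circ> ?d = ?d \<circ> simple_refl ?k"
  proof (rule ext)
    fix x
    have "?d x = i \<longleftrightarrow> x = ?k" "?d x = Suc i \<longleftrightarrow> x = Suc ?k"
      using Wn_inj[OF dW, of x ?k] Wn_inj[OF dW, of x "Suc ?k"] dk l' by auto
    then show "(simple_refl i \<circ> ?d) x = (?d \<circ> simple_refl ?k) x"
      by (auto simp: simple_refl_apply dk l')
  qed
  have "len n ?d < len n (?d \<circ> simple_refl ?k)"
    unfolding len_right_less_iff(1)[OF dW kk(1,2)] using dk l' by simp
  moreover have "simple_refl i \<circ> ?d \<notin> Dset"
  proof
    assume "simple_refl i \<circ> ?d \<in> Dset"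
    from Dset_less[OF this k l K] show False using \<open>?k < ?l\<close> dk by (simp add: simple_refl_apply)
  qed
  ultimately show ?thesis using kk comm that[of ?k] by blast
qed

text \<open>In the tableau \<open>d t\<^sub>\<lambda>\<close> with word \<open>c\<close>, the row of an entry \<open>y\<close> is the number of letters equal to \<open>c y\<close> up to the place \<open>y\<close>.\<close>

lemma cnt_word_perm:
  assumes c: "c \<in> words" and y: "y \<in> {1..n}"
  shows "cnt K (K (inv' (word_perm c) y)) (inv' (word_perm c) y) = cnt c (c y) y"
proof -
  let ?d = "word_perm c"
  let ?z = "inv' ?d y"
  have d: "?d \<in> Dset" and dW: "?d \<in> Wn n" using word_perm(1)[OF c] word_perm_Wn[OF c] by auto
  have range: "inv' ?d x \<in> {1..n}" if "x \<in> {1..n}" for x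
    using Wn_in[OF Wn_inv[OF dW], of x] that by simp
  have range': "?d x \<in> {1..n}" if "x \<in> {1..n}" for x
    using Wn_in[OF dW, of x] that by simp
  have le: "?d x \<le> y \<longleftrightarrow> x \<le> ?z" if "x \<in> {1..n}" "K x = K ?z" for x
    using Dset_less[OF d range[OF y] that(1)] that(2) by (simp add: Wn_inv_apply[OF dW] not_less[symmetric])
  have "bij_betw ?d {x \<in> {1..?z}. K x = K ?z} {x \<in> {1..y}. c x = c y}"
  proof (rule bij_betwI[where g = "inv' ?d"])
    show "?d \<in> {x \<in> {1..?z}. K x = K ?z} \<rightarrow> {x \<in> {1..y}. c x = c y}"
    proof
      fix x assume x: "x \<in> {x \<in> {1..?z}. K x = K ?z}"
      then have "x \<in> {1..n}" "K x = K ?z" using range[OF y] by auto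
      then show "?d x \<in> {x \<in> {1..y}. c x = c y}"
        using le[of x] range'[of x] x by (simp add: word_perm_apply[OF c] Wn_inv_apply[OF dW])
    qed
    show "inv' ?d \<in> {x \<in> {1..y}. c x = c y} \<rightarrow> {x \<in> {1..?z}. K x = K ?z}"
    proof
      fix x assume x: "x \<in> {x \<in> {1..y}. c x = c y}"
      then have xn: "x \<in> {1..n}" using y by auto
      show "inv' ?d x \<in> {x \<in> {1..?z}. K x = K ?z}"
        using le[OF range[OF xn]] range[OF xn] x by (simp add: word_perm_apply[OF c] Wn_inv_apply[OF dW])
    qed
  qed (simp_all add: Wn_inv_apply[OF dW])
  then show ?thesis by (simp add: cnt_def bij_betw_same_card)
qed

lemma ninv_le: "ninv n c \<le> n * n"
proof -
  have "card (invs n c) \<le> card ({1..n} \<times> {1..n})"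
    by (rule card_mono) (auto simp: invs_def)
  then show ?thesis by (simp add: ninv_def)
qed

text \<open>The tableau criterion for the Bruhat order. As long as \<open>u\<close> differs from
  \<open>c\<close>, a transposition of two places moves it up by a Bruhat step and keeps it below
  \<open>c\<close>. Lengths are at most \<open>n * n\<close>, so this ends at
  \<open>c\<close>.\<close>

lemma bruhat_le_if_dom:
  assumes "u \<in> words" "c \<in> words" "dominates n u c"
  shows "bruhat_le n (word_perm u) (word_perm c)"
  using assms
proof (induction "n * n - len n (word_perm u)" arbitrary: u rule: less_induct)
  case less
  note u = less.prems(1) and c = less.prems(2)
  have le: "cnt_le c k m \<le> cnt_le u k m" if "m \<le> n" for k m
    using less.prems(3) that by (simp add: dominates_def)
  show ?case
  proof (cases "u = c")
    case True
    then show ?thesis by (simp add: bruhat_le_def)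
  next
    case False
    then have ex: "\<exists>x. u x \<noteq> c x" by auto
    define a where "a = (LEAST x. u x \<noteq> c x)"
    have ua: "u a \<noteq> c a" unfolding a_def by (rule LeastI_ex[OF ex])
    have pre: "u x = c x" if "x < a" for x using not_less_Least[of x] that unfolding a_def by blast
    have a: "a \<in> {1..n}"
    proof (rule ccontr)
      assume "a \<notin> {1..n}"
      then have "u a = c a" using words_outside[OF u] words_outside[OF c] by metis
      then show False using ua by simp
    qed
    have prec: "cnt_le u k (a - 1) = cnt_le c k (a - 1)" for k
      by (rule cnt_le_cong) (use pre a in auto)
    have "u a \<le> c a"
      using le[of a "c a"] prec[of "c a"] a by (simp add: cnt_le_pred split: if_splits)
    then have less_a: "u a < c a" using ua by simp
    \<comment> \<open>Otherwise \<open>u\<close> would have fewer letters than \<open>c\<close> in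
      the interval from \<open>u a + 1\<close> to \<open>c a\<close>, as the words agree before
      \<open>a\<close> and \<open>c\<close> has such a letter at \<open>a\<close>. But both are
      rearrangements of \<open>K\<close>.\<close>
    have "\<exists>b. a < b \<and> b \<le> n \<and> u a < u b \<and> u b \<le> c a"
    proof (rule ccontr)
      assume nb: "\<not> ?thesis"
      let ?P = "\<lambda>l. u a < l \<and> l \<le> c a"
      have "{x \<in> {1..n}. ?P (u x)} \<subset> {x \<in> {1..n}. ?P (c x)}"
      proof (rule psubsetI)
        show "{x \<in> {1..n}. ?P (u x)} \<subseteq> {x \<in> {1..n}. ?P (c x)}"
        proof
          fix x assume "x \<in> {x \<in> {1..n}. ?P (u x)}"
          then have x: "x \<in> {1..n}" "u a < u x" "u x \<le> c a" by auto
          then have "x < a" using nb by (cases x a rule: linorder_cases) auto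
          then show "x \<in> {x \<in> {1..n}. ?P (c x)}" using x pre[of x] by simp
        qed
        show "{x \<in> {1..n}. ?P (u x)} \<noteq> {x \<in> {1..n}. ?P (c x)}"
          using a less_a by blast
      qed
      then have "card {x \<in> {1..n}. ?P (u x)} < card {x \<in> {1..n}. ?P (c x)}"
        by (intro psubset_card_mono) auto
      then show False using words_card[OF u, of ?P] words_card[OF c, of ?P] by simp
    qed
    then have exb: "\<exists>b. a < b \<and> u a < u b \<and> u b \<le> c a" by blast
    define b where "b = (LEAST b. a < b \<and> u a < u b \<and> u b \<le> c a)"
    have b: "a < b" "u a < u b" "u b \<le> c a" using LeastI_ex[OF exb] unfolding b_def by auto
    have bmin: "\<not> (u a < u x \<and> u x \<le> c a)" if "a < x" "x < b" for x
      using not_less_Least[of x] that unfolding b_def by blast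
    have "b \<le> n"
    proof -
      obtain b' where "a < b'" "b' \<le> n" "u a < u b'" "u b' \<le> c a"
        using \<open>\<exists>b. a < b \<and> b \<le> n \<and> u a < u b \<and> u b \<le> c a\<close> by blast
      then have "b \<le> b'" unfolding b_def by (intro Least_le conjI)
      then show ?thesis using \<open>b' \<le> n\<close> by simp
    qed
    then have bn: "b \<in> {1..n}" using a b by auto
    \<comment> \<open>Moving the last \<open>u a\<close> before \<open>b\<close>, rather than the
      one at \<open>a\<close>, keeps equal letters in order, so that the product with the
      transposition stays in \<open>Dset\<close>. For the same reason \<open>b\<close> is chosen
      least.\<close>
    define a' where "a' = Max {x. a \<le> x \<and> x < b \<and> u x = u a}"
    have "a' \<in> {x. a \<le> x \<and> x < b \<and> u x = u a}"
      unfolding a'_def by (rule Max_in) (use b in auto)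
    then have a': "a \<le> a'" "a' < b" "u a' = u a" by auto
    have amax: "u x \<noteq> u a" if "a' < x" "x < b" for x
    proof
      assume "u x = u a"
      then have "x \<le> a'" unfolding a'_def using that a' by (intro Max_ge) auto
      then show False using that by simp
    qed
    have a'n: "a' \<in> {1..n}" using a a' bn by auto
    let ?t = "transpose a' b"
    let ?d = "word_perm u" and ?u = "u \<circ> ?t"
    have dW: "?d \<in> Wn n" by (rule word_perm_Wn[OF u])
    have tW: "?t \<in> Wn n" using a'n bn by (simp add: Wn_iff permutes_swap_id)
    have uw: "?u \<in> words" by (rule words_transpose[OF u a'n bn])
    have word: "K \<circ> inv' (?t \<circ> ?d) = ?u"
    proof -
      have "inv' (?t \<circ> ?d) = inv' ?d \<circ> ?t" unfolding Wn_comp_inv[OF tW dW] by simp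
      then show ?thesis using word_perm(2)[OF u] by (metis comp_assoc)
    qed
    have "?t \<circ> ?d \<in> Dset"
      unfolding Dset_def
    proof (safe intro!: Wn_comp[OF tW dW])
      fix x y assume xy: "1 \<le> x" "x < y" "y \<le> n" "K x = K y"
      have l: "?d x < ?d y" using word_perm(1)[OF u] xy by (simp add: Dset_def)
      have e: "u (?d x) = u (?d y)" using xy by (simp add: word_perm_apply[OF u] Wn_inv_apply[OF dW])
      have n1: "\<not> (a' < ?d y \<and> ?d y < b)" if "?d x = a'"
        using amax[of "?d y"] e that a' by auto
      have n2: "\<not> (a' < ?d x \<and> ?d x < b)" if "?d y = b"
        using bmin[of "?d x"] e that a' b by auto
      show "(?t \<circ> ?d) x < (?t \<circ> ?d) y"
        using l e n1 n2 a' b by (auto simp: transpose_def)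
    qed
    then have du: "word_perm ?u = ?t \<circ> ?d" using word_perm_eq word by metis
    have "ninv n (inv' ?d) < ninv n (inv' ?d \<circ> ?t)"
      by (rule ninv_transpose) (use a'n bn a' b word_perm_less_inv[OF u a'n bn] in auto)
    moreover have "inv' ?d \<circ> ?t = inv' (?t \<circ> ?d)" unfolding Wn_comp_inv[OF tW dW] by simp
    ultimately have lless: "len n ?d < len n (?t \<circ> ?d)"
      using len_inv[OF dW] len_inv[OF Wn_comp[OF tW dW]]
        len_eq_ninv[OF Wn_inv[OF dW]] len_eq_ninv[OF Wn_inv[OF Wn_comp[OF tW dW]]] by simp
    have step: "bruhat_step n ?d (?t \<circ> ?d)"
      unfolding bruhat_step_def using dW lless a'n bn a' by auto
    have dom: "dominates n ?u c"
      unfolding dominates_def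
    proof (intro allI impI)
      fix m k assume m: "m \<le> n"
      have t: "cnt_le ?u k m + (if a' \<le> m \<and> m < b \<and> u a' \<le> k then 1 else 0)
          = cnt_le u k m + (if a' \<le> m \<and> m < b \<and> u b \<le> k then 1 else 0)"
        by (rule cnt_le_transpose) (use a'n a' in auto)
      show "cnt_le c k m \<le> cnt_le ?u k m"
      proof (cases "a' \<le> m \<and> m < b \<and> u a \<le> k \<and> k < u b")
        \<comment> \<open>From \<open>a\<close> to \<open>m\<close> the word \<open>u\<close> has no
          letter in the interval from \<open>k + 1\<close> to \<open>c a\<close>, while
          \<open>c\<close> has one at \<open>a\<close>. Comparing the counts at \<open>c a\<close>
          leaves a surplus of one at \<open>k\<close>, which pays for the exchange.\<close>
        case True
        have "cnt_le u (c a) m + cnt_le u k (a - 1) = cnt_le u k m + cnt_le u (c a) (a - 1)"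
          if "a - 1 \<le> m" "m < b" for m
          using that
        proof (induction m rule: dec_induct)
          case (step m)
          have "u (Suc m) \<le> c a \<longleftrightarrow> u (Suc m) \<le> k"
          proof (cases "Suc m = a")
            case False
            then have "a < Suc m" using step(1) a by auto
            then have "\<not> (u a < u (Suc m) \<and> u (Suc m) \<le> c a)" using step by (intro bmin) auto
            then show ?thesis using True b by auto
          qed (use True less_a in auto)
          then show ?case using step by (simp add: cnt_le_Suc)
        qed simp
        moreover have "cnt_le c k m + cnt_le c (c a) (a - 1) + 1 \<le> cnt_le c (c a) m + cnt_le c k (a - 1)"
          if "a \<le> m" for m
          using that
        proof (induction m rule: dec_induct)
          case base
          then show ?case using True b a by (simp add: cnt_le_pred)
        next
          case (step m)
          then show ?case using True b by (auto simp: cnt_le_Suc)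
        qed
        ultimately have "cnt_le u (c a) m + cnt_le u k (a - 1) = cnt_le u k m + cnt_le u (c a) (a - 1)"
          "cnt_le c k m + cnt_le c (c a) (a - 1) + 1 \<le> cnt_le c (c a) m + cnt_le c k (a - 1)"
          using True a' by auto
        then have "cnt_le c k m + 1 \<le> cnt_le u k m"
          using le[OF m, of "c a"] prec[of k] prec[of "c a"] by linarith
        then show ?thesis using t by (auto split: if_splits)
      qed (use t le[OF m, of k] a' b in \<open>auto split: if_splits\<close>)
    qed
    have "len n (?t \<circ> ?d) \<le> n * n"
      using ninv_le len_eq_ninv[OF Wn_comp[OF tW dW]] by simp
    then have "bruhat_le n (word_perm ?u) (word_perm c)"
      using less.hyps[OF _ uw c dom] lless du by simp
    then show ?thesis
      unfolding du bruhat_le_def using step by (meson converse_rtranclp_into_rtranclp)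
  qed
qed

end

section \<open>Functions that are symmetric along the rows\<close>

lemma right_op_coord_fns: "right_op n s f \<in> coord_fns n"
  by (simp add: right_op_def coord_fns_def)

lemma right_op_linear:
  "right_op n s (\<lambda>w. \<Sum>i\<in>I. a i * f i w) = (\<lambda>w. \<Sum>i\<in>I. a i * right_op n s (f i) w)"
  by (rule ext) (simp add: right_op_def distrib_left sum.distrib sum_distrib_left mult.left_commute
      del: comp_apply)

text \<open>Associativity: left and right multiplications commute.\<close>

lemma right_op_TT:
  assumes t: "t \<in> simple_refls n" and w: "w \<in> Wn n" and f: "f \<in> coord_fns n"
  shows "right_op n t (TT n w f) = TT n w (right_op n t f)"
proof (rule Psi_inj)
  interpret Group.monoid "hecke n" by (rule hecke_monoid)
  have T: "T_gen n t \<in> carrier (hecke n)" "T_elt n w \<in> carrier (hecke n)"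
    using t w by (simp_all add: T_gen_def hecke_class_in FC_gen T_elt_class T_rep_FC)
  have "Psi n (right_op n t (TT n w f)) = T_elt n w \<otimes>\<^bsub>hecke n\<^esub> Psi n f \<otimes>\<^bsub>hecke n\<^esub> T_gen n t"
    using t w f by (simp add: Psi_T_gen T_elt_mult_Psi)
  also have "\<dots> = T_elt n w \<otimes>\<^bsub>hecke n\<^esub> (Psi n f \<otimes>\<^bsub>hecke n\<^esub> T_gen n t)"
    by (rule m_assoc) (simp_all add: T Psi_in)
  also have "\<dots> = Psi n (TT n w (right_op n t f))"
    using t w by (simp add: Psi_T_gen T_elt_mult_Psi right_op_coord_fns)
  finally show "Psi n (right_op n t (TT n w f)) = Psi n (TT n w (right_op n t f))" .
qed (simp_all add: right_op_coord_fns TT_coord_fns)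

text \<open>Right eigenvectors of trivial type for the row stabiliser. By
  \<open>row_eigen_TT\<close> and \<open>row_eigen_sum\<close> the set is stable under left
  multiplication, so row symmetry passes from the generator to all vectors built from it.\<close>

definition row_eigen :: "nat \<Rightarrow> (nat \<Rightarrow> nat) \<Rightarrow> (perm \<Rightarrow> laurent) set" where
  "row_eigen n \<rho> = {f \<in> coord_fns n. \<forall>k. 1 \<le> k \<and> k < n \<and> \<rho> k = \<rho> (Suc k) \<longrightarrow>
     right_op n (simple_refl k) f = (\<lambda>w. q * f w)}"

lemma row_eigen_sum:
  assumes "\<And>i. i \<in> I \<Longrightarrow> f i \<in> row_eigen n \<rho>"
  shows "(\<lambda>w. \<Sum>i\<in>I. a i * f i w) \<in> row_eigen n \<rho>"
proof -
  have "f i w = 0" if "i \<in> I" "w \<notin> Wn n" for i w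
    using assms[OF that(1)] that(2) by (simp add: row_eigen_def coord_fns_def)
  then have "(\<lambda>w. \<Sum>i\<in>I. a i * f i w) \<in> coord_fns n" by (simp add: coord_fns_def)
  moreover have "right_op n (simple_refl k) (\<lambda>w. \<Sum>i\<in>I. a i * f i w) = (\<lambda>w. q * (\<Sum>i\<in>I. a i * f i w))"
    if k: "1 \<le> k" "k < n" "\<rho> k = \<rho> (Suc k)" for k
  proof (rule ext)
    fix w
    have "right_op n (simple_refl k) (f i) = (\<lambda>w. q * f i w)" if "i \<in> I" for i
      using assms[OF that] k by (simp add: row_eigen_def)
    then show "right_op n (simple_refl k) (\<lambda>w. \<Sum>i\<in>I. a i * f i w) w = q * (\<Sum>i\<in>I. a i * f i w)"
      unfolding right_op_linear by (simp add: sum_distrib_left mult.left_commute)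
  qed
  ultimately show ?thesis by (simp add: row_eigen_def)
qed

lemma row_eigen_TT:
  assumes f: "f \<in> row_eigen n \<rho>" and w: "w \<in> Wn n"
  shows "TT n w f \<in> row_eigen n \<rho>"
proof -
  have F: "f \<in> coord_fns n" using f by (simp add: row_eigen_def)
  have "right_op n (simple_refl k) (TT n w f) = (\<lambda>v. q * TT n w f v)"
    if k: "1 \<le> k" "k < n" "\<rho> k = \<rho> (Suc k)" for k
  proof -
    have e: "right_op n (simple_refl k) f = (\<lambda>w. q * f w)" using f k by (simp add: row_eigen_def)
    show ?thesis
      unfolding right_op_TT[OF simple_refl_in[OF k(1,2)] w F] e by (rule ext) (rule TT_smult)
  qed
  then show ?thesis using TT_coord_fns[OF F] by (simp add: row_eigen_def)
qed

text \<open>Below only the sign of a monomial factor matters: two monomials with coefficient 1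
  cannot cancel, as \<open>qpow_plus_nonzero\<close> sees at \<open>q = 1\<close>.\<close>

definition qpow :: "int \<Rightarrow> laurent" where
  "qpow m = Poly_Mapping.single m 1"

lemma qpow_add: "qpow a * qpow b = qpow (a + b)"
  by (simp add: qpow_def mult_single)

lemma qpow_1: "qpow 1 = q" "qpow (- 1) = q_inv"
  by (simp_all add: qpow_def q_def q_inv_def)

lemma qpow_plus_nonzero: "qpow a + qpow b \<noteq> 0"
proof
  assume "qpow a + qpow b = 0"
  then have "at_one (qpow a + qpow b) = 0" by simp
  then show False by (simp add: at_one_add qpow_def)
qed

lemma row_eigen_step:
  assumes f: "f \<in> row_eigen n \<rho>" and u: "u \<in> Wn n" and k: "1 \<le> k" "k < n" "\<rho> k = \<rho> (Suc k)"
  shows "\<exists>m. f (u \<circ> simple_refl k) = qpow m * f u"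
proof -
  have "right_op n (simple_refl k) f = (\<lambda>w. q * f w)" using f k by (simp add: row_eigen_def)
  from fun_cong[OF this, of u]
  have "f (u \<circ> simple_refl k) + (if len n (u \<circ> simple_refl k) < len n u then q_diff else 0) * f u = q * f u"
    using u by (simp add: right_op_def del: comp_apply)
  then have "f (u \<circ> simple_refl k) = q * f u \<or> f (u \<circ> simple_refl k) = q_inv * f u"
    by (cases "len n (u \<circ> simple_refl k) < len n u")
      (simp_all add: q_diff_def left_diff_distrib eq_diff_eq[symmetric])
  then show ?thesis unfolding qpow_1[symmetric] by blast
qed

text \<open>Rows are intervals because \<open>\<rho>\<close> is monotone, so the transposition is a
  product of simple reflections of the row, each contributing a monomial.\<close>

lemma row_eigen_transpose:
  assumes f: "f \<in> row_eigen n \<rho>"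
    and mono: "\<And>x y. 1 \<le> x \<Longrightarrow> x \<le> y \<Longrightarrow> y \<le> n \<Longrightarrow> \<rho> x \<le> \<rho> y"
    and "u \<in> Wn n" "1 \<le> a" "a < b" "b \<le> n" "\<rho> a = \<rho> b"
  shows "\<exists>m. f (u \<circ> transpose a b) = qpow m * f u"
  using assms(3-)
proof (induction "b - a" arbitrary: a u)
  case 0
  then show ?case by simp
next
  case (Suc d)
  show ?case
  proof (cases "b = Suc a")
    case True
    then show ?thesis using row_eigen_step[OF f, of u a] Suc.prems by (simp add: simple_refl_def)
  next
    case False
    then have ab: "Suc a < b" using Suc.prems by simp
    have "\<rho> a \<le> \<rho> (Suc a)" "\<rho> (Suc a) \<le> \<rho> b" by (rule mono; use Suc.prems ab in simp)+
    then have r: "\<rho> (Suc a) = \<rho> b" "\<rho> a = \<rho> (Suc a)" using Suc.prems by auto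
    have a: "1 \<le> a" "a < n" using Suc.prems by auto
    let ?s = "simple_refl a" and ?t = "transpose (Suc a) b"
    have sW: "?s \<in> Wn n" by (rule simple_refl_Wn[OF a])
    have tW: "?t \<in> Wn n" using Suc.prems ab by (simp add: Wn_iff permutes_swap_id)
    have u1: "u \<circ> ?s \<in> Wn n" by (rule Wn_comp[OF Suc.prems(1) sW])
    have u2: "u \<circ> ?s \<circ> ?t \<in> Wn n" by (rule Wn_comp[OF u1 tW])
    have eq: "u \<circ> transpose a b = u \<circ> ?s \<circ> ?t \<circ> ?s"
      using ab by (auto simp: fun_eq_iff simple_refl_apply transpose_def)
    obtain m1 where m1: "f (u \<circ> ?s) = qpow m1 * f u"
      using row_eigen_step[OF f Suc.prems(1) a r(2)] by blast
    obtain m2 where m2: "f (u \<circ> ?s \<circ> ?t) = qpow m2 * f (u \<circ> ?s)"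
    proof -
      have "d = b - Suc a" using Suc.hyps(2) by arith
      from Suc.hyps(1)[OF this u1 _ ab Suc.prems(4) r(1)] that show ?thesis by auto
    qed
    obtain m3 where m3: "f (u \<circ> ?s \<circ> ?t \<circ> ?s) = qpow m3 * f (u \<circ> ?s \<circ> ?t)"
      using row_eigen_step[OF f u2 a r(2)] by blast
    show ?thesis
      unfolding eq m3 m2 m1 mult.assoc[symmetric] qpow_add by blast
  qed
qed

lemma left_op_eigen:
  assumes u: "u \<in> Wn n" and e: "left_op n (simple_refl i) f u = - q_inv * f u"
  shows "\<exists>m. f (simple_refl i \<circ> u) = - (qpow m * f u)"
proof -
  have "f (simple_refl i \<circ> u) + (if len n (simple_refl i \<circ> u) < len n u then q_diff else 0) * f u = - q_inv * f u"
    using e u by (simp add: left_op_def del: comp_apply)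
  then have "f (simple_refl i \<circ> u) = - (q * f u) \<or> f (simple_refl i \<circ> u) = - (q_inv * f u)"
    by (cases "len n (simple_refl i \<circ> u) < len n u")
      (simp_all add: q_diff_def left_diff_distrib eq_diff_eq[symmetric])
  then show ?thesis unfolding qpow_1[symmetric] by blast
qed

text \<open>For adjacent \<open>x\<close> and \<open>y\<close>, multiplying \<open>u\<close> by
  \<open>simple_refl x\<close> on the left is multiplying it on the right by a transposition within
  a row. The first gives a negative monomial factor, the second a positive one, so the value is
  zero. In general, left multiplications move \<open>y\<close> next to \<open>x\<close> and change
  the value by nonzero factors only.\<close>

lemma eigen_vanish:
  assumes f: "f \<in> row_eigen n \<rho>"
    and mono: "\<And>x y. 1 \<le> x \<Longrightarrow> x \<le> y \<Longrightarrow> y \<le> n \<Longrightarrow> \<rho> x \<le> \<rho> y"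
    and xy: "1 \<le> x" "x < y" "y \<le> n"
    and eig: "\<And>i. x \<le> i \<Longrightarrow> i < y \<Longrightarrow> left_op n (simple_refl i) f = (\<lambda>w. - q_inv * f w)"
    and u: "u \<in> Wn n" and row: "\<rho> (inv' u x) = \<rho> (inv' u y)"
  shows "f u = 0"
  using xy(2,3) eig u row
proof (induction "y - x" arbitrary: y u)
  case 0
  then show ?case by simp
next
  case (Suc d)
  note u = Suc.prems(4)
  show ?case
  proof (cases "y = Suc x")
    case True
    have x: "1 \<le> x" "x < n" using xy Suc.prems by auto
    let ?a = "inv' u x" and ?b = "inv' u y"
    have ab: "?a \<in> {1..n}" "?b \<in> {1..n}"
      using Wn_in[OF Wn_inv[OF u]] xy(1) Suc.prems(1,2) by auto
    have uab: "u ?a = x" "u ?b = Suc x" using True by (simp_all add: Wn_inv_apply[OF u])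
    have iff: "u z = x \<longleftrightarrow> z = ?a" "u z = Suc x \<longleftrightarrow> z = ?b" for z
      using Wn_inj[OF u, of z ?a] Wn_inj[OF u, of z ?b] uab by auto
    have eq: "simple_refl x \<circ> u = u \<circ> transpose ?a ?b"
    proof (rule ext)
      fix z
      consider "z = ?a" | "z = ?b" | "z \<noteq> ?a" "z \<noteq> ?b" by blast
      then show "(simple_refl x \<circ> u) z = (u \<circ> transpose ?a ?b) z"
      proof cases
        case 3
        then have "u z \<noteq> x" "u z \<noteq> Suc x" using iff by blast+
        then show ?thesis using 3 by (simp add: simple_refl_apply)
      qed (simp_all add: simple_refl_apply uab)
    qed
    have "left_op n (simple_refl x) f u = - q_inv * f u"
      using Suc.prems(3)[of x] True by simp
    then obtain m where m: "f (simple_refl x \<circ> u) = - (qpow m * f u)"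
      using left_op_eigen[OF u] by blast
    have "?a \<noteq> ?b" using uab by auto
    then consider "?a < ?b" | "?b < ?a" by linarith
    then have "\<exists>l. f (u \<circ> transpose ?a ?b) = qpow l * f u"
    proof cases
      case 1
      then show ?thesis using ab Suc.prems(5) by (intro row_eigen_transpose[OF f mono u]) auto
    next
      case 2
      have "\<exists>l. f (u \<circ> transpose ?b ?a) = qpow l * f u"
        using ab Suc.prems(5) 2 by (intro row_eigen_transpose[OF f mono u]) auto
      then show ?thesis by (simp only: transpose_commute)
    qed
    then obtain l where "f (u \<circ> transpose ?a ?b) = qpow l * f u" by blast
    then have "(qpow l + qpow m) * f u = 0"
      using m eq by (simp add: distrib_right)
    then show ?thesis using qpow_plus_nonzero by simp
  next
    case False
    obtain i where i: "y = Suc i" using Suc.prems(1) by (cases y) auto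
    have xi: "x < i" using False Suc.prems(1) i by simp
    have i': "1 \<le> i" "i < n" using xi xy(1) Suc.prems(2) i by auto
    let ?u = "simple_refl i \<circ> u"
    have uW: "?u \<in> Wn n" by (rule Wn_comp[OF simple_refl_Wn[OF i'] u])
    have "f ?u = 0"
    proof (rule Suc.hyps(1)[OF _ xi _ _ uW])
      show "\<rho> (inv' ?u x) = \<rho> (inv' ?u i)"
        unfolding inv_comp_left[OF u i'] using Suc.prems(5) xi i by (simp add: simple_refl_apply)
    qed (use Suc.hyps(2) Suc.prems i i' in auto)
    moreover have "left_op n (simple_refl i) f u = - q_inv * f u"
      using Suc.prems(3)[of i] xi i by simp
    then obtain m where "f ?u = - (qpow m * f u)"
      using left_op_eigen[OF u] by blast
    moreover have "qpow m \<noteq> 0" by (simp add: qpow_def)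
    ultimately show ?thesis by simp
  qed
qed

text \<open>The pigeonhole count, row by row: \<open>P\<close> has at most one point per block in a
  row, hence at most \<open>k\<close>, and at most all points of the row. By \<open>down\<close>
  rows are left-justified, so a row reaching beyond column \<open>k\<close> has points in all of the
  first \<open>k\<close> columns, and any other row lies within them.\<close>

lemma card_le_by_columns:
  fixes row col blk :: "nat \<Rightarrow> nat"
  assumes Y: "finite Y" and P: "P \<subseteq> Y"
    and down: "\<And>y c. y \<in> Y \<Longrightarrow> 1 \<le> c \<Longrightarrow> c < col y \<Longrightarrow> \<exists>y'\<in>Y. row y' = row y \<and> col y' = c"
    and blk: "\<And>x. x \<in> P \<Longrightarrow> blk x \<in> {1..k}"
    and inj: "\<And>x y. x \<in> P \<Longrightarrow> y \<in> P \<Longrightarrow> row x = row y \<Longrightarrow> blk x = blk y \<Longrightarrow> x = y"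
  shows "card P \<le> card {y \<in> Y. col y \<le> k}"
proof -
  let ?C = "{y \<in> Y. col y \<le> k}"
  have fin: "finite P" "finite ?C" using Y P by (auto intro: finite_subset)
  have sum: "card A = (\<Sum>r\<in>row ` Y. card {x \<in> A. row x = r})" if "A \<subseteq> Y" "finite A" for A
  proof -
    have "card A = (\<Sum>r\<in>row ` Y. \<Sum>x\<in>{x \<in> A. row x = r}. 1)"
      unfolding card_eq_sum by (rule sum.group[symmetric]) (use that Y in auto)
    then show ?thesis by simp
  qed
  have "card {x \<in> P. row x = r} \<le> card {x \<in> ?C. row x = r}" for r
  proof (cases "\<exists>y\<in>Y. row y = r \<and> k < col y")
    case True
    then obtain y where y: "y \<in> Y" "row y = r" "k < col y" by blast
    have "card {x \<in> P. row x = r} \<le> card {1..k}"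
      by (rule card_inj_on_le[where f = blk]) (use inj blk in \<open>auto simp: inj_on_def\<close>)
    also have "\<dots> \<le> card (col ` {x \<in> ?C. row x = r})"
    proof (rule card_mono)
      show "{1..k} \<subseteq> col ` {x \<in> ?C. row x = r}"
      proof
        fix c assume c: "c \<in> {1..k}"
        then obtain y' where "y' \<in> Y" "row y' = r" "col y' = c"
          using down[OF y(1), of c] y by auto
        then show "c \<in> col ` {x \<in> ?C. row x = r}" using c by auto
      qed
    qed (rule finite_imageI, use Y in simp)
    also have "\<dots> \<le> card {x \<in> ?C. row x = r}" by (rule card_image_le) (use Y in simp)
    finally show ?thesis .
  next
    case False
    then show ?thesis using P Y by (intro card_mono) (auto simp: not_less)
  qed
  then show ?thesis
    using sum[OF P fin(1)] sum[of ?C] fin(2) by (simp add: sum_mono)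
qed

text \<open>The place sought is the one where the count of \<open>c'\<close> first reaches the row
  number \<open>cnt c (c y) y\<close>. The lattice condition, chained through the letters from
  \<open>c'\<close> to \<open>c y\<close>, puts it no later than \<open>y\<close>.\<close>

lemma lattice_cell:
  assumes l: "lattice_word n c" and y: "y \<in> {1..n}" and c': "1 \<le> c'" "c' < c y"
  shows "\<exists>y'\<in>{1..y}. c y' = c' \<and> cnt c c' y' = cnt c (c y) y"
proof -
  let ?r = "cnt c (c y) y"
  have "cnt c j y \<le> cnt c c' y" if "c' \<le> j" for j
    using that
  proof (induction j rule: dec_induct)
    case (step j)
    have "cnt c (Suc j) y \<le> cnt c j y" using l y c' step by (simp add: lattice_word_def)
    then show ?case using step by simp
  qed simp
  then have ge: "?r \<le> cnt c c' y" using c' by simp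
  have r: "1 \<le> ?r" using y by (simp add: cnt_pred)
  define z where "z = (LEAST z. ?r \<le> cnt c c' z)"
  have z: "?r \<le> cnt c c' z" "z \<le> y"
    using LeastI[of "\<lambda>z. ?r \<le> cnt c c' z", OF ge] Least_le[of "\<lambda>z. ?r \<le> cnt c c' z", OF ge]
    by (simp_all add: z_def)
  have z1: "1 \<le> z" using z(1) r by (cases z) auto
  have "\<not> ?r \<le> cnt c c' (z - 1)"
    unfolding z_def by (rule not_less_Least) (use z1 in \<open>simp add: z_def[symmetric]\<close>)
  then have "c z = c' \<and> cnt c c' z = ?r"
    using z(1) cnt_pred[OF z1, of c c'] by (auto split: if_splits)
  then show ?thesis using z z1 by auto
qed

text \<open>
  \<open>K k\<close> is the column of \<open>k\<close> in \<open>t\<^sub>\<lambda>\<close>, \<open>\<rho> k\<close> is the row of \<open>k\<close> in \<open>t\<^sup>\<lambda>\<close>, and \<open>Z\<close> gives the coordinates of the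
  generator \<open>y\<^sub>\<lambda> T\<^bsub>v\<inverse>\<^esub> x\<^sub>\<lambda>\<close>.
\<close>

locale specht_data = col_index +
  fixes \<rho> :: "nat \<Rightarrow> nat" and v :: perm and Z :: "perm \<Rightarrow> laurent"
  assumes rho_mono: "1 \<le> x \<Longrightarrow> x \<le> y \<Longrightarrow> y \<le> n \<Longrightarrow> \<rho> x \<le> \<rho> y"
    and v_Wn: "v \<in> Wn n"
    and rho_v: "1 \<le> k \<Longrightarrow> k \<le> n \<Longrightarrow> \<rho> (v k) = cnt K (K k) k"
    and lattice_K: "lattice_word n K"
    and Z_row: "Z \<in> row_eigen n \<rho>"
    and Z_col: "1 \<le> k \<Longrightarrow> k < n \<Longrightarrow> K k = K (Suc k) \<Longrightarrow>
      left_op n (simple_refl k) Z = (\<lambda>w. - q_inv * Z w)"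
    and Z_v: "at_one (Z (inv' v)) \<noteq> 0"
begin

lemma Z_coord_fns: "Z \<in> coord_fns n"
  using Z_row by (simp add: row_eigen_def)

text \<open>
  Pigeonhole: a function that is symmetric along rows and antisymmetric along \<open>k\<close> blocks with more
  places than the first \<open>k\<close> columns vanishes, as two places of some block lie in the same row.
\<close>

lemma eigen_blocks_vanish:
  assumes f: "f \<in> row_eigen n \<rho>" and P: "P \<subseteq> {1..n}"
    and blk: "\<And>x. x \<in> P \<Longrightarrow> blk x \<in> {1..k}"
    and conv: "\<And>x y z. x \<in> P \<Longrightarrow> y \<in> P \<Longrightarrow> blk x = blk y \<Longrightarrow> x \<le> z \<Longrightarrow> z \<le> y \<Longrightarrow> z \<in> P \<and> blk z = blk x"
    and eig: "\<And>i. i \<in> P \<Longrightarrow> Suc i \<in> P \<Longrightarrow> blk i = blk (Suc i) \<Longrightarrow>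
      left_op n (simple_refl i) f = (\<lambda>w. - q_inv * f w)"
    and card: "cnt_le K k n < card P"
  shows "f = (\<lambda>w. 0)"
proof (rule ext)
  fix u
  show "f u = 0"
  proof (cases "u \<in> Wn n")
    case u: True
    \<comment> \<open>The word of the tableau
      \<open>u t\<^sup>\<lambda> = u v t\<^sub>\<lambda>\<close>, in which \<open>x\<close> lies in
      row \<open>\<rho> (inv' u x)\<close> and column \<open>?c x\<close>.\<close>
    let ?c = "K \<circ> inv' (u \<circ> v)"
    have uv: "u \<circ> v \<in> Wn n" by (rule Wn_comp[OF u v_Wn])
    have iuv: "inv' (u \<circ> v) = inv' v \<circ> inv' u" by (rule Wn_comp_inv[OF u v_Wn])
    have cw: "?c \<in> words" unfolding words_def using uv by blast
    have "\<exists>x\<in>P. \<exists>y\<in>P. \<rho> (inv' u x) = \<rho> (inv' u y) \<and> blk x = blk y \<and> x \<noteq> y"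
    proof (rule ccontr)
      assume neg: "\<not> ?thesis"
      have "card P \<le> card {y \<in> {1..n}. ?c y \<le> k}"
      proof (rule card_le_by_columns[where row = "\<lambda>x. \<rho> (inv' u x)" and blk = blk])
        fix y c assume y: "y \<in> {1..n}" and c: "1 \<le> c" "c < ?c y"
        let ?z = "inv' (u \<circ> v) y"
        have z: "?z \<in> {1..n}" using Wn_in[OF Wn_inv[OF uv], of y] y by simp
        have vz: "v ?z = inv' u y" by (simp add: iuv Wn_inv_apply[OF v_Wn])
        have "c < K ?z" using c by simp
        from lattice_cell[OF lattice_K z c(1) this]
        obtain z' where z': "z' \<in> {1..?z}" "K z' = c" "cnt K c z' = cnt K (K ?z) ?z" by blast
        have z'n: "1 \<le> z'" "z' \<le> n" using z' z by auto
        let ?y = "u (v z')"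
        have "?y \<in> {1..n}" using Wn_in[OF u, of "v z'"] Wn_in[OF v_Wn, of z'] z'n by simp
        moreover have "\<rho> (inv' u ?y) = \<rho> (inv' u y)"
          using rho_v[OF z'n] rho_v[of ?z] z z' vz by (simp add: Wn_inv_apply[OF u])
        moreover have "?c ?y = c"
          using z' by (simp add: iuv Wn_inv_apply[OF u] Wn_inv_apply[OF v_Wn])
        ultimately show "\<exists>y'\<in>{1..n}. \<rho> (inv' u y') = \<rho> (inv' u y) \<and> ?c y' = c" by blast
      qed (use P blk neg in auto)
      also have "\<dots> = cnt_le K k n"
        unfolding cnt_le_def by (rule words_card[OF cw])
      finally show False using card by simp
    qed
    then obtain x y where xy: "x \<in> P" "y \<in> P" "\<rho> (inv' u x) = \<rho> (inv' u y)" "blk x = blk y" "x < y"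
      by (metis linorder_neqE_nat)
    show ?thesis
    proof (rule eigen_vanish[OF f rho_mono _ xy(5) _ _ u xy(3)])
      fix i assume i: "x \<le> i" "i < y"
      have "i \<in> P \<and> blk i = blk x" using conv[OF xy(1,2,4), of i] i by simp
      moreover have "Suc i \<in> P \<and> blk (Suc i) = blk x" using conv[OF xy(1,2,4), of "Suc i"] i by simp
      ultimately show "left_op n (simple_refl i) f = (\<lambda>w. - q_inv * f w)" by (intro eig) auto
    qed (use xy P in auto)
  next
    case False
    then show ?thesis using f by (simp add: row_eigen_def coord_fns_def)
  qed
qed

section \<open>Straightening\<close>

definition word_vec :: "(nat \<Rightarrow> nat) \<Rightarrow> perm \<Rightarrow> laurent" where
  "word_vec c = TT n (word_perm c) Z"

lemma word_vec_row: "c \<in> words \<Longrightarrow> word_vec c \<in> row_eigen n \<rho>"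
  unfolding word_vec_def by (rule row_eigen_TT[OF Z_row word_perm_Wn])

lemma word_vec_ascent:
  assumes c: "c \<in> words" and i: "1 \<le> i" "i < n" and asc: "c i < c (Suc i)"
  shows "left_op n (simple_refl i) (word_vec c) = word_vec (c \<circ> simple_refl i)"
proof (rule ext)
  fix w
  show "left_op n (simple_refl i) (word_vec c) w = word_vec (c \<circ> simple_refl i) w"
    unfolding word_vec_def left_op_TT[OF simple_refl_in[OF i] word_perm_Wn[OF c] Z_coord_fns]
    using word_perm_ascent[OF c i asc] word_perm_swap[OF c i] asc by (simp del: comp_apply)
qed

lemma word_vec_descent:
  assumes c: "c \<in> words" and i: "1 \<le> i" "i < n" and desc: "c (Suc i) < c i"
  shows "left_op n (simple_refl i) (word_vec c) w = word_vec (c \<circ> simple_refl i) w + q_diff * word_vec c w"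
  unfolding word_vec_def left_op_TT[OF simple_refl_in[OF i] word_perm_Wn[OF c] Z_coord_fns]
  using word_perm_descent[OF c i desc] word_perm_swap[OF c i] desc by (simp del: comp_apply)

text \<open>Here the reflection passes through the representative and becomes
  \<open>simple_refl k\<close> in the column stabiliser, which acts on the generator by
  \<open>- q_inv\<close>.\<close>

lemma word_vec_equal:
  assumes c: "c \<in> words" and i: "1 \<le> i" "i < n" and eq: "c i = c (Suc i)"
  shows "left_op n (simple_refl i) (word_vec c) = (\<lambda>w. - q_inv * word_vec c w)"
proof (rule ext)
  fix w
  obtain k where k: "1 \<le> k" "k < n" "K k = K (Suc k)"
    "simple_refl i \<circ> word_perm c = word_perm c \<circ> simple_refl k" "len n (word_perm c) < len n (word_perm c \<circ> simple_refl k)"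
    by (rule word_perm_equal[OF c i eq])
  have "left_op n (simple_refl i) (word_vec c) w = TT n (word_perm c \<circ> simple_refl k) Z w"
    unfolding word_vec_def left_op_TT[OF simple_refl_in[OF i] word_perm_Wn[OF c] Z_coord_fns] k(4)
    using k(5) by simp
  also have "\<dots> = TT n (word_perm c) (left_op n (simple_refl k) Z) w"
    unfolding TT_left_op[OF simple_refl_in[OF k(1,2)] word_perm_Wn[OF c] Z_coord_fns] using k(5) by simp
  also have "\<dots> = - q_inv * word_vec c w"
    unfolding Z_col[OF k(1-3)] word_vec_def by (rule TT_smult)
  finally show "left_op n (simple_refl i) (word_vec c) w = - q_inv * word_vec c w" .
qed

text \<open>Such a word has one \<open>j\<close> too many and one \<open>j + 1\<close> too few; by
  \<open>shallow_upd\<close> the repair may be made at any of its letters \<open>j\<close>.\<close>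

definition shallow :: "nat \<Rightarrow> (nat \<Rightarrow> nat) set" where
  "shallow j = {e. \<exists>p\<in>{1..n}. e p = j \<and> e(p := Suc j) \<in> words}"

definition height :: "nat \<Rightarrow> (nat \<Rightarrow> nat) \<Rightarrow> nat \<Rightarrow> int" where
  "height j c m = int (cnt c j m) - int (cnt c (Suc j) m)"

text \<open>A weighted lowering operator on words. The height of the prefix as exponent is what
  makes it compatible with the exchange of places in \<open>lower_ascent\<close> and
  \<open>lower_equal\<close>.\<close>

definition lower :: "nat \<Rightarrow> (nat \<Rightarrow> nat) \<Rightarrow> perm \<Rightarrow> laurent" where
  "lower j e w = (\<Sum>p | p \<in> {1..n} \<and> e p = j. mq (height j e (p - 1)) * word_vec (e(p := Suc j)) w)"

lemma shallow_upd:
  assumes e: "e \<in> shallow j" and p: "p \<in> {1..n}" "e p = j"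
  shows "e(p := Suc j) \<in> words"
proof -
  obtain p0 where p0: "p0 \<in> {1..n}" "e p0 = j" "e(p0 := Suc j) \<in> words"
    using e by (auto simp: shallow_def)
  have "e(p := Suc j) = e(p0 := Suc j) \<circ> transpose p0 p"
    using p p0 by (auto simp: fun_eq_iff transpose_def)
  then show ?thesis using words_transpose[OF p0(3,1) p(1)] by simp
qed

lemma upd_swap: "(e \<circ> simple_refl i)(simple_refl i p := x) = e(p := x) \<circ> simple_refl i"
  by (auto simp: fun_eq_iff simple_refl_apply)

lemma simple_refl_range: "1 \<le> i \<Longrightarrow> i < n \<Longrightarrow> simple_refl i p \<in> {1..n} \<longleftrightarrow> p \<in> {1..n}"
  by (auto simp: simple_refl_apply)

lemma shallow_swap:
  assumes e: "e \<in> shallow j" and i: "1 \<le> i" "i < n"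
  shows "e \<circ> simple_refl i \<in> shallow j"
proof -
  obtain p where p: "p \<in> {1..n}" "e p = j" "e(p := Suc j) \<in> words"
    using e by (auto simp: shallow_def)
  have "(e \<circ> simple_refl i)(simple_refl i p := Suc j) \<in> words"
    unfolding upd_swap by (rule words_swap[OF p(3) i])
  moreover have "simple_refl i p \<in> {1..n}" using p(1) by (simp only: simple_refl_range[OF i])
  ultimately show ?thesis using p(2) unfolding shallow_def by (auto intro!: bexI[of _ "simple_refl i p"])
qed

lemma lower_row: "e \<in> shallow j \<Longrightarrow> lower j e \<in> row_eigen n \<rho>"
  unfolding lower_def[abs_def] by (rule row_eigen_sum, rule word_vec_row, rule shallow_upd) blast+

lemma left_op_lower:
  "left_op n s (lower j e) w
    = (\<Sum>p | p \<in> {1..n} \<and> e p = j. mq (height j e (p - 1)) * left_op n s (word_vec (e(p := Suc j))) w)"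
  unfolding lower_def[abs_def] left_op_linear ..

text \<open>Terms are matched along \<open>simple_refl i\<close>. The only one that does not simply
  move has \<open>j, j + 1\<close> in the places \<open>i, i + 1\<close>: after the change both
  letters are equal and the operator multiplies by \<open>- q_inv\<close>, while the prefix height
  drops by one, which changes the weight by the same factor.\<close>

lemma lower_ascent:
  assumes e: "e \<in> shallow j" and i: "1 \<le> i" "i < n" and asc: "e i < e (Suc i)"
  shows "left_op n (simple_refl i) (lower j e) = lower j (e \<circ> simple_refl i)"
proof (rule ext)
  fix w
  let ?s = "simple_refl i"
  let ?P = "\<lambda>e. {p. p \<in> {1..n} \<and> e p = j}"
  have each: "mq (height j e (p - 1)) * left_op n ?s (word_vec (e(p := Suc j))) w
    = mq (height j (e \<circ> ?s) (?s p - 1)) * word_vec ((e \<circ> ?s)(?s p := Suc j)) w" if p: "p \<in> ?P e" for p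
  proof -
    let ?c = "e(p := Suc j)"
    have c: "?c \<in> words" using shallow_upd[OF e] p by blast
    have hh: "height j (e \<circ> ?s) m = height j e m" if "m \<noteq> i" for m
      using that by (simp add: height_def cnt_swap(1)[OF i(1)])
    consider "p = i" "e (Suc i) = Suc j" | "p = i" "Suc j < e (Suc i)" | "p = Suc i" | "p \<noteq> i" "p \<noteq> Suc i"
      using asc p by fastforce
    then show ?thesis
    proof cases
      case 1
      have "?c \<circ> ?s = ?c" by (rule comp_simple_refl_eq) (use 1 in simp)
      moreover have "left_op n ?s (word_vec ?c) w = - q_inv * word_vec ?c w"
        using word_vec_equal[OF c i] 1 by simp
      moreover have "height j (e \<circ> ?s) i = height j e (i - 1) - 1"
        using 1 by (simp add: height_def cnt_swap(2)[OF i(1)])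
      then have "mq (height j (e \<circ> ?s) i) = - q_inv * mq (height j e (i - 1))"
        by (simp add: mq_pred)
      ultimately show ?thesis
        unfolding upd_swap using 1 by (simp add: simple_refl_apply mult_ac)
    next
      case 2
      have "left_op n ?s (word_vec ?c) = word_vec (?c \<circ> ?s)"
        by (rule word_vec_ascent[OF c i]) (use 2 in simp)
      moreover have "height j (e \<circ> ?s) i = height j e (i - 1)"
        using 2 by (simp add: height_def cnt_swap(2)[OF i(1)])
      ultimately show ?thesis
        unfolding upd_swap using 2 by (simp add: simple_refl_apply)
    next
      case 3
      have "left_op n ?s (word_vec ?c) = word_vec (?c \<circ> ?s)"
        by (rule word_vec_ascent[OF c i]) (use 3 asc p in auto)
      moreover have "height j e i = height j e (i - 1)"
        using 3 asc p by (simp add: height_def cnt_pred[OF i(1)])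
      ultimately show ?thesis
        unfolding upd_swap using 3 hh[of "i - 1"] i by (simp add: simple_refl_apply)
    next
      case 4
      have "left_op n ?s (word_vec ?c) = word_vec (?c \<circ> ?s)"
        by (rule word_vec_ascent[OF c i]) (use 4 asc in auto)
      moreover have "height j (e \<circ> ?s) (p - 1) = height j e (p - 1)"
        by (rule hh) (use 4 p in auto)
      ultimately show ?thesis
        unfolding upd_swap using 4 by (simp add: simple_refl_apply)
    qed
  qed
  have bij: "bij_betw ?s (?P e) (?P (e \<circ> ?s))"
  proof (rule bij_betwI[where g = ?s])
    show "?s \<in> ?P e \<rightarrow> ?P (e \<circ> ?s)" "?s \<in> ?P (e \<circ> ?s) \<rightarrow> ?P e"
      unfolding Pi_def mem_Collect_eq simple_refl_range[OF i] by auto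
  qed simp_all
  show "left_op n ?s (lower j e) w = lower j (e \<circ> ?s) w"
    unfolding left_op_lower lower_def sum.reindex_bij_betw[OF bij, symmetric]
    by (rule sum.cong[OF refl each])
qed

text \<open>Terms changing another place inherit the eigenvalue. If the equal letters are
  \<open>j\<close>, the changes at \<open>i\<close> and \<open>i + 1\<close> have weights in the
  ratio of 1 to \<open>- q\<close>, and this combination of two exchanged words is again an
  eigenvector.\<close>

lemma lower_equal:
  assumes e: "e \<in> shallow j" and i: "1 \<le> i" "i < n" and eq: "e i = e (Suc i)"
  shows "left_op n (simple_refl i) (lower j e) = (\<lambda>w. - q_inv * lower j e w)"
proof (rule ext)
  fix w
  let ?s = "simple_refl i"
  let ?P = "{p. p \<in> {1..n} \<and> e p = j}"
  let ?a = "\<lambda>p. mq (height j e (p - 1))"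
  have other: "?a p * left_op n ?s (word_vec (e(p := Suc j))) w = - q_inv * (?a p * word_vec (e(p := Suc j)) w)"
    if p: "p \<in> ?P" "p \<noteq> i" "p \<noteq> Suc i" for p
  proof -
    have "e(p := Suc j) \<in> words" using shallow_upd[OF e] p by blast
    from word_vec_equal[OF this i] eq p show ?thesis by (simp add: mult_ac)
  qed
  show "left_op n ?s (lower j e) w = - q_inv * lower j e w"
  proof (cases "e i = j")
    case False
    then show ?thesis
      unfolding left_op_lower lower_def sum_distrib_left
      by (intro sum.cong refl other) (use eq in auto)
  next
    case True
    have P: "i \<in> ?P" "Suc i \<in> ?P" using True eq i by auto
    have split: "sum g ?P = sum g (?P - {i, Suc i}) + (g i + g (Suc i))" for g :: "nat \<Rightarrow> laurent"
    proof -
      have "?P = insert i (insert (Suc i) (?P - {i, Suc i}))" using P by blast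
      then have "sum g ?P = sum g (insert i (insert (Suc i) (?P - {i, Suc i})))" by metis
      then show ?thesis by (simp add: ac_simps)
    qed
    let ?c = "e(i := Suc j)" and ?d = "e(Suc i := Suc j)"
    have c: "?c \<in> words" and d: "?d \<in> words" using shallow_upd[OF e] P by blast+
    have cd: "?c \<circ> ?s = ?d" "?d \<circ> ?s = ?c"
      using eq True by (auto simp: fun_eq_iff simple_refl_apply)
    have lc: "left_op n ?s (word_vec ?c) w = word_vec ?d w + q_diff * word_vec ?c w"
      using word_vec_descent[OF c i, of w] eq True unfolding cd by simp
    have ld: "left_op n ?s (word_vec ?d) w = word_vec ?c w"
      using word_vec_ascent[OF d i] eq True unfolding cd by simp
    have h: "height j e i = height j e (i - 1) + 1"
      using True by (simp add: height_def cnt_pred[OF i(1)])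
    have "?a i * left_op n ?s (word_vec ?c) w + ?a (Suc i) * left_op n ?s (word_vec ?d) w
      = - q_inv * (?a i * word_vec ?c w + ?a (Suc i) * word_vec ?d w)"
    proof -
      let ?m = "mq (height j e (i - 1))"
      have "?a (Suc i) = - q * ?m" by (simp add: h mq_Suc)
      moreover have "q_inv * (q * x) = x" for x by (simp add: mult.assoc[symmetric] q_inv_mult_q)
      ultimately show ?thesis
        unfolding lc ld by (simp add: q_diff_def algebra_simps)
    qed
    moreover have "(\<Sum>p\<in>?P - {i, Suc i}. ?a p * left_op n ?s (word_vec (e(p := Suc j))) w)
        = (\<Sum>p\<in>?P - {i, Suc i}. - q_inv * (?a p * word_vec (e(p := Suc j)) w))"
      by (rule sum.cong[OF refl other]) auto
    ultimately show ?thesis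
      unfolding left_op_lower lower_def split distrib_left sum_distrib_left by simp
  qed
qed

text \<open>Sorting by \<open>lower_ascent\<close> reduces to a weakly increasing \<open>e\<close>.
  There each letter up to \<open>j\<close> forms a block of sign type, and together these blocks
  have one place more than the first \<open>j\<close> columns, so the pigeonhole principle
  applies.\<close>

theorem lower_eq_0:
  assumes "1 \<le> j" "e \<in> shallow j"
  shows "lower j e = (\<lambda>w. 0)"
  using assms(2)
proof (induction "ninv n e" arbitrary: e rule: less_induct)
  case less
  note e = less.prems
  show ?case
  proof (cases "\<exists>i. 1 \<le> i \<and> i < n \<and> e (Suc i) < e i")
    case True
    then obtain i where i: "1 \<le> i" "i < n" "e (Suc i) < e i" by blast
    let ?s = "simple_refl i"
    have es: "e \<circ> ?s \<in> shallow j" by (rule shallow_swap[OF e i(1,2)])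
    have "lower j e = lower j (e \<circ> ?s \<circ> ?s)" by (simp add: comp_assoc)
    also have "\<dots> = left_op n ?s (lower j (e \<circ> ?s))"
      by (rule lower_ascent[OF es i(1,2), symmetric]) (use i in \<open>simp add: simple_refl_apply\<close>)
    also have "lower j (e \<circ> ?s) = (\<lambda>w. 0)"
      using less.hyps[OF _ es] ninv_descent[OF i] by simp
    also have "left_op n ?s (\<lambda>w. 0) = (\<lambda>w. 0)" by (simp add: left_op_def fun_eq_iff)
    finally show ?thesis .
  next
    case False
    have mono: "e x \<le> e y" if "1 \<le> x" "x \<le> y" "y \<le> n" for x y
      by (rule no_descent_mono[where lo = 1 and hi = n and c = e]) (use False that in \<open>auto simp: not_less\<close>)
    obtain p where p: "p \<in> {1..n}" "e p = j" "e(p := Suc j) \<in> words"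
      using e by (auto simp: shallow_def)
    have pos: "1 \<le> e x" if "x \<in> {1..n}" for x
      using words_pos[OF p(3), of x] that p(2) assms(1) by (auto split: if_splits)
    show ?thesis
    proof (rule eigen_blocks_vanish[OF lower_row[OF e], where blk = e and k = j])
      have "{x \<in> {1..n}. e x \<le> j} = insert p {x \<in> {1..n}. (e(p := Suc j)) x \<le> j}"
        using p by auto
      then have "card {x \<in> {1..n}. e x \<le> j} = Suc (cnt_le (e(p := Suc j)) j n)"
        by (simp add: cnt_le_def)
      then show "cnt_le K j n < card {x \<in> {1..n}. e x \<le> j}" using words_cnt_le[OF p(3)] by simp
    next
      fix i assume "i \<in> {x \<in> {1..n}. e x \<le> j}" "Suc i \<in> {x \<in> {1..n}. e x \<le> j}" "e i = e (Suc i)"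
      then show "left_op n (simple_refl i) (lower j e) = (\<lambda>w. - q_inv * lower j e w)"
        by (intro lower_equal[OF e]) auto
    next
      fix x y z assume "x \<in> {x \<in> {1..n}. e x \<le> j}" "y \<in> {x \<in> {1..n}. e x \<le> j}" "e x = e y"
        "x \<le> z" "z \<le> y"
      then show "z \<in> {x \<in> {1..n}. e x \<le> j} \<and> e z = e x"
        using mono[of x z] mono[of z y] by auto
    qed (use pos in auto)
  qed
qed

text \<open>
  Antisymmetrising over the arrangements of a set of places of a word makes it an eigenvector for
  the exchanges of places inside the set.
\<close>

lemma left_op_alternating_sum:
  assumes fin: "finite C" and C: "C \<subseteq> words" and i: "1 \<le> i" "i < n"
    and closed: "\<And>c. c \<in> C \<Longrightarrow> c \<circ> simple_refl i \<in> C"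
  shows "left_op n (simple_refl i) (\<lambda>w. \<Sum>c\<in>C. mq (- int (ninv n c)) * word_vec c w)
    = (\<lambda>w. - q_inv * (\<Sum>c\<in>C. mq (- int (ninv n c)) * word_vec c w))"
proof (rule ext)
  fix w
  let ?s = "simple_refl i" and ?a = "\<lambda>c. mq (- int (ninv n c))"
  have ss: "c \<circ> ?s \<circ> ?s = c" for c :: "nat \<Rightarrow> nat" by (simp add: comp_assoc)
  define e where "e c = (if c i = c (Suc i) then - q_inv else if c (Suc i) < c i then q_diff else 0)" for c :: "nat \<Rightarrow> nat"
  define m where "m c = (if c i = c (Suc i) then 0 else (1::laurent))" for c :: "nat \<Rightarrow> nat"
  have left_op: "left_op n ?s (word_vec c) w = m c * word_vec (c \<circ> ?s) w + e c * word_vec c w" if "c \<in> C" for c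
  proof -
    have c: "c \<in> words" using that C by blast
    consider "c i < c (Suc i)" | "c (Suc i) < c i" | "c i = c (Suc i)" by linarith
    then show ?thesis
      by cases (simp_all add: word_vec_ascent[OF c i] word_vec_descent[OF c i] word_vec_equal[OF c i] e_def m_def)
  qed
  have bij: "bij_betw (\<lambda>c. c \<circ> ?s) C C"
    by (rule bij_betwI[where g = "\<lambda>c. c \<circ> ?s"]) (use closed ss in blast)+
  have coef: "?a (c \<circ> ?s) * m (c \<circ> ?s) + ?a c * e c = - q_inv * ?a c" for c
  proof -
    consider "c i < c (Suc i)" | "c (Suc i) < c i" | "c i = c (Suc i)" by linarith
    then show ?thesis
    proof cases
      case 1
      have "- int (ninv n (c \<circ> ?s)) = - int (ninv n c) - 1" using ninv_ascent[OF i 1] by simp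
      then have "?a (c \<circ> ?s) = - q_inv * ?a c" by (simp only: mq_pred)
      then show ?thesis using 1 by (simp add: m_def e_def simple_refl_apply)
    next
      case 2
      have "- int (ninv n (c \<circ> ?s)) = - int (ninv n c) + 1" using ninv_descent[OF i 2] by simp
      then have "?a (c \<circ> ?s) = - q * ?a c" by (simp only: mq_Suc)
      then show ?thesis using 2 by (simp add: m_def e_def simple_refl_apply q_diff_def algebra_simps)
    next
      case 3
      then show ?thesis by (simp add: m_def e_def simple_refl_apply mult.commute)
    qed
  qed
  have "left_op n ?s (\<lambda>w. \<Sum>c\<in>C. ?a c * word_vec c w) w
      = (\<Sum>c\<in>C. ?a c * m c * word_vec (c \<circ> ?s) w) + (\<Sum>c\<in>C. ?a c * e c * word_vec c w)"
    unfolding left_op_linear by (simp add: left_op distrib_left sum.distrib mult.assoc)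
  also have "(\<Sum>c\<in>C. ?a c * m c * word_vec (c \<circ> ?s) w) = (\<Sum>c\<in>C. ?a (c \<circ> ?s) * m (c \<circ> ?s) * word_vec c w)"
    using sum.reindex_bij_betw[OF bij, of "\<lambda>c. ?a (c \<circ> ?s) * m (c \<circ> ?s) * word_vec c w"]
    by (simp only: ss)
  also have "\<dots> + (\<Sum>c\<in>C. ?a c * e c * word_vec c w) = (\<Sum>c\<in>C. - q_inv * ?a c * word_vec c w)"
    unfolding sum.distrib[symmetric] distrib_right[symmetric] coef ..
  also have "\<dots> = - q_inv * (\<Sum>c\<in>C. ?a c * word_vec c w)"
    by (simp add: sum_distrib_left sum_negf mult.assoc)
  finally show "left_op n ?s (\<lambda>w. \<Sum>c\<in>C. ?a c * word_vec c w) w = - q_inv * (\<Sum>c\<in>C. ?a c * word_vec c w)" .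
qed

section \<open>Garnir relations and straightening\<close>

definition below :: "(nat \<Rightarrow> nat) \<Rightarrow> (nat \<Rightarrow> nat) set" where
  "below c = {u \<in> words. dominates n u c \<and> u \<noteq> c}"

definition in_span :: "(nat \<Rightarrow> nat) set \<Rightarrow> (perm \<Rightarrow> laurent) \<Rightarrow> bool" where
  "in_span S f \<longleftrightarrow> (\<exists>a. f = (\<lambda>w. \<Sum>u\<in>S. a u * word_vec u w))"

lemma in_span_trans:
  assumes "in_span S f" "\<And>u. u \<in> S \<Longrightarrow> in_span T (word_vec u)"
  shows "in_span T f"
proof -
  obtain a where a: "f = (\<lambda>w. \<Sum>u\<in>S. a u * word_vec u w)" using assms(1) by (auto simp: in_span_def)
  obtain b where b: "\<And>u. u \<in> S \<Longrightarrow> word_vec u = (\<lambda>w. \<Sum>t\<in>T. b u t * word_vec t w)"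
    using assms(2) unfolding in_span_def by metis
  have "f = (\<lambda>w. \<Sum>t\<in>T. (\<Sum>u\<in>S. a u * b u t) * word_vec t w)"
  proof (rule ext)
    fix w
    have "f w = (\<Sum>u\<in>S. a u * (\<Sum>t\<in>T. b u t * word_vec t w))"
      unfolding a by (intro sum.cong refl arg_cong2[of _ _ _ _ "(*)"] fun_cong[OF b])
    also have "\<dots> = (\<Sum>t\<in>T. (\<Sum>u\<in>S. a u * b u t) * word_vec t w)"
      unfolding sum_distrib_left sum_distrib_right by (subst sum.swap) (simp add: mult.assoc)
    finally show "f w = (\<Sum>t\<in>T. (\<Sum>u\<in>S. a u * b u t) * word_vec t w)" .
  qed
  then show ?thesis unfolding in_span_def by (rule exI[where x = "\<lambda>t. \<Sum>u\<in>S. a u * b u t"])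
qed

lemma sum_indicator:
  fixes g :: "_ \<Rightarrow> laurent"
  assumes "finite S" "u \<in> S"
  shows "(\<Sum>t\<in>S. (if t = u then x else 0) * g t) = x * g u"
proof -
  have "(\<Sum>t\<in>S. (if t = u then x else 0) * g t) = (\<Sum>t\<in>S. if t = u then x * g t else 0)"
    by (rule sum.cong) auto
  then show ?thesis using assms by simp
qed

lemma in_span_word_vec: "u \<in> S \<Longrightarrow> finite S \<Longrightarrow> in_span S (word_vec u)"
  unfolding in_span_def
  by (intro exI[of _ "\<lambda>t. if t = u then 1 else 0"] ext) (simp add: sum_indicator)

lemma finite_below: "finite (below c)"
  by (rule finite_subset[OF _ finite_words]) (auto simp: below_def)

text \<open>
  In this situation \<open>c\<close> is the greatest arrangement of the letters in the places \<open>X\<close>, that is, it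
  belongs to a Garnir tableau.
\<close>

lemma garnir:
  assumes c: "c \<in> words" and nl: "\<not> lattice_word n c"
    and desc_ok: "\<And>i. 1 \<le> i \<Longrightarrow> i < n \<Longrightarrow> c (Suc i) < c i \<Longrightarrow> lattice_word n (c \<circ> simple_refl i)"
  shows "in_span (below c) (word_vec c)"
proof -
  obtain m j where m: "m \<le> n" and j: "1 \<le> j" and v: "cnt c j m < cnt c (Suc j) m"
    using nl by (auto simp: lattice_word_def not_le)
  \<comment> \<open>The first prefix in which \<open>j + 1\<close> outnumbers \<open>j\<close>; it
    ends with a letter \<open>j + 1\<close>, and the excess is one.\<close>
  define p where "p = (LEAST m. cnt c j m < cnt c (Suc j) m)"
  have vp: "cnt c j p < cnt c (Suc j) p"
    unfolding p_def by (rule LeastI[of "\<lambda>m. cnt c j m < cnt c (Suc j) m", OF v])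
  have pm: "p \<le> n" using Least_le[of "\<lambda>m. cnt c j m < cnt c (Suc j) m", OF v] m by (simp add: p_def)
  have p1: "1 \<le> p" using vp by (cases p) auto
  have "\<not> cnt c j (p - 1) < cnt c (Suc j) (p - 1)"
    unfolding p_def by (rule not_less_Least) (use p1 in \<open>simp add: p_def[symmetric]\<close>)
  then have cp: "c p = Suc j" and eqp: "cnt c (Suc j) p = Suc (cnt c j p)"
    using vp cnt_pred[OF p1, of c] by (auto split: if_splits)
  \<comment> \<open>An exchange away from \<open>p\<close> leaves the counts of this prefix
    unchanged, so it cannot produce a lattice word. Hence \<open>c\<close> increases weakly up to
    \<open>p\<close> and again after \<open>p\<close>.\<close>
  have desc: "i = p" if i: "1 \<le> i" "i < n" "c (Suc i) < c i" for i
  proof (rule ccontr)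
    assume "i \<noteq> p"
    then have "cnt (c \<circ> simple_refl i) l p = cnt c l p" for l
      using cnt_swap(1)[OF i(1), of p c l] by simp
    moreover have "cnt (c \<circ> simple_refl i) (Suc j) p \<le> cnt (c \<circ> simple_refl i) j p"
      using desc_ok[OF i] j pm by (simp add: lattice_word_def)
    ultimately show False using vp by simp
  qed
  have mono1: "c x \<le> c y" if "1 \<le> x" "x \<le> y" "y \<le> p" for x y
  proof (rule no_descent_mono[where lo = 1 and hi = p and c = c])
    show "c i \<le> c (Suc i)" if "1 \<le> i" "i < p" for i using desc[of i] that pm by force
  qed (use that in auto)
  have mono2: "c x \<le> c y" if "p < x" "x \<le> y" "y \<le> n" for x y
  proof (rule no_descent_mono[where lo = "Suc p" and hi = n and c = c])
    show "c i \<le> c (Suc i)" if "Suc p \<le> i" "i < n" for i using desc[of i] that by force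
  qed (use that in auto)
  \<comment> \<open>If all letters after \<open>p\<close> exceeded \<open>j\<close>, the excess of
    \<open>j + 1\<close> would persist to the end of the word, against the column lengths of the
    diagram.\<close>
  have none: False if none: "\<And>x. p < x \<Longrightarrow> x \<le> n \<Longrightarrow> j < c x"
  proof -
    have "cnt c j x = cnt c j p" if "p \<le> x" "x \<le> n" for x
      using that
    proof (induction x rule: dec_induct)
      case (step x)
      then show ?case using none[of "Suc x"] by (simp add: cnt_Suc)
    qed simp
    from this[OF pm order_refl] have "cnt c j n = cnt c j p" .
    moreover have "cnt c (Suc j) p \<le> cnt c (Suc j) n" by (rule cnt_mono[OF pm])
    moreover have "cnt c (Suc j) n \<le> cnt c j n"
      using lattice_K j by (simp add: words_cnt[OF c] lattice_word_def)
    ultimately show False using vp by simp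
  qed
  have pn1: "p < n"
  proof (rule ccontr)
    assume "\<not> p < n"
    then show False by (intro none) simp
  qed
  have pn2: "c (Suc p) < c p"
  proof (rule ccontr)
    assume np: "\<not> c (Suc p) < c p"
    show False
    proof (rule none)
      fix x assume "p < x" "x \<le> n"
      then have "c (Suc p) \<le> c x" by (intro mono2) auto
      then show "j < c x" using np cp by simp
    qed
  qed
  note pn = pn1 pn2
  have cSp: "c (Suc p) = j"
  proof -
    have "cnt (c \<circ> simple_refl p) (Suc j) (Suc p) \<le> cnt (c \<circ> simple_refl p) j (Suc p)"
      using desc_ok[OF p1 pn] j pn by (simp add: lattice_word_def)
    then have "cnt c (Suc j) (Suc p) \<le> cnt c j (Suc p)" by (simp add: cnt_swap(1)[OF p1])
    then show ?thesis using eqp by (auto simp: cnt_Suc split: if_splits)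
  qed
  have after: "j \<le> c x" if "p < x" "x \<le> n" for x
    using mono2[of "Suc p" x] cSp that by simp
  \<comment> \<open>The Garnir places. Because \<open>c\<close> increases weakly on both sides of
    \<open>p\<close>, they form one interval around \<open>p\<close>; it serves as the last block,
    after those of the letters below \<open>j\<close>.\<close>
  define X where "X = {x \<in> {1..n}. (x \<le> p \<and> c x = Suc j) \<or> (p < x \<and> c x = j)}"
  define P where "P = {x \<in> {1..n}. c x < j} \<union> X"
  define blk where "blk x = (if c x < j then c x else j)" for x
  define C where "C = {c \<circ> \<pi> | \<pi>. \<pi> permutes X}"
  have XP: "x \<in> X \<longleftrightarrow> x \<in> P \<and> j \<le> c x" for x
    by (auto simp: X_def P_def)
  have finX: "finite X" by (simp add: X_def)
  have finC: "finite C"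
    unfolding C_def using finite_permutations[OF finX] by (simp add: finite_image_set)
  have CW: "C \<subseteq> words"
  proof
    fix c' assume "c' \<in> C"
    then obtain \<pi> where "\<pi> permutes X" "c' = c \<circ> \<pi>" by (auto simp: C_def)
    moreover have "\<pi> permutes {1..n}"
      by (rule permutes_subset[OF \<open>\<pi> permutes X\<close>]) (auto simp: X_def)
    ultimately show "c' \<in> words" using words_comp[OF c, of \<pi>] by (simp add: Wn_iff)
  qed
  have conv: "z \<in> P \<and> blk z = blk x" if xy: "x \<in> P" "y \<in> P" "blk x = blk y" "x \<le> z" "z \<le> y" for x y z
  proof (cases "c x < j")
    case True
    then have e: "c y = c x" using xy(3) by (auto simp: blk_def split: if_splits)
    have "y \<le> p" using after[of y] True e xy(2) by (force simp: P_def X_def)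
    then have "c z = c x" using mono1[of x z] mono1[of z y] e xy by (auto simp: P_def X_def)
    then show ?thesis using True xy by (auto simp: P_def X_def blk_def)
  next
    case False
    then have X: "x \<in> X" "y \<in> X" using xy XP by (auto simp: blk_def split: if_splits)
    have "z \<in> X"
    proof (cases "z \<le> p")
      case True
      then have "c x = Suc j" "1 \<le> x" using X xy by (auto simp: X_def)
      then have "c z = Suc j" using mono1[of x z] mono1[of z p] cp True xy by simp
      then show ?thesis using X xy True by (auto simp: X_def)
    next
      case False
      then have "c y = j" "y \<le> n" using X xy by (auto simp: X_def)
      then have "c z = j" using mono2[of z y] after[of z] False xy by simp
      then show ?thesis using X xy False by (auto simp: X_def)
    qed
    then show ?thesis using XP False by (auto simp: blk_def)
  qed
  let ?G = "\<lambda>w. \<Sum>c'\<in>C. mq (- int (ninv n c')) * word_vec c' w"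
  have "?G = (\<lambda>w. 0)"
  proof (rule eigen_blocks_vanish[where P = P and blk = blk and k = j])
    show "?G \<in> row_eigen n \<rho>" by (rule row_eigen_sum, rule word_vec_row) (use CW in blast)
    show "P \<subseteq> {1..n}" by (auto simp: P_def X_def)
    show "blk x \<in> {1..j}" if "x \<in> P" for x
      using that j words_pos[OF c, of x] by (auto simp: P_def X_def blk_def)
    show "left_op n (simple_refl i) ?G = (\<lambda>w. - q_inv * ?G w)"
      if iP: "i \<in> P" "Suc i \<in> P" "blk i = blk (Suc i)" for i
    proof (rule left_op_alternating_sum[OF finC CW])
      show "1 \<le> i" "i < n" using iP by (auto simp: P_def X_def)
      fix c' assume "c' \<in> C"
      then obtain \<pi> where \<pi>: "\<pi> permutes X" "c' = c \<circ> \<pi>" by (auto simp: C_def)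
      show "c' \<circ> simple_refl i \<in> C"
      proof (cases "c i < j")
        case True
        then have "c i = c (Suc i)" "i \<notin> X" "Suc i \<notin> X"
          using iP XP by (auto simp: blk_def split: if_splits)
        then have "c' i = c' (Suc i)" using \<pi> by (simp add: permutes_not_in)
        then show ?thesis using comp_simple_refl_eq[of c' i] \<open>c' \<in> C\<close> by simp
      next
        case False
        then have "i \<in> X" "Suc i \<in> X" using iP XP by (auto simp: blk_def split: if_splits)
        then have "(\<pi> \<circ> simple_refl i) permutes X"
          unfolding simple_refl_def by (intro permutes_compose \<pi>(1) permutes_swap_id)
        then show ?thesis unfolding C_def \<pi>(2) comp_assoc by blast
      qed
    qed
    \<comment> \<open>\<open>P\<close> arises from the places with letters up to \<open>j\<close> by
      trading the letters \<open>j\<close> up to \<open>p\<close> for the letters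
      \<open>j + 1\<close> there, of which there is one more.\<close>
    show "cnt_le K j n < card P"
    proof -
      let ?L = "{x \<in> {1..n}. c x \<le> j}"
      have "P = (?L - {x \<in> {1..p}. c x = j}) \<union> {x \<in> {1..p}. c x = Suc j}"
        using pm after by (force simp: P_def X_def)
      moreover have "card ((?L - {x \<in> {1..p}. c x = j}) \<union> {x \<in> {1..p}. c x = Suc j})
          = card (?L - {x \<in> {1..p}. c x = j}) + cnt c (Suc j) p"
        unfolding cnt_def by (rule card_Un_disjoint) auto
      moreover have "card (?L - {x \<in> {1..p}. c x = j}) = card ?L - cnt c j p"
        unfolding cnt_def by (rule card_Diff_subset) (use pm in auto)
      moreover have "cnt c j p \<le> card ?L"
        unfolding cnt_def by (rule card_mono) (use pm in auto)
      moreover have "card ?L = cnt_le K j n" using words_cnt_le[OF c] by (simp add: cnt_le_def)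
      ultimately show ?thesis using eqp by simp
    qed
  qed (rule conv)
  have cC: "c \<in> C" unfolding C_def using permutes_id[of X] by (intro CollectI exI[of _ id]) simp
  have sub: "c' \<in> below c" if c'C: "c' \<in> C - {c}" for c'
  proof -
    obtain \<pi> where \<pi>: "\<pi> permutes X" "c' = c \<circ> \<pi>" using c'C unfolding C_def by blast
    have c'W: "c' \<in> words" using CW c'C by blast
    have val: "c' x = c x \<or> x \<in> X \<and> c x \<in> {j, Suc j} \<and> c' x \<in> {j, Suc j}" for x
    proof (cases "x \<in> X")
      case True
      then have "\<pi> x \<in> X" using permutes_in_image[OF \<pi>(1)] by simp
      then show ?thesis using True \<pi>(2) by (auto simp: X_def)
    qed (use \<pi> in \<open>simp add: permutes_not_in\<close>)
    \<comment> \<open>Only the counts for \<open>j\<close> can change. In \<open>c\<close> the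
      letters \<open>j\<close> of \<open>X\<close> all stand after \<open>p\<close>, so a
      rearrangement can only move them to the left.\<close>
    have "cnt_le c k m \<le> cnt_le c' k m" if m: "m \<le> n" for k m
    proof (cases "k = j")
      case False
      then have "(c x \<le> k) = (c' x \<le> k)" for x using val[of x] by auto
      then show ?thesis by (simp add: cnt_le_def)
    next
      case True
      show ?thesis
      proof (cases "m \<le> p")
        case mp: True
        have "{x \<in> {1..m}. c x \<le> k} \<subseteq> {x \<in> {1..m}. c' x \<le> k}"
        proof
          fix x assume x: "x \<in> {x \<in> {1..m}. c x \<le> k}"
          then have "x \<notin> X" using mp True by (auto simp: X_def)
          then show "x \<in> {x \<in> {1..m}. c' x \<le> k}" using x val[of x] by auto
        qed
        then show ?thesis unfolding cnt_le_def by (intro card_mono) auto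
      next
        case mp: False
        have split: "cnt_le d k n = cnt_le d k m + card {x \<in> {Suc m..n}. d x \<le> k}" for d
        proof -
          have "{x \<in> {1..n}. d x \<le> k} = {x \<in> {1..m}. d x \<le> k} \<union> {x \<in> {Suc m..n}. d x \<le> k}"
            using m by auto
          then show ?thesis unfolding cnt_le_def by (simp only:) (rule card_Un_disjoint, auto)
        qed
        have "{x \<in> {Suc m..n}. c' x \<le> k} \<subseteq> {x \<in> {Suc m..n}. c x \<le> k}"
        proof
          fix x assume x: "x \<in> {x \<in> {Suc m..n}. c' x \<le> k}"
          then have "x \<in> X \<Longrightarrow> c x = j" using mp by (auto simp: X_def)
          then show "x \<in> {x \<in> {Suc m..n}. c x \<le> k}" using x val[of x] True by auto
        qed
        then have "card {x \<in> {Suc m..n}. c' x \<le> k} \<le> card {x \<in> {Suc m..n}. c x \<le> k}"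
          by (intro card_mono) auto
        then show ?thesis
          using split[of c] split[of c'] words_cnt_le[OF c, of k] words_cnt_le[OF c'W, of k] by linarith
      qed
    qed
    then show ?thesis using c'W c'C by (simp add: below_def dominates_def)
  qed
  let ?S = "\<lambda>w. \<Sum>c'\<in>C - {c}. mq (- int (ninv n c')) * word_vec c' w"
  \<comment> \<open>The weight of \<open>c\<close> is an invertible monomial, so the relation can be
    solved for its vector.\<close>
  have BWc: "word_vec c w = (\<Sum>c'\<in>C - {c}. - (mq (int (ninv n c)) * mq (- int (ninv n c'))) * word_vec c' w)" for w
  proof -
    have "mq (- int (ninv n c)) * word_vec c w + ?S w = 0"
      using fun_cong[OF \<open>?G = (\<lambda>w. 0)\<close>, of w]
      unfolding sum.remove[OF finC cC, of "\<lambda>c'. mq (- int (ninv n c')) * word_vec c' w"] .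
    then have "mq (- int (ninv n c)) * word_vec c w = - ?S w"
      by (simp only: eq_neg_iff_add_eq_0)
    then have "mq (int (ninv n c)) * (mq (- int (ninv n c)) * word_vec c w) = mq (int (ninv n c)) * - ?S w"
      by (simp only:)
    then show ?thesis
      unfolding mult.assoc[symmetric] mq_inverse mult_1 sum_negf[symmetric] sum_distrib_left
      by (simp add: mult.assoc)
  qed
  then have "in_span (C - {c}) (word_vec c)"
    unfolding in_span_def
    by (intro exI[of _ "\<lambda>c'. - (mq (int (ninv n c)) * mq (- int (ninv n c')))"] ext)
  then show ?thesis by (rule in_span_trans) (rule in_span_word_vec[OF sub finite_below])
qed

text \<open>If some descent leads to a word that is still not a lattice word, the operator of the
  reflection applied to its expansion straightens \<open>c\<close>, and dominance survives by
  \<open>dom_swap\<close>. Otherwise every descent leads to a lattice word, which is the Garnir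
  situation.\<close>

lemma straighten_below:
  assumes "c \<in> words" "\<not> lattice_word n c"
  shows "in_span (below c) (word_vec c)"
  using assms
proof (induction "ninv n c" arbitrary: c rule: less_induct)
  case less
  note c = less.prems(1)
  show ?case
  proof (cases "\<exists>i. 1 \<le> i \<and> i < n \<and> c (Suc i) < c i \<and> \<not> lattice_word n (c \<circ> simple_refl i)")
    case True
    then obtain i where i: "1 \<le> i" "i < n" "c (Suc i) < c i" "\<not> lattice_word n (c \<circ> simple_refl i)" by blast
    let ?s = "simple_refl i" and ?d = "c \<circ> simple_refl i"
    have d: "?d \<in> words" by (rule words_swap[OF c i(1,2)])
    have asc: "?d i < ?d (Suc i)" using i(3) by (simp add: simple_refl_apply)
    have dc: "?d \<circ> ?s = c" by (simp add: comp_assoc)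
    obtain a where a: "word_vec ?d = (\<lambda>w. \<Sum>u\<in>below ?d. a u * word_vec u w)"
      using less.hyps[OF _ d i(4)] ninv_descent[OF i(1-3)] by (auto simp: in_span_def)
    have "word_vec c = (\<lambda>w. \<Sum>u\<in>below ?d. a u * left_op n ?s (word_vec u) w)"
      using word_vec_ascent[OF d i(1,2) asc] unfolding dc a left_op_linear by simp
    moreover have "in_span (below c) (left_op n ?s (word_vec u))" if u: "u \<in> below ?d" for u
    proof -
      have uw: "u \<in> words" and ud: "dominates n u ?d" "u \<noteq> ?d" using u by (auto simp: below_def)
      have dom: "dominates n u c" "dominates n (u \<circ> ?s) c"
        using dom_swap[OF ud(1) i(1,2) asc] unfolding dc by auto
      have "u \<noteq> c"
      proof
        assume "u = c"
        then have "dominates n ?d u"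
          using dom_swap(2)[OF dom_refl[of n ?d] i(1,2) asc] unfolding dc by metis
        then show False using dom_antisym[OF uw d ud(1)] ud(2) by simp
      qed
      moreover have "u \<circ> ?s \<noteq> c"
      proof
        assume "u \<circ> ?s = c"
        then have "u \<circ> ?s \<circ> ?s = ?d" by simp
        then show False using ud(2) by (simp add: comp_assoc)
      qed
      ultimately have in_below: "u \<in> below c" "u \<circ> ?s \<in> below c"
        using dom uw words_swap[OF uw i(1,2)] by (auto simp: below_def)
      consider "u i < u (Suc i)" | "u (Suc i) < u i" | "u i = u (Suc i)" by linarith
      then have "\<exists>x y. left_op n ?s (word_vec u) = (\<lambda>w. x * word_vec (u \<circ> ?s) w + y * word_vec u w)"
      proof cases
        case 1
        show ?thesis unfolding word_vec_ascent[OF uw i(1,2) 1] by (intro exI[of _ 1] exI[of _ 0]) simp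
      next
        case 2
        show ?thesis by (intro exI[of _ 1] exI[of _ q_diff] ext) (simp add: word_vec_descent[OF uw i(1,2) 2])
      next
        case 3
        show ?thesis unfolding word_vec_equal[OF uw i(1,2) 3] by (intro exI[of _ 0] exI[of _ "- q_inv"]) simp
      qed
      then obtain x y where xy: "left_op n ?s (word_vec u) = (\<lambda>w. x * word_vec (u \<circ> ?s) w + y * word_vec u w)" by blast
      have "in_span (below c) (\<lambda>w. x * word_vec (u \<circ> ?s) w + y * word_vec u w)"
        unfolding in_span_def
        by (intro exI[of _ "\<lambda>t. (if t = u \<circ> ?s then x else 0) + (if t = u then y else 0)"] ext)
          (simp only: distrib_right sum.distrib sum_indicator[OF finite_below] in_below)
      then show ?thesis unfolding xy .
    qed
    then obtain b where b: "\<And>u. u \<in> below ?d \<Longrightarrow> left_op n ?s (word_vec u) = (\<lambda>w. \<Sum>t\<in>below c. b u t * word_vec t w)"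
      unfolding in_span_def by metis
    ultimately have "word_vec c w = (\<Sum>t\<in>below c. (\<Sum>u\<in>below ?d. a u * b u t) * word_vec t w)" for w
      unfolding sum_distrib_right by (subst sum.swap) (simp add: b sum_distrib_left mult.assoc)
    then show ?thesis
      unfolding in_span_def by (intro exI[of _ "\<lambda>t. \<Sum>u\<in>below ?d. a u * b u t"] ext)
  next
    case False
    then show ?thesis by (intro garnir less.prems) blast+
  qed
qed

end

lemma bruhat_le_len:
  assumes "bruhat_le n u w"
  shows "u = w \<or> len n u < len n w"
  using assms unfolding bruhat_le_def
  by (induction rule: rtranclp_induct) (auto simp: bruhat_step_def)

lemma cnt_upd_less: "m < p \<Longrightarrow> cnt (c(p := x)) l m = cnt c l m"
  by (rule cnt_cong) auto

lemma cnt_upd_ge: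
  assumes "1 \<le> p" "p \<le> m"
  shows "cnt (c(p := x)) l m + (if c p = l then 1 else 0) = cnt c l m + (if x = l then 1 else 0)"
  using assms(2)
proof (induction m rule: dec_induct)
  case base
  show ?case
    using cnt_pred[OF assms(1), of "c(p := x)" l] cnt_pred[OF assms(1), of c l] cnt_upd_less[of "p - 1" p c x l]
      assms(1) by (simp del: fun_upd_apply add: fun_upd_same)
next
  case (step m)
  then have "(c(p := x)) (Suc m) = c (Suc m)" by simp
  then show ?case
    using step.IH cnt_Suc[of "c(p := x)" l m] cnt_Suc[of c l m] by (simp del: fun_upd_apply)
qed

context specht_data
begin

section \<open>Standard words form a basis\<close>

definition std_words :: "(nat \<Rightarrow> nat) set" where
  "std_words = {u \<in> words. lattice_word n u}"

lemma finite_std_words: "finite std_words"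
  by (rule finite_subset[OF _ finite_words]) (auto simp: std_words_def)

lemma std_words_words: "u \<in> std_words \<Longrightarrow> u \<in> words"
  by (simp add: std_words_def)

lemma dominates_len:
  assumes "u \<in> words" "c \<in> words" "dominates n u c" "u \<noteq> c"
  shows "len n (word_perm u) < len n (word_perm c)"
proof -
  have "word_perm u \<noteq> word_perm c" using word_perm(2)[OF assms(1)] word_perm(2)[OF assms(2)] assms(4) by metis
  then show ?thesis using bruhat_le_len[OF bruhat_le_if_dom[OF assms(1-3)]] by simp
qed

text \<open>Iterating \<open>straighten_below\<close> terminates because the words strictly below
  \<open>c\<close> have shorter representatives.\<close>

lemma straighten:
  "c \<in> words \<Longrightarrow> \<exists>a. (\<forall>u. a u \<noteq> 0 \<longrightarrow> u \<in> std_words \<and> dominates n u c) \<and> (\<forall>w. word_vec c w = (\<Sum>u\<in>std_words. a u * word_vec u w))"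
proof (induction "len n (word_perm c)" arbitrary: c rule: less_induct)
  case less
  show ?case
  proof (cases "lattice_word n c")
    case True
    then have "c \<in> std_words" using less.prems by (simp add: std_words_def)
    then show ?thesis
      by (intro exI[of _ "\<lambda>u. if u = c then 1 else 0"]) (simp add: sum_indicator finite_std_words dom_refl)
  next
    case False
    obtain b where b: "word_vec c = (\<lambda>w. \<Sum>u\<in>below c. b u * word_vec u w)"
      using straighten_below[OF less.prems False] by (auto simp: in_span_def)
    have "\<forall>u\<in>below c. \<exists>a. (\<forall>t. a t \<noteq> 0 \<longrightarrow> t \<in> std_words \<and> dominates n t u)
        \<and> (\<forall>w. word_vec u w = (\<Sum>t\<in>std_words. a t * word_vec t w))"
    proof
      fix u assume "u \<in> below c"
      then have u: "u \<in> words" "dominates n u c" "u \<noteq> c" by (auto simp: below_def)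
      show "\<exists>a. (\<forall>t. a t \<noteq> 0 \<longrightarrow> t \<in> std_words \<and> dominates n t u)
        \<and> (\<forall>w. word_vec u w = (\<Sum>t\<in>std_words. a t * word_vec t w))"
        by (rule less.hyps[OF dominates_len[OF u(1) less.prems u(2,3)] u(1)])
    qed
    from bchoice[OF this] obtain A where A': "\<forall>u\<in>below c. (\<forall>t. A u t \<noteq> 0 \<longrightarrow> t \<in> std_words \<and> dominates n t u)
        \<and> (\<forall>w. word_vec u w = (\<Sum>t\<in>std_words. A u t * word_vec t w))" ..
    have A: "A u t \<noteq> 0 \<Longrightarrow> t \<in> std_words \<and> dominates n t u"
      "word_vec u w = (\<Sum>t\<in>std_words. A u t * word_vec t w)" if "u \<in> below c" for u t w
      using bspec[OF A' that] by simp_all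
    let ?a = "\<lambda>t. \<Sum>u\<in>below c. b u * A u t"
    have "t \<in> std_words \<and> dominates n t c" if nz: "?a t \<noteq> 0" for t
    proof -
      obtain u where u: "u \<in> below c" "b u * A u t \<noteq> 0"
        by (rule sum.not_neutral_contains_not_neutral[OF nz])
      then have "A u t \<noteq> 0" by auto
      from A(1)[OF u(1) this] show ?thesis
        using u(1) dom_trans[of n t u c] by (auto simp: below_def)
    qed
    moreover have "word_vec c w = (\<Sum>t\<in>std_words. ?a t * word_vec t w)" for w
    proof -
      have "word_vec c w = (\<Sum>u\<in>below c. \<Sum>t\<in>std_words. b u * A u t * word_vec t w)"
        unfolding b by (rule sum.cong[OF refl]) (simp add: A(2) sum_distrib_left mult.assoc)
      also have "\<dots> = (\<Sum>t\<in>std_words. ?a t * word_vec t w)"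
        by (subst sum.swap) (simp add: sum_distrib_right)
      finally show ?thesis .
    qed
    ultimately show ?thesis by (intro exI[of _ ?a] conjI allI) (rule impI)
  qed
qed

text \<open>The choice is determined: on \<open>std_words\<close> by \<open>coeff_unique\<close>,
  and outside by the value zero.\<close>

definition coeff :: "(nat \<Rightarrow> nat) \<Rightarrow> (nat \<Rightarrow> nat) \<Rightarrow> laurent" where
  "coeff c = (SOME a. (\<forall>u. a u \<noteq> 0 \<longrightarrow> u \<in> std_words \<and> dominates n u c)
     \<and> (\<forall>w. word_vec c w = (\<Sum>u\<in>std_words. a u * word_vec u w)))"

lemma coeff:
  assumes "c \<in> words"
  shows coeff_dominates: "coeff c u \<noteq> 0 \<Longrightarrow> dominates n u c"
    and word_vec_coeff: "word_vec c w = (\<Sum>u\<in>std_words. coeff c u * word_vec u w)"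
proof -
  note a = someI_ex[OF straighten[OF assms], folded coeff_def]
  show "coeff c u \<noteq> 0 \<Longrightarrow> dominates n u c" using conjunct1[OF a] by simp
  show "word_vec c w = (\<Sum>u\<in>std_words. coeff c u * word_vec u w)" by (rule spec[OF conjunct2[OF a]])
qed

section \<open>Linear independence of the standard vectors\<close>

lemma at_one_word_vec:
  assumes u: "u \<in> words" and w: "w \<in> Wn n"
  shows "at_one (word_vec u w) = at_one (Z (inv' (word_perm u) \<circ> w))"
  unfolding word_vec_def by (rule at_one_TT[OF word_perm_Wn[OF u] w])

text \<open>The value comes from one of \<open>Z\<close>, which vanishes by
  \<open>eigen_vanish\<close> as soon as two places with the same letter in \<open>u\<close> lie in
  one row of the tableau of \<open>t\<close>. So the letters of \<open>u\<close> are distinct along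
  each row, and counting row by row among the entries up to \<open>m\<close> gives
  dominance.\<close>

lemma at_one_word_vec_nonzero:
  assumes u: "u \<in> words" and t: "t \<in> std_words" and nz: "at_one (word_vec u (word_perm t \<circ> inv' v)) \<noteq> 0"
  shows "dominates n t u"
  unfolding dominates_def
proof (intro allI impI)
  fix m k assume m: "m \<le> n"
  have tw: "t \<in> words" and tl: "lattice_word n t" using t by (auto simp: std_words_def)
  let ?d = "word_perm u" and ?e = "word_perm t"
  have dW: "?d \<in> Wn n" and eW: "?e \<in> Wn n" using word_perm_Wn u tw by auto
  let ?g = "inv' ?d \<circ> (?e \<circ> inv' v)"
  have evW: "?e \<circ> inv' v \<in> Wn n" by (rule Wn_comp[OF eW Wn_inv[OF v_Wn]])
  have gW: "?g \<in> Wn n" by (rule Wn_comp[OF Wn_inv[OF dW] evW])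
  have ig: "inv' ?g x = v (inv' ?e (?d x))" for x
    unfolding Wn_comp_inv[OF Wn_inv[OF dW] evW] Wn_comp_inv[OF eW Wn_inv[OF v_Wn]]
      Wn_inv_inv[OF dW] Wn_inv_inv[OF v_Wn] by simp
  have Zg: "Z ?g \<noteq> 0" using nz at_one_word_vec[OF u evW] by auto
  have inj: "x = y" if xy: "x \<in> {1..n}" "y \<in> {1..n}" "K x = K y" "\<rho> (inv' ?g x) = \<rho> (inv' ?g y)" for x y
  proof (rule ccontr)
    have *: False if xy: "1 \<le> x" "x < y" "y \<le> n" "K x = K y" "\<rho> (inv' ?g x) = \<rho> (inv' ?g y)" for x y
    proof -
      have "Z ?g = 0"
      proof (rule eigen_vanish[OF Z_row rho_mono xy(1-3) _ gW xy(5)])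
        fix i assume i: "x \<le> i" "i < y"
        have "K x \<le> K i" "K i \<le> K (Suc i)" "K (Suc i) \<le> K y"
          by (rule K_mono; use xy i in simp)+
        then show "left_op n (simple_refl i) Z = (\<lambda>w. - q_inv * Z w)"
          using xy i by (intro Z_col) auto
      qed
      then show False using Zg by simp
    qed
    assume "x \<noteq> y"
    then show False using *[of x y] *[of y x] xy by (auto simp: neq_iff)
  qed
  have row: "\<rho> (v (inv' ?e y)) = cnt t (t y) y" if "y \<in> {1..n}" for y
    using rho_v[of "inv' ?e y"] cnt_word_perm[OF tw that] Wn_in[OF Wn_inv[OF eW], of y] that by simp
  have "card {y \<in> {1..m}. u y \<le> k} \<le> card {y \<in> {1..m}. t y \<le> k}"
  proof (rule card_le_by_columns[where row = "\<lambda>y. cnt t (t y) y" and blk = u])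
    fix y c assume y: "y \<in> {1..m}" and c: "1 \<le> c" "c < t y"
    then have "y \<in> {1..n}" using m by auto
    from lattice_cell[OF tl this c]
    obtain y' where "y' \<in> {1..y}" "t y' = c" "cnt t c y' = cnt t (t y) y" by blast
    then show "\<exists>y'\<in>{1..m}. cnt t (t y') y' = cnt t (t y) y \<and> t y' = c" using y by auto
  next
    fix x y assume x: "x \<in> {y \<in> {1..m}. u y \<le> k}" and y: "y \<in> {y \<in> {1..m}. u y \<le> k}"
      and r: "cnt t (t x) x = cnt t (t y) y" and uxy: "u x = u y"
    have xn: "x \<in> {1..n}" and yn: "y \<in> {1..n}" using x y m by auto
    have "inv' ?d x = inv' ?d y"
    proof (rule inj)
      show "inv' ?d x \<in> {1..n}" "inv' ?d y \<in> {1..n}"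
        using Wn_in[OF Wn_inv[OF dW]] xn yn by simp_all
      show "K (inv' ?d x) = K (inv' ?d y)" using uxy by (simp add: word_perm_apply[OF u])
      show "\<rho> (inv' ?g (inv' ?d x)) = \<rho> (inv' ?g (inv' ?d y))"
        unfolding ig Wn_inv_apply[OF dW] row[OF xn] row[OF yn] by (rule r)
    qed
    then show "x = y" by (simp only: Wn_inj[OF Wn_inv[OF dW]])
  qed (use words_pos[OF u] m in auto)
  then show "cnt_le u k m \<le> cnt_le t k m" by (simp add: cnt_le_def)
qed

lemma at_one_word_vec_diag:
  assumes "t \<in> words"
  shows "at_one (word_vec t (word_perm t \<circ> inv' v)) \<noteq> 0"
proof -
  have W: "word_perm t \<circ> inv' v \<in> Wn n" by (rule Wn_comp[OF word_perm_Wn[OF assms] Wn_inv[OF v_Wn]])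
  have "inv' (word_perm t) \<circ> (word_perm t \<circ> inv' v) = inv' v"
    unfolding comp_assoc[symmetric] Wn_inv_comp(2)[OF word_perm_Wn[OF assms]] by (rule id_o)
  then show ?thesis using at_one_word_vec[OF assms W] Z_v by simp
qed

text \<open>Evaluation at \<open>word_perm t \<circ> inv' v\<close>, for \<open>t\<close> with the
  longest representative in the support, isolates \<open>t\<close>: any other contributing word
  would lie strictly above \<open>t\<close> and have a longer representative.\<close>

lemma independent_at_one:
  assumes z: "\<And>w. w \<in> Wn n \<Longrightarrow> (\<Sum>u\<in>std_words. z u * at_one (word_vec u w)) = 0" and u: "u \<in> std_words"
  shows "z u = 0"
proof (rule ccontr)
  assume "z u \<noteq> 0"
  let ?S = "{u \<in> std_words. z u \<noteq> 0}"
  have S: "finite ?S" "?S \<noteq> {}" using finite_std_words u \<open>z u \<noteq> 0\<close> by auto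
  obtain t where t: "t \<in> ?S" "\<And>x. x \<in> ?S \<Longrightarrow> len n (word_perm x) \<le> len n (word_perm t)"
    by (rule obtains_MAX[OF S, of "\<lambda>x. len n (word_perm x)"]) (metis (no_types, lifting) Max_ge S(1) finite_imageI imageI)
  have tw: "t \<in> words" using t by (simp add: std_words_def)
  have W: "word_perm t \<circ> inv' v \<in> Wn n" by (rule Wn_comp[OF word_perm_Wn[OF tw] Wn_inv[OF v_Wn]])
  have "z x * at_one (word_vec x (word_perm t \<circ> inv' v)) = 0" if x: "x \<in> std_words - {t}" for x
  proof (rule ccontr)
    assume nz: "z x * at_one (word_vec x (word_perm t \<circ> inv' v)) \<noteq> 0"
    have xw: "x \<in> words" using x by (simp add: std_words_def)
    have "dominates n t x" by (rule at_one_word_vec_nonzero[OF xw]) (use t nz in auto)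
    then have "len n (word_perm t) < len n (word_perm x)" using x by (intro dominates_len tw xw) auto
    moreover have "len n (word_perm x) \<le> len n (word_perm t)" using nz x by (intro t(2)) auto
    ultimately show False by simp
  qed
  then have "(\<Sum>x\<in>std_words - {t}. z x * at_one (word_vec x (word_perm t \<circ> inv' v))) = 0"
    by (intro sum.neutral ballI)
  then have "(\<Sum>x\<in>std_words. z x * at_one (word_vec x (word_perm t \<circ> inv' v))) = z t * at_one (word_vec t (word_perm t \<circ> inv' v))"
    using t sum.remove[OF finite_std_words, of t "\<lambda>x. z x * at_one (word_vec x (word_perm t \<circ> inv' v))"] by simp
  then show False using z[OF W] t at_one_word_vec_diag[OF tw] by simp
qed

text \<open>Induction on the width \<open>d\<close> of the window of exponents: all coefficients
  vanish at \<open>q = 1\<close>, so the relation can be divided by \<open>q - 1\<close>, which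
  narrows the window by one.\<close>

lemma independent_bounded:
  assumes "\<And>u. u \<in> std_words \<Longrightarrow> Poly_Mapping.keys (a u) \<subseteq> {lo..<lo + int d}"
    and "\<And>w. (\<Sum>u\<in>std_words. a u * word_vec u w) = 0" and "u \<in> std_words"
  shows "a u = 0"
  using assms
proof (induction d arbitrary: a u)
  case 0
  then show ?case by simp
next
  case (Suc d)
  have at_one_0: "at_one (a u) = 0" if u: "u \<in> std_words" for u
  proof (rule independent_at_one[OF _ u])
    fix w
    have "at_one (\<Sum>u\<in>std_words. a u * word_vec u w) = 0" using Suc.prems(2) by simp
    then show "(\<Sum>u\<in>std_words. at_one (a u) * at_one (word_vec u w)) = 0" by (simp add: at_one_sum at_one_mult)
  qed
  have "\<forall>u\<in>std_words. \<exists>g. a u = (q - 1) * g \<and> Poly_Mapping.keys g \<subseteq> {lo..<lo + int d}"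
  proof
    fix u assume u: "u \<in> std_words"
    have "Poly_Mapping.keys (a u) \<subseteq> {lo..lo + int d}" using Suc.prems(1)[OF u] by force
    then show "\<exists>g. a u = (q - 1) * g \<and> Poly_Mapping.keys g \<subseteq> {lo..<lo + int d}"
      by (rule at_one_eq_0_divisible[OF at_one_0[OF u]]) (intro exI conjI)
  qed
  from bchoice[OF this] obtain g where
    "\<forall>u\<in>std_words. a u = (q - 1) * g u \<and> Poly_Mapping.keys (g u) \<subseteq> {lo..<lo + int d}" ..
  then have g: "a u = (q - 1) * g u" "Poly_Mapping.keys (g u) \<subseteq> {lo..<lo + int d}" if "u \<in> std_words" for u
    using that by simp_all
  have "(\<Sum>u\<in>std_words. g u * word_vec u w) = 0" for w
  proof -
    have "(q - 1) * (\<Sum>u\<in>std_words. g u * word_vec u w) = (\<Sum>u\<in>std_words. a u * word_vec u w)"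
      unfolding sum_distrib_left by (rule sum.cong[OF refl]) (simp add: g(1) mult.assoc)
    then show ?thesis using Suc.prems(2) q_minus_1_nonzero by simp
  qed
  from Suc.IH[OF g(2) this Suc.prems(3)] show ?case using g(1)[OF Suc.prems(3)] by simp
qed

theorem independent:
  assumes "\<And>w. (\<Sum>u\<in>std_words. a u * word_vec u w) = 0" and "u \<in> std_words"
  shows "a u = 0"
proof -
  let ?K = "\<Union>u\<in>std_words. Poly_Mapping.keys (a u)"
  have "finite ?K" using finite_std_words by simp
  then have le: "Min ?K \<le> k" "k \<le> Max ?K" if "k \<in> ?K" for k
    using that by (auto intro: Min_le Max_ge)
  have "Poly_Mapping.keys (a u) \<subseteq> {Min ?K..<Min ?K + int (nat (Max ?K + 1 - Min ?K))}"
    if u: "u \<in> std_words" for u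
  proof
    fix k assume "k \<in> Poly_Mapping.keys (a u)"
    then have "k \<in> ?K" using u by blast
    from le[OF this] show "k \<in> {Min ?K..<Min ?K + int (nat (Max ?K + 1 - Min ?K))}"
      unfolding atLeastLessThan_iff by linarith
  qed
  from independent_bounded[OF this assms] show ?thesis .
qed

lemma coeff_unique:
  assumes "\<And>w. f w = (\<Sum>u\<in>std_words. a u * word_vec u w)" "\<And>w. f w = (\<Sum>u\<in>std_words. b u * word_vec u w)" "u \<in> std_words"
  shows "a u = b u"
proof -
  have "a u - b u = 0"
  proof (rule independent[OF _ assms(3)])
    fix w
    show "(\<Sum>u\<in>std_words. (a u - b u) * word_vec u w) = 0"
      using assms(1)[of w] assms(2)[of w] by (simp add: left_diff_distrib sum_subtractf)
  qed
  then show ?thesis by simp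
qed

lemma coeff_std_words:
  assumes "c \<in> std_words" "u \<in> std_words"
  shows "coeff c u = (if u = c then 1 else 0)"
  by (rule coeff_unique[where f = "word_vec c" and b = "\<lambda>u. if u = c then 1 else 0"])
    (use assms in \<open>simp_all add: word_vec_coeff[OF std_words_words] sum_indicator finite_std_words\<close>)

section \<open>Integrality of the coefficients\<close>

lemma height_0: "height j c 0 = 0"
  by (simp add: height_def)

lemma height_pred:
  "1 \<le> p \<Longrightarrow> height j c p = height j c (p - 1) + (if c p = j then 1 else 0) - (if c p = Suc j then 1 else 0)"
  by (simp add: height_def cnt_pred)

lemma height_lower_bound: "- int m \<le> height j c m"
proof -
  have "cnt c (Suc j) m \<le> card {1..m}" unfolding cnt_def by (rule card_mono) auto
  then show ?thesis by (simp add: height_def)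
qed

lemma height_upd_up:
  assumes "c p = Suc j" "1 \<le> p"
  shows "height j (c(p := j)) m = height j c m + (if p \<le> m then 2 else 0)"
  using assms cnt_upd_ge[of p m c j j] cnt_upd_ge[of p m c j "Suc j"]
  by (cases "p \<le> m") (auto simp: height_def cnt_upd_less)

lemma height_upd_down:
  assumes "c p = j" "1 \<le> p"
  shows "height j (c(p := Suc j)) m = height j c m - (if p \<le> m then 2 else 0)"
  using assms cnt_upd_ge[of p m c "Suc j" j] cnt_upd_ge[of p m c "Suc j" "Suc j"]
  by (cases "p \<le> m") (auto simp: height_def cnt_upd_less)

text \<open>Independence lets \<open>lower_eq_0\<close> be read off coefficient by
  coefficient.\<close>

lemma coeff_relation:
  assumes j: "1 \<le> j" and e: "e \<in> shallow j" and u: "u \<in> std_words"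
  shows "(\<Sum>p | p \<in> {1..n} \<and> e p = j. mq (height j e (p - 1)) * coeff (e(p := Suc j)) u) = 0"
proof (rule independent[OF _ u, where a = "\<lambda>u. \<Sum>p | p \<in> {1..n} \<and> e p = j. mq (height j e (p - 1)) * coeff (e(p := Suc j)) u"])
  fix w
  let ?P = "{p. p \<in> {1..n} \<and> e p = j}"
  have "0 = (\<Sum>p\<in>?P. mq (height j e (p - 1)) * word_vec (e(p := Suc j)) w)"
    using fun_cong[OF lower_eq_0[OF j e], of w] by (simp add: lower_def)
  also have "\<dots> = (\<Sum>p\<in>?P. \<Sum>u\<in>std_words. mq (height j e (p - 1)) * coeff (e(p := Suc j)) u * word_vec u w)"
  proof (rule sum.cong[OF refl])
    fix p assume "p \<in> ?P"
    then have "e(p := Suc j) \<in> words" using shallow_upd[OF e] by blast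
    then show "mq (height j e (p - 1)) * word_vec (e(p := Suc j)) w
        = (\<Sum>u\<in>std_words. mq (height j e (p - 1)) * coeff (e(p := Suc j)) u * word_vec u w)"
      by (subst word_vec_coeff) (simp_all add: sum_distrib_left mult.assoc)
  qed
  also have "\<dots> = (\<Sum>u\<in>std_words. (\<Sum>p\<in>?P. mq (height j e (p - 1)) * coeff (e(p := Suc j)) u) * word_vec u w)"
    by (subst sum.swap) (simp add: sum_distrib_right)
  finally show "(\<Sum>u\<in>std_words. (\<Sum>p\<in>?P. mq (height j e (p - 1)) * coeff (e(p := Suc j)) u) * word_vec u w) = 0" ..
qed

text \<open>
  As for the crystal operators on words, apply the relation of \<open>lower\<close> at the first place where the
  path \<open>height j c\<close> attains its minimum. The words arising from changes at later places have
  coefficients in \<open>q \<int>[q]\<close> in this relation, those from earlier places have a path with a smaller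
  minimum.
\<close>

lemma coeff_valuation_step:
  assumes j: "1 \<le> j" and all: "\<And>c u. c \<in> words \<Longrightarrow> u \<in> std_words \<Longrightarrow> coeff c u \<in> val_ge m"
    and "c \<in> words" "x \<le> n" "height j c x < 0" and u: "u \<in> std_words"
  shows "coeff c u \<in> val_ge (m + 1)"
  using assms(3-5)
proof (induction "nat (int n + Min (height j c ` {0..n}))" arbitrary: c x rule: less_induct)
  case less
  note c = less.prems(1)
  let ?H = "\<lambda>c. height j c ` {0..n}"
  define M where "M = Min (?H c)"
  have M: "M \<in> ?H c" unfolding M_def by (rule Min_in) auto
  have Mle: "M \<le> height j c y" if "y \<le> n" for y unfolding M_def using that by (intro Min_le) auto
  have Mneg: "M < 0" using Mle[OF less.prems(2)] less.prems(3) by simp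
  obtain y where "M = height j c y" "y \<in> {0..n}" using M by (rule imageE)
  then have y: "y \<le> n" "height j c y = M" by simp_all
  \<comment> \<open>The path steps down at its first minimum, so the letter there is
    \<open>j + 1\<close>. Turning it into \<open>j\<close> gives \<open>e\<close>, and
    \<open>c\<close> reappears as the term of \<open>lower j e\<close> at \<open>p\<close>.\<close>
  define p where "p = (LEAST y. height j c y = M)"
  have hp: "height j c p = M" unfolding p_def by (rule LeastI[of "\<lambda>y. height j c y = M", OF y(2)])
  have pn: "p \<le> n" using Least_le[of "\<lambda>y. height j c y = M", OF y(2)] y(1) by (simp add: p_def)
  have p1: "1 \<le> p" using hp Mneg height_0[of j c] by (cases p) auto
  have "height j c (p - 1) \<noteq> M"
    unfolding p_def by (rule not_less_Least) (use p1 in \<open>simp add: p_def[symmetric]\<close>)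
  moreover have "M \<le> height j c (p - 1)" using pn by (intro Mle) auto
  ultimately have cp: "c p = Suc j" and hp1: "height j c (p - 1) = M + 1"
    using height_pred[OF p1, of j c] hp by (auto split: if_splits)
  define e where "e = c(p := j)"
  have ep: "e(p := Suc j) = c" using cp by (auto simp: e_def)
  have es: "e \<in> shallow j" unfolding shallow_def using ep c p1 pn by (auto simp: e_def intro!: bexI[of _ p])
  have he: "height j e y = height j c y + (if p \<le> y then 2 else 0)" for y
    unfolding e_def by (rule height_upd_up[of c p j, OF cp p1])
  let ?P = "{x. x \<in> {1..n} \<and> e x = j}"
  have pP: "p \<in> ?P" using p1 pn by (simp add: e_def)
  have finP: "finite ?P" by simp
  have hep: "height j e (p - 1) = M + 1" using he[of "p - 1"] hp1 p1 by simp
  let ?t = "\<lambda>x. mq (height j e (x - 1)) * coeff (e(x := Suc j)) u"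
  \<comment> \<open>Scaling by \<open>mq (- (M + 1))\<close> makes the weight of \<open>c\<close>
    equal to 1.\<close>
  have other: "mq (- (M + 1)) * ?t x \<in> val_ge (m + 1)" if x: "x \<in> ?P - {p}" for x
  proof -
    have xw: "e(x := Suc j) \<in> words" using shallow_upd[OF es] x by blast
    have cx: "x \<noteq> p" "1 \<le> x" "x \<le> n" "e x = j" using x by auto
    have eq: "mq (- (M + 1)) * ?t x = mq (height j e (x - 1) - (M + 1)) * coeff (e(x := Suc j)) u"
    proof -
      have "height j e (x - 1) - (M + 1) = - (M + 1) + height j e (x - 1)" by simp
      then show ?thesis by (simp only: mq_add mult.assoc)
    qed
    show ?thesis
    proof (cases "p < x")
      \<comment> \<open>From \<open>p\<close> on the path of \<open>e\<close> is that of
        \<open>c\<close> raised by 2, so the scaled weight has order at least 1 and the bound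
        \<open>m\<close> suffices.\<close>
      case True
      have "p \<le> x - 1" "x - 1 \<le> n" using True cx by linarith+
      then have "M + 2 \<le> height j e (x - 1)" using he[of "x - 1"] Mle[of "x - 1"] by simp
      then have "mq (height j e (x - 1) - (M + 1)) \<in> val_ge 1"
        by (intro val_ge_mono[OF mq_val_ge]) simp
      from val_ge_mult[OF this all[OF xw u]] show ?thesis unfolding eq by (simp add: add.commute)
    next
      \<comment> \<open>Before \<open>p\<close> the path of \<open>c\<close> stays above
        \<open>M\<close>, so the scaled weight has order at least 0. The word changed at
        \<open>x\<close> reaches depth \<open>M - 1\<close> at \<open>p - 1\<close>, so the
        induction on the minimum applies.\<close>
      case False
      then have xp: "x < p" using cx by simp
      let ?c = "e(x := Suc j)"
      have "height j ?c (p - 1) = height j e (p - 1) - 2"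
        using height_upd_down[of e x j, OF cx(4,2), of "p - 1"] xp by simp
      then have deep: "height j ?c (p - 1) = M - 1" using hep by simp
      have "Min (?H ?c) \<le> height j ?c (p - 1)" using pn by (intro Min_le) auto
      moreover have "- int n \<le> Min (?H ?c)"
      proof -
        have "Min (?H ?c) \<in> ?H ?c" by (rule Min_in) auto
        then obtain y where "Min (?H ?c) = height j ?c y" "y \<in> {0..n}" by (rule imageE)
        then show ?thesis using height_lower_bound[of y j ?c] by simp
      qed
      ultimately have dec: "nat (int n + Min (?H ?c)) < nat (int n + Min (?H c))"
        using deep unfolding M_def by linarith
      have "coeff ?c u \<in> val_ge (m + 1)"
        by (rule less.hyps[OF dec xw, of "p - 1"]) (use deep Mneg pn in auto)
      moreover have "M + 1 \<le> height j e (x - 1)"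
      proof -
        have "height j c (x - 1) \<noteq> M"
          unfolding p_def by (rule not_less_Least) (use xp in \<open>simp add: p_def[symmetric]\<close>)
        moreover have "\<not> p \<le> x - 1" "x - 1 \<le> n" using xp pn cx by linarith+
        ultimately show ?thesis using he[of "x - 1"] Mle[of "x - 1"] by simp
      qed
      then have "mq (height j e (x - 1) - (M + 1)) \<in> val_ge 0"
        by (intro val_ge_mono[OF mq_val_ge]) simp
      ultimately show ?thesis unfolding eq using val_ge_mult by fastforce
    qed
  qed
  have "?t p + sum ?t (?P - {p}) = 0"
    using coeff_relation[OF j es u] sum.remove[OF finP pP, of ?t] by simp
  then have tp: "?t p = - sum ?t (?P - {p})" by (simp only: eq_neg_iff_add_eq_0)
  have "mq (- (M + 1)) * ?t p = - (\<Sum>x\<in>?P - {p}. mq (- (M + 1)) * ?t x)"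
    unfolding sum_distrib_left[symmetric] mult_minus_right[symmetric] tp ..
  then have "mq (- (M + 1)) * ?t p \<in> val_ge (m + 1)"
    by (rule ssubst) (intro val_ge_uminus val_ge_sum other)
  moreover have "mq (- (M + 1)) * ?t p = coeff c u"
    using mq_inverse[of "M + 1"] unfolding ep hep by (simp add: mult.assoc[symmetric] mult.commute)
  ultimately show ?case by (simp only:)
qed

lemma not_lattice_height: "\<not> lattice_word n c \<Longrightarrow> \<exists>j x. 1 \<le> j \<and> x \<le> n \<and> height j c x < 0"
  by (force simp: lattice_word_def height_def not_le)

theorem coeff_in_q_polys:
  assumes c: "c \<in> words" and nl: "\<not> lattice_word n c" and u: "u \<in> std_words"
  shows "coeff c u \<in> val_ge 1"
proof -
  have step: "coeff c u \<in> val_ge (m + 1)"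
    if "\<And>c u. c \<in> words \<Longrightarrow> u \<in> std_words \<Longrightarrow> coeff c u \<in> val_ge m" "c \<in> words" "\<not> lattice_word n c" "u \<in> std_words" for c u m
    using not_lattice_height[OF that(3)] coeff_valuation_step[OF _ that(1,2) _ _ that(4)] by blast
  \<comment> \<open>The bound is raised for all words together, one degree at a time; lattice words
    do not obstruct this up to 0, since their coefficients are 0 and 1.\<close>
  have all: "coeff c u \<in> val_ge 0"
    if "\<And>c u. c \<in> words \<Longrightarrow> u \<in> std_words \<Longrightarrow> coeff c u \<in> val_ge (- int k)" "c \<in> words" "u \<in> std_words" for k c u
    using that
  proof (induction k arbitrary: c u)
    case 0
    then show ?case by simp
  next
    case (Suc k)
    show ?case
    proof (rule Suc.IH[OF _ Suc.prems(2,3)])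
      fix c u assume cu: "c \<in> words" "u \<in> std_words"
      show "coeff c u \<in> val_ge (- int k)"
      proof (cases "lattice_word n c")
        case True
        then have "c \<in> std_words" using cu by (simp add: std_words_def)
        then show ?thesis using coeff_std_words[OF _ cu(2)] by (simp add: val_ge_def)
      next
        case False
        from step[OF Suc.prems(1) cu(1) False cu(2)] show ?thesis by simp
      qed
    qed
  qed
  \<comment> \<open>The starting bound exists because there are finitely many coefficients.\<close>
  have "\<exists>k. \<forall>p\<in>words \<times> std_words. coeff (fst p) (snd p) \<in> val_ge (- int k)"
  proof -
    have "\<forall>p. \<exists>k. coeff (fst p) (snd p) \<in> val_ge (- int k)" using ex_val_ge by blast
    from choice[OF this] obtain k where k: "\<forall>p. coeff (fst p) (snd p) \<in> val_ge (- int (k p))" ..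
    have fin: "finite (k ` (words \<times> std_words))" using finite_words finite_std_words by simp
    have "coeff (fst p) (snd p) \<in> val_ge (- int (Max (k ` (words \<times> std_words))))" if "p \<in> words \<times> std_words" for p
      by (rule val_ge_mono[OF spec[OF k]]) (use Max_ge[OF fin imageI[OF that]] in simp)
    then show ?thesis by (intro exI ballI)
  qed
  then obtain k where k: "\<forall>p\<in>words \<times> std_words. coeff (fst p) (snd p) \<in> val_ge (- int k)" ..
  have "coeff c u \<in> val_ge (- int k)" if "c \<in> words" "u \<in> std_words" for c u
    using bspec[OF k, of "(c, u)"] that by simp
  from step[OF all[OF this] c nl u] show ?thesis by simp
qed

section \<open>Weak ascents\<close>

text \<open>The difference of the two sides factors as
  \<open>(\<alpha> - q) * (\<alpha> + q_inv)\<close>, and there are no zero divisors.\<close>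

lemma q_root:
  assumes "\<alpha> * \<alpha> = 1 + q_diff * \<alpha>" "\<alpha> \<in> val_ge 1"
  shows "\<alpha> = q"
proof -
  have "(\<alpha> - q) * (\<alpha> + q_inv) = \<alpha> * \<alpha> - (1 + q_diff * \<alpha>)"
    by (simp add: q_diff_def algebra_simps q_mult_q_inv)
  then have "\<alpha> - q = 0 \<or> \<alpha> + q_inv = 0" using assms(1) by simp
  moreover have "\<alpha> + q_inv \<noteq> 0"
  proof
    assume "\<alpha> + q_inv = 0"
    then have "q_inv \<in> val_ge 1" using val_ge_uminus[OF assms(2)] by (simp add: eq_neg_iff_add_eq_0[symmetric])
    then show False by (simp add: val_ge_def q_inv_def)
  qed
  ultimately show ?thesis by simp
qed

lemma coeff_weak_ascent_dominates:
  assumes c: "c \<in> std_words" and i: "1 \<le> i" "i < n" and nl: "\<not> lattice_word n (c \<circ> simple_refl i)"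
    and u: "u \<in> std_words" "coeff (c \<circ> simple_refl i) u \<noteq> 0"
  shows "dominates n u c"
  by (rule dom_weak_ascent[OF _ _ i nl])
    (use c u coeff_dominates[OF words_swap[OF std_words_words[OF c] i]] in \<open>auto simp: std_words_def\<close>)

text \<open>The diagonal coefficient \<open>\<alpha>\<close> of \<open>T\<^sub>s\<close> satisfies the quadratic relation of \<open>T\<^sub>s\<close>, because \<open>T\<^sub>s\<close> is triangular enough.\<close>

lemma coeff_weak_ascent_diag:
  assumes c: "c \<in> std_words" and i: "1 \<le> i" "i < n" and asc: "c i < c (Suc i)"
    and nl: "\<not> lattice_word n (c \<circ> simple_refl i)"
  shows "coeff (c \<circ> simple_refl i) c = q"
proof (rule q_root)
  let ?s = "simple_refl i" and ?d = "c \<circ> simple_refl i"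
  have cw: "c \<in> words" and cl: "lattice_word n c" using c by (auto simp: std_words_def)
  have d: "?d \<in> words" by (rule words_swap[OF cw i])
  have dc: "?d \<circ> ?s = c" by (simp add: comp_assoc)
  show "coeff ?d c \<in> val_ge 1" by (rule coeff_in_q_polys[OF d nl c])
  \<comment> \<open>The matrix of \<open>T\<^sub>s\<close> in the standard vectors. Below, the
    coefficient of \<open>c\<close> in the square of \<open>T\<^sub>s\<close> applied to the vector
    of \<open>c\<close> is computed in two ways, as \<open>e1\<close> and \<open>e2\<close>.\<close>
  define X where "X u t = (if u i < u (Suc i) then coeff (u \<circ> ?s) t
      else if u (Suc i) < u i then coeff (u \<circ> ?s) t + q_diff * coeff u t else - q_inv * coeff u t)" for u t
  have X: "left_op n ?s (word_vec u) w = (\<Sum>t\<in>std_words. X u t * word_vec t w)" if u: "u \<in> std_words" for u w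
  proof -
    have uw: "u \<in> words" using u by (simp add: std_words_def)
    note us = word_vec_coeff[OF words_swap[OF uw i], of w] and u' = word_vec_coeff[OF uw, of w]
    consider "u i < u (Suc i)" | "u (Suc i) < u i" | "u i = u (Suc i)" by linarith
    then show ?thesis
    proof cases
      case 1
      then show ?thesis using us by (simp add: word_vec_ascent[OF uw i] X_def del: comp_apply)
    next
      case 2
      have "left_op n ?s (word_vec u) w = (\<Sum>t\<in>std_words. coeff (u \<circ> ?s) t * word_vec t w) + q_diff * (\<Sum>t\<in>std_words. coeff u t * word_vec t w)"
        unfolding word_vec_descent[OF uw i 2] us[symmetric] u'[symmetric] ..
      then show ?thesis using 2
        by (simp add: X_def distrib_right sum.distrib sum_distrib_left mult.assoc del: comp_apply)
    next
      case 3
      have "left_op n ?s (word_vec u) w = - q_inv * (\<Sum>t\<in>std_words. coeff u t * word_vec t w)"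
        unfolding word_vec_equal[OF uw i 3] u'[symmetric] ..
      then show ?thesis using 3 by (simp add: X_def sum_distrib_left mult.assoc sum_negf)
    qed
  qed
  have e1: "left_op n ?s (word_vec ?d) w = (\<Sum>t\<in>std_words. (\<Sum>u\<in>std_words. coeff ?d u * X u t) * word_vec t w)" for w
  proof -
    have "word_vec ?d = (\<lambda>w. \<Sum>u\<in>std_words. coeff ?d u * word_vec u w)" using word_vec_coeff[OF d] by (rule ext)
    then have "left_op n ?s (word_vec ?d) w = (\<Sum>u\<in>std_words. coeff ?d u * left_op n ?s (word_vec u) w)"
      by (simp only: left_op_linear)
    also have "\<dots> = (\<Sum>u\<in>std_words. \<Sum>t\<in>std_words. coeff ?d u * X u t * word_vec t w)"
      by (rule sum.cong[OF refl]) (simp add: X sum_distrib_left mult.assoc)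
    also have "\<dots> = (\<Sum>t\<in>std_words. (\<Sum>u\<in>std_words. coeff ?d u * X u t) * word_vec t w)"
      by (subst sum.swap) (simp add: sum_distrib_right)
    finally show ?thesis .
  qed
  have e2: "left_op n ?s (word_vec ?d) w = (\<Sum>t\<in>std_words. (coeff c t + q_diff * coeff ?d t) * word_vec t w)" for w
  proof -
    have "left_op n ?s (word_vec ?d) w = word_vec c w + q_diff * word_vec ?d w"
      using word_vec_descent[OF d i, of w] asc unfolding dc by (simp add: simple_refl_apply)
    also have "\<dots> = (\<Sum>t\<in>std_words. coeff c t * word_vec t w) + q_diff * (\<Sum>t\<in>std_words. coeff ?d t * word_vec t w)"
      unfolding word_vec_coeff[OF cw, symmetric] word_vec_coeff[OF d, symmetric] ..
    finally show ?thesis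
      by (simp add: distrib_right sum.distrib sum_distrib_left mult.assoc)
  qed
  have "(\<Sum>u\<in>std_words. coeff ?d u * X u c) = coeff c c + q_diff * coeff ?d c"
    by (rule coeff_unique[OF e1 e2 c])
  \<comment> \<open>A contribution through \<open>u\<close> would make \<open>u\<close> and
    \<open>c\<close> dominate each other, unless \<open>u \<circ> ?s\<close> were \<open>c\<close>
    itself, in which case \<open>?d\<close> would be the lattice word \<open>u\<close>.\<close>
  moreover have "coeff ?d u * X u c = 0" if u: "u \<in> std_words - {c}" for u
  proof (rule ccontr)
    assume nz: "coeff ?d u * X u c \<noteq> 0"
    have uL: "u \<in> std_words" "u \<noteq> c" and uw: "u \<in> words" and ul: "lattice_word n u"
      using u by (auto simp: std_words_def)
    have "coeff ?d u \<noteq> 0" using nz by auto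
    then have uc: "dominates n u c" by (rule coeff_weak_ascent_dominates[OF c i nl uL(1)])
    have usW: "u \<circ> ?s \<in> words" by (rule words_swap[OF uw i])
    have ucc: "coeff u c = 0" using coeff_std_words[OF uL(1) c] uL(2) by simp
    have us_c: "u \<circ> ?s \<noteq> c"
    proof
      assume "u \<circ> ?s = c"
      then have "?d = u \<circ> ?s \<circ> ?s" by simp
      then have "?d = u" by (simp add: comp_assoc)
      then show False using nl ul by simp
    qed
    have "coeff (u \<circ> ?s) c \<noteq> 0 \<and> u i \<noteq> u (Suc i)"
      using nz ucc by (auto simp: X_def split: if_splits)
    then have nzc: "coeff (u \<circ> ?s) c \<noteq> 0" by blast
    show False
    proof (cases "lattice_word n (u \<circ> ?s)")
      case True
      then have "u \<circ> ?s \<in> std_words" using usW by (simp add: std_words_def)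
      then show False using coeff_std_words[OF _ c] nzc us_c by metis
    next
      case False
      have "dominates n c u" by (rule coeff_weak_ascent_dominates[OF uL(1) i False c nzc])
      then show False using dom_antisym[OF uw cw uc] uL(2) by simp
    qed
  qed
  then have "(\<Sum>u\<in>std_words - {c}. coeff ?d u * X u c) = 0" by (intro sum.neutral ballI)
  then have "(\<Sum>u\<in>std_words. coeff ?d u * X u c) = coeff ?d c * X c c"
    using sum.remove[OF finite_std_words c, of "\<lambda>u. coeff ?d u * X u c"] by simp
  moreover have "X c c = coeff ?d c" using asc by (simp add: X_def del: comp_apply)
  moreover have "coeff c c = 1" using coeff_std_words[OF c c] by simp
  ultimately show "coeff ?d c * coeff ?d c = 1 + q_diff * coeff ?d c" by simp
qed

theorem word_vec_weak_ascent:
  assumes c: "c \<in> std_words" and i: "1 \<le> i" "i < n" and asc: "c i < c (Suc i)"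
    and nl: "\<not> lattice_word n (c \<circ> simple_refl i)"
  shows "left_op n (simple_refl i) (word_vec c) w
    = q * word_vec c w - (\<Sum>u | u \<in> std_words \<and> dominates n u c \<and> u \<noteq> c. - coeff (c \<circ> simple_refl i) u * word_vec u w)"
proof -
  let ?s = "simple_refl i" and ?d = "c \<circ> simple_refl i"
  let ?S = "{u. u \<in> std_words \<and> dominates n u c \<and> u \<noteq> c}"
  have cw: "c \<in> words" using c by (simp add: std_words_def)
  have "left_op n ?s (word_vec c) w = (\<Sum>u\<in>std_words. coeff ?d u * word_vec u w)"
    unfolding word_vec_ascent[OF cw i asc] by (rule word_vec_coeff[OF words_swap[OF cw i]])
  also have "\<dots> = coeff ?d c * word_vec c w + (\<Sum>u\<in>std_words - {c}. coeff ?d u * word_vec u w)"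
    by (rule sum.remove[OF finite_std_words c])
  also have "(\<Sum>u\<in>std_words - {c}. coeff ?d u * word_vec u w) = (\<Sum>u\<in>?S. coeff ?d u * word_vec u w)"
    by (rule sum.mono_neutral_right)
      (use coeff_weak_ascent_dominates[OF c i nl] finite_std_words in auto)
  finally show ?thesis
    unfolding coeff_weak_ascent_diag[OF c i asc nl] mult_minus_left sum_negf diff_minus_eq_add .
qed

end

section \<open>Tableaux\<close>

lemma rank_less:
  fixes le :: "'a \<Rightarrow> 'a \<Rightarrow> bool"
  assumes "finite S" and trans: "\<And>x y z. le x y \<Longrightarrow> le y z \<Longrightarrow> le x z"
    and refl: "\<And>x. le x x" and y: "y \<in> S" and xy: "le x y" "\<not> le y x"
  shows "card {z \<in> S. le z x} < card {z \<in> S. le z y}"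
proof (rule psubset_card_mono)
  show "{z \<in> S. le z x} \<subset> {z \<in> S. le z y}"
    using trans[OF _ xy(1)] refl[of y] y xy(2) by blast
qed (use assms(1) in simp)

text \<open>Ranks in a finite total order. Applied to the column order and the row order of the
  cells, this shows that \<open>col_tab\<close> and \<open>row_tab\<close> are bijective
  fillings.\<close>

lemma rank_bij:
  fixes le :: "'a \<Rightarrow> 'a \<Rightarrow> bool"
  assumes fin: "finite S" and trans: "\<And>x y z. le x y \<Longrightarrow> le y z \<Longrightarrow> le x z"
    and refl: "\<And>x. le x x" and total: "\<And>x y. x \<noteq> y \<Longrightarrow> le x y \<longleftrightarrow> \<not> le y x"
  shows "bij_betw (\<lambda>x. card {z \<in> S. le z x}) S {1..card S}"
proof -
  let ?f = "\<lambda>x. card {z \<in> S. le z x}"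
  have inj: "inj_on ?f S"
  proof (rule inj_onI, rule ccontr)
    fix x y assume xy: "x \<in> S" "y \<in> S" "?f x = ?f y" "x \<noteq> y"
    show False
      using rank_less[where S = S and le = le and x = x and y = y, OF fin trans refl xy(2)]
        rank_less[where S = S and le = le and x = y and y = x, OF fin trans refl xy(1)]
        xy(3) total[OF xy(4)] by fastforce
  qed
  have "?f ` S \<subseteq> {1..card S}"
  proof
    fix k assume "k \<in> ?f ` S"
    then obtain x where x: "x \<in> S" "k = ?f x" by blast
    have "?f x \<le> card S" by (rule card_mono[OF fin]) auto
    moreover have "0 < ?f x" using fin x(1) refl[of x] by (simp add: card_gt_0_iff) blast
    ultimately show "k \<in> {1..card S}" using x(2) by simp
  qed
  moreover have "card (?f ` S) = card {1..card S}" using card_image[OF inj] by simp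
  ultimately have "?f ` S = {1..card S}" by (intro card_subset_eq) auto
  with inj show ?thesis by (simp add: bij_betw_def)
qed

locale shape =
  fixes n :: nat and lam :: "nat list"
  assumes part: "is_partition n lam"
begin

abbreviation cells :: "(nat \<times> nat) set" where "cells \<equiv> diagram lam"

lemma sum_lam: "sum_list lam = n"
  using part by (simp add: is_partition_def)

lemma lam_decreasing: "i \<le> i' \<Longrightarrow> i' < length lam \<Longrightarrow> lam ! i' \<le> lam ! i"
  using part sorted_wrt_nth_less[of "(\<ge>)" lam i i'] by (cases "i = i'") (auto simp: is_partition_def)

lemma cells_down:
  assumes "(i, j) \<in> cells" "1 \<le> i'" "i' \<le> i" "1 \<le> j'" "j' \<le> j"
  shows "(i', j') \<in> cells"
proof -
  have i: "1 \<le> i" "i \<le> length lam" "j \<le> lam ! (i - 1)" using assms(1) by (auto simp: diagram_def)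
  have "lam ! (i - 1) \<le> lam ! (i' - 1)" by (rule lam_decreasing) (use i assms in linarith)+
  then show ?thesis using i assms by (simp add: diagram_def)
qed

lemma cells_pos: "(i, j) \<in> cells \<Longrightarrow> 1 \<le> i" "(i, j) \<in> cells \<Longrightarrow> 1 \<le> j"
  by (auto simp: diagram_def)

lemma cells_Sigma: "cells = (SIGMA i:{1..length lam}. {1..lam ! (i - 1)})"
  by (auto simp: diagram_def)

lemma finite_cells: "finite cells"
  by (simp add: cells_Sigma)

lemma card_cells: "card cells = n"
proof -
  have "card cells = (\<Sum>i\<in>{1..length lam}. lam ! (i - 1))"
    by (simp add: cells_Sigma)
  also have "\<dots> = (\<Sum>i\<in>{0..<length lam}. lam ! i)"
    by (rule sum.reindex_bij_witness[of _ Suc "\<lambda>i. i - 1"]) auto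
  finally show ?thesis by (simp add: sum_list_sum_nth[symmetric] sum_lam)
qed

definition col_le :: "nat \<times> nat \<Rightarrow> nat \<times> nat \<Rightarrow> bool" where
  "col_le x y \<longleftrightarrow> snd x < snd y \<or> snd x = snd y \<and> fst x \<le> fst y"

definition row_le :: "nat \<times> nat \<Rightarrow> nat \<times> nat \<Rightarrow> bool" where
  "row_le x y \<longleftrightarrow> fst x < fst y \<or> fst x = fst y \<and> snd x \<le> snd y"

lemma col_tab_eq: "x \<in> cells \<Longrightarrow> col_tab lam x = card {z \<in> cells. col_le z x}"
  by (cases x) (simp add: col_tab_def col_le_def case_prod_beta')

lemma row_tab_eq: "x \<in> cells \<Longrightarrow> row_tab lam x = card {z \<in> cells. row_le z x}"
  by (cases x) (simp add: row_tab_def row_le_def case_prod_beta')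

lemma col_tab_bij: "bij_betw (col_tab lam) cells {1..n}"
proof -
  have "bij_betw (\<lambda>x. card {z \<in> cells. col_le z x}) cells {1..card cells}"
    by (rule rank_bij[OF finite_cells]) (auto simp: col_le_def prod_eq_iff)
  then show ?thesis unfolding card_cells by (subst bij_betw_cong[OF col_tab_eq])
qed

lemma row_tab_bij: "bij_betw (row_tab lam) cells {1..n}"
proof -
  have "bij_betw (\<lambda>x. card {z \<in> cells. row_le z x}) cells {1..card cells}"
    by (rule rank_bij[OF finite_cells]) (auto simp: row_le_def prod_eq_iff)
  then show ?thesis unfolding card_cells by (subst bij_betw_cong[OF row_tab_eq])
qed

lemma col_tab_outside: "x \<notin> cells \<Longrightarrow> col_tab lam x = 0"
  by (cases x) (simp add: col_tab_def)

lemma row_tab_outside: "x \<notin> cells \<Longrightarrow> row_tab lam x = 0"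
  by (cases x) (simp add: row_tab_def)

lemma col_tab_less_iff:
  assumes x: "x \<in> cells" and y: "y \<in> cells"
  shows "col_tab lam x < col_tab lam y \<longleftrightarrow> col_le x y \<and> x \<noteq> y"
proof -
  have less: "col_tab lam x < col_tab lam y" if "x \<in> cells" "y \<in> cells" "col_le x y" "x \<noteq> y" for x y
    unfolding col_tab_eq[OF that(1)] col_tab_eq[OF that(2)]
    by (rule rank_less[OF finite_cells])
      (use that in \<open>auto simp: col_le_def prod_eq_iff\<close>)
  have "col_le x y \<or> col_le y x" by (auto simp: col_le_def)
  then show ?thesis using less[OF x y] less[OF y x] by fastforce
qed

lemma row_tab_less:
  assumes "x \<in> cells" "y \<in> cells" "row_le x y" "x \<noteq> y"
  shows "row_tab lam x < row_tab lam y"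
  unfolding row_tab_eq[OF assms(1)] row_tab_eq[OF assms(2)]
  by (rule rank_less[OF finite_cells]) (use assms in \<open>auto simp: row_le_def prod_eq_iff\<close>)

lemma is_tableau_iff:
  "is_tableau lam t \<longleftrightarrow> bij_betw t cells {1..n} \<and> (\<forall>c. c \<notin> cells \<longrightarrow> t c = 0)"
  by (simp add: is_tableau_def sum_lam)

definition cell :: "nat \<Rightarrow> nat \<times> nat" where
  "cell k = inv_into cells (col_tab lam) k"

definition rcell :: "nat \<Rightarrow> nat \<times> nat" where
  "rcell k = inv_into cells (row_tab lam) k"

text \<open>The map \<open>K\<close> of the abstract setting; as a word it is that of
  \<open>t\<^sub>\<lambda>\<close> itself.\<close>

definition kap :: "nat \<Rightarrow> nat" where
  "kap k = snd (cell k)"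

text \<open>Rows refer to \<open>t\<^sup>\<lambda>\<close>, whereas the columns of
  \<open>kap\<close> refer to \<open>t\<^sub>\<lambda>\<close>; the permutation \<open>v\<close>
  links the two.\<close>

definition rho :: "nat \<Rightarrow> nat" where
  "rho k = fst (rcell k)"

lemma cell_in: "k \<in> {1..n} \<Longrightarrow> cell k \<in> cells"
  unfolding cell_def by (rule inv_into_into) (use col_tab_bij in \<open>simp add: bij_betw_def\<close>)

lemma col_tab_cell: "k \<in> {1..n} \<Longrightarrow> col_tab lam (cell k) = k"
  unfolding cell_def by (rule f_inv_into_f) (use col_tab_bij in \<open>simp add: bij_betw_def\<close>)

lemma cell_col_tab: "x \<in> cells \<Longrightarrow> cell (col_tab lam x) = x"
  unfolding cell_def by (rule inv_into_f_f) (use col_tab_bij in \<open>simp_all add: bij_betw_def\<close>)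

lemma col_tab_range: "x \<in> cells \<Longrightarrow> col_tab lam x \<in> {1..n}"
  using col_tab_bij by (rule bij_betwE[THEN bspec])

lemma rcell_in: "k \<in> {1..n} \<Longrightarrow> rcell k \<in> cells"
  unfolding rcell_def by (rule inv_into_into) (use row_tab_bij in \<open>simp add: bij_betw_def\<close>)

lemma row_tab_rcell: "k \<in> {1..n} \<Longrightarrow> row_tab lam (rcell k) = k"
  unfolding rcell_def by (rule f_inv_into_f) (use row_tab_bij in \<open>simp add: bij_betw_def\<close>)

lemma rcell_row_tab: "x \<in> cells \<Longrightarrow> rcell (row_tab lam x) = x"
  unfolding rcell_def by (rule inv_into_f_f) (use row_tab_bij in \<open>simp_all add: bij_betw_def\<close>)

lemma row_tab_range: "x \<in> cells \<Longrightarrow> row_tab lam x \<in> {1..n}"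
  using row_tab_bij by (rule bij_betwE[THEN bspec])

lemma kap_mono:
  assumes "1 \<le> x" "x \<le> y" "y \<le> n"
  shows "kap x \<le> kap y"
proof (cases "x = y")
  case False
  have xy: "x \<in> {1..n}" "y \<in> {1..n}" using assms by auto
  have "col_tab lam (cell x) < col_tab lam (cell y)"
    using False assms by (simp add: col_tab_cell[OF xy(1)] col_tab_cell[OF xy(2)])
  then show ?thesis
    using col_tab_less_iff[OF cell_in[OF xy(1)] cell_in[OF xy(2)]] by (auto simp: col_le_def kap_def)
qed simp

lemma kap_pos: "1 \<le> x \<Longrightarrow> x \<le> n \<Longrightarrow> 1 \<le> kap x"
  using cells_pos(2)[of "fst (cell x)" "snd (cell x)"] cell_in[of x] by (simp add: kap_def)

sublocale col_index n kap
  by unfold_locales (rule kap_mono, assumption+, rule kap_pos)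

lemma rho_mono':
  assumes "1 \<le> x" "x \<le> y" "y \<le> n"
  shows "rho x \<le> rho y"
proof (rule ccontr)
  assume n: "\<not> ?thesis"
  have xy: "x \<in> {1..n}" "y \<in> {1..n}" using assms by auto
  have "row_tab lam (rcell y) < row_tab lam (rcell x)"
    by (rule row_tab_less[OF rcell_in[OF xy(2)] rcell_in[OF xy(1)]])
      (use n in \<open>auto simp: row_le_def rho_def\<close>)
  then show False using assms by (simp add: row_tab_rcell[OF xy(1)] row_tab_rcell[OF xy(2)])
qed

text \<open>The cell of \<open>k\<close> and the cells above it carry exactly the entries of its
  column up to \<open>k\<close>.\<close>

lemma cnt_kap:
  assumes k: "k \<in> {1..n}"
  shows "cnt kap (kap k) k = fst (cell k)"
proof -
  let ?i = "fst (cell k)" and ?j = "snd (cell k)"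
  have c: "(?i, ?j) \<in> cells" using cell_in[OF k] by simp
  have "bij_betw (\<lambda>i. col_tab lam (i, ?j)) {1..?i} {x \<in> {1..k}. kap x = kap k}"
  proof (rule bij_betwI[where g = "\<lambda>x. fst (cell x)"])
    show "(\<lambda>i. col_tab lam (i, ?j)) \<in> {1..?i} \<rightarrow> {x \<in> {1..k}. kap x = kap k}"
    proof
      fix i assume i: "i \<in> {1..?i}"
      then have ic: "(i, ?j) \<in> cells" using cells_down[OF c, of i ?j] cells_pos(2)[OF c] by simp
      have "\<not> col_tab lam (?i, ?j) < col_tab lam (i, ?j)"
        unfolding col_tab_less_iff[OF c ic] using i by (auto simp: col_le_def)
      then have "col_tab lam (i, ?j) \<le> k" using col_tab_cell[OF k] by simp
      then show "col_tab lam (i, ?j) \<in> {x \<in> {1..k}. kap x = kap k}"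
        using col_tab_range[OF ic] cell_col_tab[OF ic] by (simp add: kap_def)
    qed
    show "(\<lambda>x. fst (cell x)) \<in> {x \<in> {1..k}. kap x = kap k} \<rightarrow> {1..?i}"
    proof
      fix x assume x: "x \<in> {x \<in> {1..k}. kap x = kap k}"
      then have xn: "x \<in> {1..n}" using k by auto
      have "\<not> col_tab lam (cell k) < col_tab lam (cell x)"
        using x by (simp add: col_tab_cell[OF k] col_tab_cell[OF xn])
      then have "fst (cell x) \<le> ?i"
        using x by (auto simp: col_tab_less_iff[OF cell_in[OF k] cell_in[OF xn]] col_le_def kap_def prod_eq_iff)
      moreover have "1 \<le> fst (cell x)"
        using cells_pos(1)[of "fst (cell x)" "snd (cell x)"] cell_in[OF xn] by simp
      ultimately show "fst (cell x) \<in> {1..?i}" by simp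
    qed
    show "fst (cell (col_tab lam (i, ?j))) = i" if "i \<in> {1..?i}" for i
      using cells_down[OF c, of i ?j] cells_pos(2)[OF c] that cell_col_tab[of "(i, ?j)"] by simp
    show "col_tab lam (fst (cell x), ?j) = x" if x: "x \<in> {x \<in> {1..k}. kap x = kap k}" for x
    proof -
      have xn: "x \<in> {1..n}" and e: "snd (cell x) = ?j" using x k by (auto simp: kap_def)
      then have "(fst (cell x), ?j) = cell x" by (simp add: prod_eq_iff)
      then show ?thesis using col_tab_cell[OF xn] by simp
    qed
  qed
  from bij_betw_same_card[OF this] show ?thesis by (simp add: cnt_def)
qed

lemma tab_perm_exists:
  assumes t: "is_tableau lam t"
  shows "\<exists>w. w \<in> Wn n \<and> w \<circ> col_tab lam = t"
proof -
  have tb: "bij_betw t cells {1..n}" and t0: "\<And>c. c \<notin> cells \<Longrightarrow> t c = 0"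
    using t by (auto simp: is_tableau_iff)
  define w where "w x = (if x \<in> {1..n} then t (cell x) else x)" for x
  have "bij_betw (t \<circ> cell) {1..n} {1..n}"
    unfolding cell_def[abs_def] by (rule bij_betw_trans[OF bij_betw_inv_into[OF col_tab_bij] tb])
  then have "bij_betw w {1..n} {1..n}"
    by (subst bij_betw_cong[of "{1..n}" w "t \<circ> cell"]) (simp add: w_def)
  then have "w permutes {1..n}"
    by (rule bij_imp_permutes) (auto simp: w_def)
  moreover have "w (col_tab lam x) = t x" for x
  proof (cases "x \<in> cells")
    case True
    show ?thesis unfolding w_def if_P[OF col_tab_range[OF True]] cell_col_tab[OF True] ..
  qed (simp add: w_def col_tab_outside t0)
  ultimately show ?thesis by (intro exI[of _ w]) (auto simp: Wn_iff fun_eq_iff)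
qed

lemma tab_perm_unique:
  assumes w: "w \<in> Wn n" "w' \<in> Wn n" and eq: "w \<circ> col_tab lam = w' \<circ> col_tab lam"
  shows "w = w'"
proof (rule ext)
  fix x
  show "w x = w' x"
  proof (cases "x \<in> {1..n}")
    case True
    then show ?thesis using fun_cong[OF eq, of "cell x"] by (simp add: col_tab_cell[OF True])
  next
    case False
    then show ?thesis using w by (auto simp: Wn_iff permutes_def)
  qed
qed

lemma tab_perm:
  assumes t: "is_tableau lam t"
  shows "tab_perm n lam t \<in> Wn n" "tab_perm n lam t \<circ> col_tab lam = t"
proof -
  have "\<exists>!w. w \<in> Wn n \<and> w \<circ> col_tab lam = t"
    using tab_perm_exists[OF t] tab_perm_unique by metis
  from theI'[OF this, folded tab_perm_def]
  show "tab_perm n lam t \<in> Wn n" "tab_perm n lam t \<circ> col_tab lam = t" by auto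
qed

lemma Wn_tableau:
  assumes w: "w \<in> Wn n"
  shows "is_tableau lam (w \<circ> col_tab lam)"
proof -
  have "bij_betw w {1..n} {1..n}" using w by (simp add: Wn_iff permutes_imp_bij)
  then have "bij_betw (w \<circ> col_tab lam) cells {1..n}" by (rule bij_betw_trans[OF col_tab_bij])
  moreover have "w 0 = 0" by (rule permutes_not_in[of w "{1..n}"]) (use w in \<open>simp_all add: Wn_iff\<close>)
  ultimately show ?thesis by (simp add: is_tableau_iff col_tab_outside)
qed

lemma tab_perm_comp: "w \<in> Wn n \<Longrightarrow> tab_perm n lam (w \<circ> col_tab lam) = w"
  using tab_perm[OF Wn_tableau] tab_perm_unique by metis

lemma tab_perm_left:
  assumes "is_tableau lam t" "s \<in> Wn n"
  shows "tab_perm n lam (s \<circ> t) = s \<circ> tab_perm n lam t"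
proof -
  have "s \<circ> t = (s \<circ> tab_perm n lam t) \<circ> col_tab lam"
    unfolding comp_assoc tab_perm(2)[OF assms(1)] ..
  then show ?thesis using tab_perm_comp[OF Wn_comp[OF assms(2) tab_perm(1)[OF assms(1)]]] by metis
qed

section \<open>Standard tableaux as lattice words\<close>

definition col_increasing :: "tableau \<Rightarrow> bool" where
  "col_increasing t \<longleftrightarrow> (\<forall>i i' j. (i, j) \<in> cells \<and> (i', j) \<in> cells \<and> i < i' \<longrightarrow> t (i, j) < t (i', j))"

definition row_increasing :: "tableau \<Rightarrow> bool" where
  "row_increasing t \<longleftrightarrow> (\<forall>i j j'. (i, j) \<in> cells \<and> (i, j') \<in> cells \<and> j < j' \<longrightarrow> t (i, j) < t (i, j'))"

lemma STD_iff: "t \<in> STD lam \<longleftrightarrow> is_tableau lam t \<and> col_increasing t \<and> row_increasing t"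
  by (simp add: STD_def col_increasing_def row_increasing_def)

lemma col_increasing_iff:
  assumes w: "w \<in> Wn n"
  shows "col_increasing (w \<circ> col_tab lam) \<longleftrightarrow> w \<in> Dset"
proof
  assume c: "col_increasing (w \<circ> col_tab lam)"
  have "w x < w y" if xy: "1 \<le> x" "x < y" "y \<le> n" "kap x = kap y" for x y
  proof -
    have x: "x \<in> {1..n}" and y: "y \<in> {1..n}" using xy by auto
    obtain i j where ij: "cell x = (i, j)" by (cases "cell x")
    obtain i' where ij': "cell y = (i', j)" using xy(4) ij by (cases "cell y") (simp add: kap_def)
    have ce: "(i, j) \<in> cells" "(i', j) \<in> cells" using cell_in[OF x] cell_in[OF y] ij ij' by auto
    have ct: "col_tab lam (i, j) = x" "col_tab lam (i', j) = y"
      using col_tab_cell[OF x] col_tab_cell[OF y] ij ij' by auto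
    have "i < i'"
      using col_tab_less_iff[OF ce] ct xy(2) by (auto simp: col_le_def)
    then have "(w \<circ> col_tab lam) (i, j) < (w \<circ> col_tab lam) (i', j)"
      using c ce unfolding col_increasing_def by blast
    then show ?thesis by (simp add: ct)
  qed
  then show "w \<in> Dset" using w by (simp add: Dset_def)
next
  assume d: "w \<in> Dset"
  show "col_increasing (w \<circ> col_tab lam)"
    unfolding col_increasing_def
  proof (intro allI impI)
    fix i i' j assume a: "(i, j) \<in> cells \<and> (i', j) \<in> cells \<and> i < i'"
    then have ce: "(i, j) \<in> cells" "(i', j) \<in> cells" by auto
    have "col_tab lam (i, j) < col_tab lam (i', j)"
      using a by (simp add: col_tab_less_iff[OF ce] col_le_def)
    then show "(w \<circ> col_tab lam) (i, j) < (w \<circ> col_tab lam) (i', j)"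
      using Dset_less[OF d col_tab_range[OF ce(1)] col_tab_range[OF ce(2)]]
      by (simp add: kap_def cell_col_tab[OF ce(1)] cell_col_tab[OF ce(2)])
  qed
qed

text \<open>The entry \<open>y\<close> lies in column \<open>?c y\<close> and row
  \<open>cnt ?c (?c y) y\<close>. So rows increase exactly if the \<open>k\<close>-th letter
  \<open>j\<close> always precedes the \<open>k\<close>-th letter \<open>j + 1\<close>, which is the
  lattice condition.\<close>

lemma row_increasing_iff:
  assumes d: "d \<in> Dset"
  shows "row_increasing (d \<circ> col_tab lam) \<longleftrightarrow> lattice_word n (kap \<circ> inv' d)"
proof -
  let ?t = "d \<circ> col_tab lam" and ?c = "kap \<circ> inv' d"
  have dW: "d \<in> Wn n" using d by (rule Dset_Wn)
  have cw: "?c \<in> words" by (rule Dset_words[OF d])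
  have range: "inv' d y \<in> {1..n}" if "y \<in> {1..n}" for y
    using Wn_in[OF Wn_inv[OF dW], of y] that by simp
  have range': "?t x \<in> {1..n}" if "x \<in> cells" for x
    using Wn_in[OF dW] col_tab_range[OF that] by simp
  have cell_eq: "cell (inv' d y) = (cnt ?c (?c y) y, ?c y)" if y: "y \<in> {1..n}" for y
    using cnt_word_perm[OF cw y] cnt_kap[OF range[OF y]] unfolding word_perm_eq[OF d]
    by (simp add: prod_eq_iff kap_def)
  have t_inv: "cell (inv' d (?t x)) = x" if "x \<in> cells" for x
    by (simp add: Wn_inv_apply[OF dW] cell_col_tab[OF that])
  have inv_t: "?t (cell (inv' d y)) = y" if "y \<in> {1..n}" for y
    by (simp add: col_tab_cell[OF range[OF that]] Wn_inv_apply[OF dW])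
  show ?thesis
  proof
    assume l: "lattice_word n ?c"
    show "row_increasing ?t"
      unfolding row_increasing_def
    proof (intro allI impI)
      fix i j j' assume a: "(i, j) \<in> cells \<and> (i, j') \<in> cells \<and> j < j'"
      then have ce: "(i, j) \<in> cells" "(i, j') \<in> cells" by auto
      let ?y = "?t (i, j')"
      have y: "?y \<in> {1..n}" by (rule range'[OF ce(2)])
      have "(cnt ?c (?c ?y) ?y, ?c ?y) = (i, j')"
        by (rule trans[OF cell_eq[OF y, symmetric] t_inv[OF ce(2)]])
      then have yc: "cnt ?c (?c ?y) ?y = i" "?c ?y = j'" unfolding prod.inject by blast+
      have "j < ?c ?y" using a yc(2) by simp
      from lattice_cell[OF l y cells_pos(2)[OF ce(1)] this]
      obtain x where x: "x \<in> {1..?y}" "?c x = j" "cnt ?c j x = cnt ?c (?c ?y) ?y" by blast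
      have xn: "x \<in> {1..n}" using x(1) y by auto
      have "cell (inv' d x) = (i, j)" using cell_eq[OF xn] x yc by simp
      then have "?t (i, j) = x" using inv_t[OF xn] by simp
      moreover have "x \<noteq> ?y" using x(2) yc(2) a by auto
      ultimately show "?t (i, j) < ?t (i, j')" using x(1) by simp
    qed
  next
    assume r: "row_increasing ?t"
    show "lattice_word n ?c"
      unfolding lattice_word_def
    proof (intro allI impI, rule ccontr)
      fix m j :: nat assume m: "m \<le> n" and j: "1 \<le> j" and "\<not> cnt ?c (Suc j) m \<le> cnt ?c j m"
      then have v: "Suc (cnt ?c j m) \<le> cnt ?c (Suc j) m" by simp
      \<comment> \<open>The violation occurs in row \<open>?k\<close>: its cell in column
        \<open>j + 1\<close> has an entry at most \<open>m\<close>, hence so has the left neighbour,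
        which would be one letter \<open>j\<close> more than there are up to
        \<open>m\<close>.\<close>
      let ?k = "Suc (cnt ?c j m)"
      define y where "y = (LEAST y. ?k \<le> cnt ?c (Suc j) y)"
      have y: "?k \<le> cnt ?c (Suc j) y" "y \<le> m"
        unfolding y_def
        by (rule LeastI[of "\<lambda>y. ?k \<le> cnt ?c (Suc j) y", OF v]
          Least_le[of "\<lambda>y. ?k \<le> cnt ?c (Suc j) y", OF v])+
      have y1: "1 \<le> y"
      proof (rule ccontr)
        assume "\<not> 1 \<le> y"
        then have "y = 0" by simp
        show False using y(1) unfolding \<open>y = 0\<close> cnt_0 by simp
      qed
      have "\<not> ?k \<le> cnt ?c (Suc j) (y - 1)"
        by (rule not_less_Least[of "y - 1" "\<lambda>y. ?k \<le> cnt ?c (Suc j) y", folded y_def])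
          (use y1 in linarith)
      then have cy: "?c y = Suc j" "cnt ?c (Suc j) y = ?k"
        using y(1) cnt_pred[OF y1, of ?c "Suc j"] by (auto split: if_splits)
      have yn: "y \<in> {1..n}" using y1 y(2) m by simp
      have yc: "cell (inv' d y) = (?k, Suc j)" using cell_eq[OF yn] cy by simp
      then have ce: "(?k, Suc j) \<in> cells" using cell_in[OF range[OF yn]] by simp
      then have ce': "(?k, j) \<in> cells" using cells_down[OF ce, of ?k j] j by simp
      let ?x = "?t (?k, j)"
      have xn: "?x \<in> {1..n}" by (rule range'[OF ce'])
      have "?x < ?t (?k, Suc j)"
        by (rule r[unfolded row_increasing_def, rule_format]) (intro conjI ce ce' lessI)
      also have "?t (?k, Suc j) = y" using inv_t[OF yn] unfolding yc .
      finally have xm: "?x \<le> m" using y(2) by linarith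
      have "(cnt ?c (?c ?x) ?x, ?c ?x) = (?k, j)"
        by (rule trans[OF cell_eq[OF xn, symmetric] t_inv[OF ce']])
      then have "cnt ?c (?c ?x) ?x = ?k" "?c ?x = j" unfolding prod.inject by blast+
      then have "cnt ?c j ?x = ?k" by (simp only:)
      then show False using cnt_mono[OF xm, of ?c j] by linarith
    qed
  qed
qed

lemma STD_comp_iff:
  assumes w: "w \<in> Wn n"
  shows "w \<circ> col_tab lam \<in> STD lam \<longleftrightarrow> w \<in> Dset \<and> lattice_word n (kap \<circ> inv' w)"
  using Wn_tableau[OF w] col_increasing_iff[OF w] row_increasing_iff[of w] by (auto simp: STD_iff)

text \<open>This is the standardness of \<open>t\<^sub>\<lambda>\<close>.\<close>

lemma lattice_kap: "lattice_word n kap"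
proof -
  have id: "id \<in> Dset" by (auto simp: Dset_def)
  have "row_increasing (id \<circ> col_tab lam)"
    by (auto simp: row_increasing_def col_tab_less_iff col_le_def)
  then have "lattice_word n (kap \<circ> inv' id)" by (simp only: row_increasing_iff[OF id])
  then show ?thesis by (simp only: inv_id o_id)
qed

definition v :: perm where "v = v_perm n lam"

lemma v_Wn': "v \<in> Wn n" and v_comp: "v \<circ> col_tab lam = row_tab lam"
proof -
  have t: "is_tableau lam (row_tab lam)"
    using row_tab_bij row_tab_outside by (simp add: is_tableau_iff)
  show "v \<in> Wn n" "v \<circ> col_tab lam = row_tab lam"
    unfolding v_def v_perm_def by (rule tab_perm[OF t])+
qed

lemma rho_v': "k \<in> {1..n} \<Longrightarrow> rho (v k) = fst (cell k)"
  using fun_cong[OF v_comp, of "cell k"] by (simp add: col_tab_cell rho_def rcell_row_tab cell_in)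

section \<open>The row and column stabilisers\<close>

lemma J_par_iff:
  assumes "1 \<le> k" "k < n"
  shows "simple_refl k \<in> J_par n lam \<longleftrightarrow> kap k = kap (Suc k)"
proof
  assume "simple_refl k \<in> J_par n lam"
  then obtain l i i' j where l: "simple_refl k = simple_refl l"
    "(i, j) \<in> cells" "(i', j) \<in> cells" "col_tab lam (i, j) = l" "col_tab lam (i', j) = l + 1"
    by (auto simp: J_par_def)
  have "simple_refl k k \<noteq> k" "simple_refl k (Suc k) \<noteq> Suc k" by (simp_all add: simple_refl_apply)
  then have "l = k" unfolding l(1) by (auto simp: simple_refl_apply split: if_splits)
  then show "kap k = kap (Suc k)"
    using l cell_col_tab[OF l(2)] cell_col_tab[OF l(3)] by (simp add: kap_def)
next
  assume e: "kap k = kap (Suc k)"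
  have k: "k \<in> {1..n}" "Suc k \<in> {1..n}" using assms by auto
  obtain i j where ij: "cell k = (i, j)" by (cases "cell k")
  obtain i' where ij': "cell (Suc k) = (i', j)" using e ij by (cases "cell (Suc k)") (simp add: kap_def)
  have "(i, j) \<in> cells \<and> (i', j) \<in> cells \<and> col_tab lam (i, j) = k \<and> col_tab lam (i', j) = k + 1"
    using col_tab_cell[OF k(1)] col_tab_cell[OF k(2)] cell_in[OF k(1)] cell_in[OF k(2)] ij ij' by simp
  then have "\<exists>i i' j. (i, j) \<in> cells \<and> (i', j) \<in> cells \<and> col_tab lam (i, j) = k \<and> col_tab lam (i', j) = k + 1"
    by blast
  then show "simple_refl k \<in> J_par n lam" unfolding J_par_def mem_Collect_eq using assms by blast
qed

lemma J_parE:
  assumes "s \<in> J_par n lam"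
  obtains k where "s = simple_refl k" "1 \<le> k" "k < n" "kap k = kap (Suc k)"
proof -
  obtain k where k: "s = simple_refl k" "1 \<le> k" "k < n" using assms by (auto simp: J_par_def)
  then show ?thesis using that[OF k] J_par_iff[OF k(2,3)] assms by simp
qed

lemma D_par_eq: "D_par n lam = Dset"
proof (rule Set.set_eqI)
  fix d
  show "d \<in> D_par n lam \<longleftrightarrow> d \<in> Dset"
  proof
    assume "d \<in> D_par n lam"
    then have d: "d \<in> Wn n" "\<And>s. s \<in> J_par n lam \<Longrightarrow> len n d < len n (d \<circ> s)"
      by (auto simp: D_par_def)
    show "d \<in> Dset"
    proof (rule Dset_adjacent[OF d(1)])
      fix k assume k: "1 \<le> k" "k < n" "kap k = kap (Suc k)"
      then have "len n d < len n (d \<circ> simple_refl k)" by (intro d(2)) (simp add: J_par_iff)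
      then show "d k < d (Suc k)" unfolding len_right_less_iff(1)[OF d(1) k(1,2)] .
    qed
  next
    assume d: "d \<in> Dset"
    have dW: "d \<in> Wn n" by (rule Dset_Wn[OF d])
    have "len n d < len n (d \<circ> s)" if s: "s \<in> J_par n lam" for s
    proof -
      obtain k where k: "s = simple_refl k" "1 \<le> k" "k < n" "kap k = kap (Suc k)"
        using s by (rule J_parE)
      show ?thesis unfolding k(1) len_right_less_iff(1)[OF dW k(2,3)]
        using d k by (simp add: Dset_def)
    qed
    then show "d \<in> D_par n lam" using dW by (simp add: D_par_def)
  qed
qed

lemma kap_swap: "kap k = kap (Suc k) \<Longrightarrow> kap (simple_refl k x) = kap x"
  by (simp add: simple_refl_apply)

lemma W_par_Wn: "w \<in> W_par n lam \<Longrightarrow> w \<in> Wn n \<and> (\<forall>x. kap (w x) = kap x)"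
  unfolding W_par_def
proof (induction rule: generate.induct)
  case one
  show ?case unfolding sym_group_one id_def using Wn_id[of n, unfolded id_def] by blast
next
  case (incl h)
  then obtain k where k: "h = simple_refl k" "1 \<le> k" "k < n" "kap k = kap (Suc k)" by (rule J_parE)
  show ?case unfolding k(1) using simple_refl_Wn[OF k(2,3)] kap_swap[OF k(4)] by blast
next
  case (inv h)
  then obtain k where k: "h = simple_refl k" "1 \<le> k" "k < n" "kap k = kap (Suc k)" by (rule J_parE)
  show ?case
    unfolding k(1) sym_group_inv_equality[OF simple_refl_Wn[OF k(2,3)]] inv_simple_refl
    using simple_refl_Wn[OF k(2,3)] kap_swap[OF k(4)] by blast
next
  case (eng h1 h2)
  then have "h1 \<circ> h2 \<in> Wn n" "kap ((h1 \<circ> h2) x) = kap x" for x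
    by (blast intro: Wn_comp) (simp add: eng)
  then show ?case unfolding sym_group_mult by blast
qed

lemma W_par_id: "id \<in> W_par n lam"
  unfolding W_par_def using generate.one[of "sym_group n"] by (simp add: sym_group_one)

lemma W_par_left:
  assumes s: "s \<in> J_par n lam"
  shows "s \<circ> w \<in> W_par n lam \<longleftrightarrow> w \<in> W_par n lam"
proof -
  have imp: "s \<circ> w \<in> W_par n lam" if "w \<in> W_par n lam" for w
    using generate.eng[OF generate.incl[OF s], of w "sym_group n"] that
    by (simp add: W_par_def sym_group_mult)
  obtain k where k: "s = simple_refl k" "1 \<le> k" "k < n" using s by (rule J_parE)
  have "s \<circ> (s \<circ> w) = w" using simple_refls_comp_comp simple_refl_in[OF k(2,3)] k(1) by metis
  then show ?thesis using imp[of w] imp[of "s \<circ> w"] by metis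
qed

lemma row_stab_iff:
  "w \<in> row_stab n lam \<longleftrightarrow> w \<in> Wn n \<and> (\<forall>k \<in> {1..n}. rho (w k) = rho k)"
proof (cases "w \<in> Wn n")
  case w: True
  show ?thesis
  proof
    assume r: "w \<in> row_stab n lam"
    have "rho (w k) = rho k" if k: "k \<in> {1..n}" for k
    proof -
      obtain i j where ij: "rcell k = (i, j)" by (cases "rcell k")
      have ce: "(i, j) \<in> cells" and rt: "row_tab lam (i, j) = k"
        using rcell_in[OF k] row_tab_rcell[OF k] ij by auto
      obtain j' where j': "(i, j') \<in> cells" "w (row_tab lam (i, j)) = row_tab lam (i, j')"
        using r ce unfolding row_stab_def by blast
      then have "rcell (w k) = (i, j')" using rt rcell_row_tab[OF j'(1)] by simp
      then show ?thesis by (simp add: rho_def ij)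
    qed
    then show "w \<in> Wn n \<and> (\<forall>k \<in> {1..n}. rho (w k) = rho k)" using w by blast
  next
    assume r: "w \<in> Wn n \<and> (\<forall>k \<in> {1..n}. rho (w k) = rho k)"
    have "\<exists>j'. (i, j') \<in> cells \<and> w (row_tab lam (i, j)) = row_tab lam (i, j')" if ce: "(i, j) \<in> cells" for i j
    proof -
      let ?k = "row_tab lam (i, j)"
      have k: "?k \<in> {1..n}" by (rule row_tab_range[OF ce])
      have wk: "w ?k \<in> {1..n}" using Wn_in[OF w, of ?k] k by simp
      have "fst (rcell (w ?k)) = i"
        using r k rcell_row_tab[OF ce] by (simp add: rho_def del: atLeastAtMost_iff)
      then have e: "rcell (w ?k) = (i, snd (rcell (w ?k)))" by (simp add: prod_eq_iff)
      show ?thesis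
        using rcell_in[OF wk] row_tab_rcell[OF wk] e by metis
    qed
    then show "w \<in> row_stab n lam" using w by (simp add: row_stab_def)
  qed
qed (simp add: row_stab_def)

lemma row_stab_right:
  assumes k: "1 \<le> k" "k < n" "rho k = rho (Suc k)" and w: "w \<in> Wn n"
  shows "w \<circ> simple_refl k \<in> row_stab n lam \<longleftrightarrow> w \<in> row_stab n lam"
proof -
  have imp: "w \<circ> simple_refl k \<in> row_stab n lam" if "w \<in> row_stab n lam" for w
  proof -
    have w: "w \<in> Wn n" and r: "\<And>x. x \<in> {1..n} \<Longrightarrow> rho (w x) = rho x"
      using that by (auto simp: row_stab_iff)
    have "rho (w (simple_refl k x)) = rho x" if "x \<in> {1..n}" for x
      using r[of "simple_refl k x"] that k by (auto simp: simple_refl_apply)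
    then show ?thesis using Wn_comp[OF w simple_refl_Wn[OF k(1,2)]] by (simp add: row_stab_iff)
  qed
  have "w \<circ> simple_refl k \<circ> simple_refl k = w" by (simp add: comp_assoc)
  then show ?thesis using imp[of w] imp[of "w \<circ> simple_refl k"] by metis
qed

section \<open>The generator of the Specht module\<close>

text \<open>Coordinates of \<open>x_elt\<close>, as \<open>Y\<close> below gives those of
  \<open>y_elt\<close>; see \<open>x_elt_Psi\<close> and \<open>y_elt_Psi\<close>.\<close>

definition X :: "perm \<Rightarrow> laurent" where
  "X w = (if w \<in> row_stab n lam then q ^ len n w else 0)"

definition Y :: "perm \<Rightarrow> laurent" where
  "Y w = (if w \<in> W_par n lam then (- q_inv) ^ len n w else 0)"

lemma row_stab_Wn: "row_stab n lam \<subseteq> Wn n"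
  by (auto simp: row_stab_def)

lemma W_par_subset: "W_par n lam \<subseteq> Wn n"
  using W_par_Wn by blast

lemma X_coord_fns: "X \<in> coord_fns n"
  using row_stab_Wn by (auto simp: X_def coord_fns_def)

lemma Y_coord_fns: "Y \<in> coord_fns n"
  using W_par_subset by (auto simp: Y_def coord_fns_def)

lemma finsum_T_elt:
  assumes "A \<subseteq> Wn n"
  shows "(\<Oplus>\<^bsub>hecke n\<^esub>w\<in>A. c w \<odot>\<^bsub>hecke n\<^esub> T_elt n w) = Psi n (\<lambda>u. if u \<in> A then c u else 0)"
proof -
  interpret abelian_group "hecke n" by (rule hecke_abelian_group)
  have fin: "finite A" by (rule finite_subset[OF assms finite_Wn])
  have "(\<Oplus>\<^bsub>hecke n\<^esub>w\<in>A. c w \<odot>\<^bsub>hecke n\<^esub> T_elt n w) = (\<Oplus>\<^bsub>hecke n\<^esub>w\<in>A. Psi n (\<lambda>u. c w * delta w u))"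
    by (rule finsum_cong') (use assms in \<open>auto simp: Psi_in T_elt_Psi Psi_smult\<close>)
  also have "\<dots> = Psi n (\<lambda>u. \<Sum>w\<in>A. c w * delta w u)" by (rule Psi_finsum[OF fin])
  also have "(\<lambda>u. \<Sum>w\<in>A. c w * delta w u) = (\<lambda>u. if u \<in> A then c u else 0)"
  proof (rule ext)
    fix u
    have "(\<Sum>w\<in>A. c w * delta w u) = (\<Sum>w\<in>A. if w = u then c w else 0)"
      by (rule sum.cong) (auto simp: delta_def)
    then show "(\<Sum>w\<in>A. c w * delta w u) = (if u \<in> A then c u else 0)" using fin by simp
  qed
  finally show ?thesis .
qed

lemma x_elt_Psi: "x_elt n lam = Psi n X"
  unfolding x_elt_def finsum_T_elt[OF row_stab_Wn] X_def[abs_def] ..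

lemma y_elt_Psi: "y_elt n lam = Psi n Y"
  unfolding y_elt_def finsum_T_elt[OF W_par_subset] Y_def[abs_def] ..

lemma q_cancel: "q_inv * (q * x) = x" "q * (q_inv * x) = x"
  by (simp_all add: mult.assoc[symmetric] q_mult_q_inv q_inv_mult_q)

text \<open>\<open>w\<close> and \<open>w \<circ> simple_refl k\<close> lie in the row stabiliser
  together, and their weights differ by a factor \<open>q\<close>; where the length drops,
  \<open>q_diff\<close> makes up for the difference between \<open>q_inv\<close> and
  \<open>q\<close>.\<close>

lemma X_row: "X \<in> row_eigen n rho"
proof -
  have "right_op n (simple_refl k) X = (\<lambda>w. q * X w)" if k: "1 \<le> k" "k < n" "rho k = rho (Suc k)" for k
  proof (rule ext)
    fix w
    let ?s = "simple_refl k"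
    show "right_op n ?s X w = q * X w"
    proof (cases "w \<in> Wn n")
      case w: True
      note iff = row_stab_right[OF k w]
      show ?thesis
      proof (cases "w \<in> row_stab n lam")
        case True
        have "X (w \<circ> ?s) + (if len n (w \<circ> ?s) < len n w then q_diff else 0) * X w = q * X w"
        proof (cases "w k < w (Suc k)")
          case up: True
          have "\<not> len n (w \<circ> ?s) < len n w" "len n (w \<circ> ?s) = Suc (len n w)"
            using len_comp_right(1)[OF w k(1,2) up] by linarith+
          then show ?thesis using True iff by (simp add: X_def del: comp_apply)
        next
          case False
          then have down: "w (Suc k) < w k" using Wn_adjacent_neq[OF w, of k] by blast
          have "len n (w \<circ> ?s) < len n w" "len n w = Suc (len n (w \<circ> ?s))"
            using len_comp_right(2)[OF w k(1,2) down] by linarith+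
          then show ?thesis using True iff
            by (simp add: X_def q_diff_def q_cancel left_diff_distrib del: comp_apply)
        qed
        then show ?thesis using w by (simp add: right_op_def del: comp_apply)
      next
        case False
        then show ?thesis using w iff by (simp add: right_op_def X_def del: comp_apply)
      qed
    next
      case False
      then show ?thesis using X_coord_fns by (simp add: right_op_def coord_fns_def)
    qed
  qed
  then show ?thesis using X_coord_fns by (simp add: row_eigen_def)
qed

lemma Y_col:
  assumes k: "1 \<le> k" "k < n" "kap k = kap (Suc k)"
  shows "left_op n (simple_refl k) Y = (\<lambda>w. - q_inv * Y w)"
proof (rule ext)
  fix w
  let ?s = "simple_refl k"
  have J: "?s \<in> J_par n lam" using k by (simp add: J_par_iff)
  show "left_op n ?s Y w = - q_inv * Y w"
  proof (cases "w \<in> Wn n")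
    case w: True
    note iff = W_par_left[OF J, of w]
    show ?thesis
    proof (cases "w \<in> W_par n lam")
      case True
      have "Y (?s \<circ> w) + (if len n (?s \<circ> w) < len n w then q_diff else 0) * Y w = - q_inv * Y w"
      proof (cases "inv' w k < inv' w (Suc k)")
        case up: True
        have "\<not> len n (?s \<circ> w) < len n w" "len n (?s \<circ> w) = Suc (len n w)"
          using len_comp_left(1)[OF w k(1,2) up] by linarith+
        then show ?thesis using True iff by (simp add: Y_def del: comp_apply)
      next
        case False
        then have down: "inv' w (Suc k) < inv' w k"
          using Wn_adjacent_neq[OF Wn_inv[OF w], of k] by blast
        have "len n (?s \<circ> w) < len n w" "len n w = Suc (len n (?s \<circ> w))"
          using len_comp_left(2)[OF w k(1,2) down] by linarith+
        then show ?thesis using True iff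
          by (simp add: Y_def q_diff_def q_cancel left_diff_distrib del: comp_apply)
      qed
      then show ?thesis using w by (simp add: left_op_def del: comp_apply)
    next
      case False
      then show ?thesis using w iff by (simp add: left_op_def Y_def del: comp_apply)
    qed
  next
    case False
    then show ?thesis using Y_coord_fns by (simp add: left_op_def coord_fns_def)
  qed
qed

definition Z :: "perm \<Rightarrow> laurent" where
  "Z u = (\<Sum>w\<in>Wn n. Y w * TT n w (TT n (inv' v) X) u)"

lemma TX_coord_fns: "TT n (inv' v) X \<in> coord_fns n"
  by (rule TT_coord_fns[OF X_coord_fns])

lemma Z_Psi: "Psi n Z = Psi n Y \<otimes>\<^bsub>hecke n\<^esub> Psi n (TT n (inv' v) X)"
  unfolding Psi_mult_Psi[OF Y_coord_fns TX_coord_fns] Z_def[abs_def] ..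

lemma specht_generator:
  "y_elt n lam \<otimes>\<^bsub>hecke n\<^esub> T_elt n (inv\<^bsub>sym_group n\<^esub> v_perm n lam) \<otimes>\<^bsub>hecke n\<^esub> x_elt n lam = Psi n Z"
proof -
  interpret Group.monoid "hecke n" by (rule hecke_monoid)
  have iv: "inv\<^bsub>sym_group n\<^esub> v_perm n lam = inv' v"
    using sym_group_inv_equality[OF v_Wn'] by (simp add: v_def)
  have T: "T_elt n (inv' v) \<in> carrier (hecke n)"
    by (simp add: T_elt_Psi Wn_inv v_Wn' Psi_in)
  have "y_elt n lam \<otimes>\<^bsub>hecke n\<^esub> T_elt n (inv' v) \<otimes>\<^bsub>hecke n\<^esub> x_elt n lam
      = Psi n Y \<otimes>\<^bsub>hecke n\<^esub> (T_elt n (inv' v) \<otimes>\<^bsub>hecke n\<^esub> Psi n X)"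
    unfolding x_elt_Psi y_elt_Psi by (rule m_assoc[OF Psi_in T Psi_in])
  also have "\<dots> = Psi n Z"
    unfolding T_elt_mult_Psi[OF Wn_inv[OF v_Wn'] X_coord_fns] Z_Psi ..
  finally show ?thesis unfolding iv .
qed

lemma Z_row': "Z \<in> row_eigen n rho"
  unfolding Z_def[abs_def]
  by (rule row_eigen_sum) (rule row_eigen_TT[OF row_eigen_TT[OF X_row Wn_inv[OF v_Wn']]])

lemma Z_Fn': "Z \<in> coord_fns n"
  using Z_row' by (simp add: row_eigen_def)

text \<open>Associativity moves \<open>T\<^sub>s\<close> onto the left factor, where
  \<open>Y_col\<close> applies.\<close>

lemma Z_col':
  assumes k: "1 \<le> k" "k < n" "kap k = kap (Suc k)"
  shows "left_op n (simple_refl k) Z = (\<lambda>w. - q_inv * Z w)"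
proof (rule Psi_inj)
  interpret Group.monoid "hecke n" by (rule hecke_monoid)
  have s: "simple_refl k \<in> simple_refls n" by (rule simple_refl_in[OF k(1,2)])
  have T: "T_gen n (simple_refl k) \<in> carrier (hecke n)"
    using s by (simp add: T_gen_def hecke_class_in FC_gen)
  have YF: "(\<lambda>w. - q_inv * Y w) \<in> coord_fns n" using Y_coord_fns by (simp add: coord_fns_def)
  have "Psi n (left_op n (simple_refl k) Z) = T_gen n (simple_refl k) \<otimes>\<^bsub>hecke n\<^esub> (Psi n Y \<otimes>\<^bsub>hecke n\<^esub> Psi n (TT n (inv' v) X))"
    unfolding Z_Psi[symmetric] T_gen_Psi[OF s] ..
  also have "\<dots> = T_gen n (simple_refl k) \<otimes>\<^bsub>hecke n\<^esub> Psi n Y \<otimes>\<^bsub>hecke n\<^esub> Psi n (TT n (inv' v) X)"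
    by (rule m_assoc[OF T Psi_in Psi_in, symmetric])
  also have "\<dots> = Psi n (\<lambda>u. \<Sum>w\<in>Wn n. - q_inv * Y w * TT n w (TT n (inv' v) X) u)"
    unfolding T_gen_Psi[OF s] Y_col[OF k] by (rule Psi_mult_Psi[OF YF TX_coord_fns])
  also have "(\<lambda>u. \<Sum>w\<in>Wn n. - q_inv * Y w * TT n w (TT n (inv' v) X) u) = (\<lambda>w. - q_inv * Z w)"
    unfolding Z_def sum_distrib_left mult.assoc ..
  finally show "Psi n (left_op n (simple_refl k) Z) = Psi n (\<lambda>w. - q_inv * Z w)" .
qed (rule left_op_coord_fns, use Z_Fn' in \<open>simp add: coord_fns_def\<close>)

text \<open>At \<open>q = 1\<close> only the trivial element contributes: the row and column stabilisers meet trivially.\<close>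

lemma Z_v': "at_one (Z (inv' v)) \<noteq> 0"
proof -
  let ?iv = "inv' v"
  have ivW: "?iv \<in> Wn n" by (rule Wn_inv[OF v_Wn'])
  have eval: "at_one (TT n w (TT n ?iv X) ?iv) = at_one (X (v \<circ> (inv' w \<circ> ?iv)))" if w: "w \<in> Wn n" for w
    unfolding at_one_TT[OF w ivW] at_one_TT[OF ivW Wn_comp[OF Wn_inv[OF w] ivW]] Wn_inv_inv[OF v_Wn'] ..
  \<comment> \<open>If both factors are nonzero, \<open>w\<close> preserves the columns of
    \<open>t\<^sub>\<lambda>\<close>. Conjugation by \<open>v\<close> turns the row condition for
    \<open>t\<^sup>\<lambda>\<close> into one for \<open>t\<^sub>\<lambda>\<close>, so
    \<open>inv' w\<close> also preserves rows there and fixes every cell.\<close>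
  have zero: "at_one (Y w) * at_one (X (v \<circ> (inv' w \<circ> ?iv))) = 0" if w: "w \<in> Wn n - {id}" for w
  proof (rule ccontr)
    assume nz: "at_one (Y w) * at_one (X (v \<circ> (inv' w \<circ> ?iv))) \<noteq> 0"
    have wW: "w \<in> Wn n" using w by blast
    have "w \<in> W_par n lam" using nz by (auto simp: Y_def split: if_splits)
    then have kw: "kap (w x) = kap x" for x using W_par_Wn by blast
    have "v \<circ> (inv' w \<circ> ?iv) \<in> row_stab n lam"
      using nz unfolding X_def by (cases "v \<circ> (inv' w \<circ> ?iv) \<in> row_stab n lam") (simp_all del: comp_apply)
    then have r: "rho ((v \<circ> (inv' w \<circ> ?iv)) k) = rho k" if "k \<in> {1..n}" for k
      using that unfolding row_stab_iff by blast
    have "inv' w x = x" if x: "x \<in> {1..n}" for x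
    proof -
      have iw: "inv' w x \<in> {1..n}" using Wn_in[OF Wn_inv[OF wW], of x] x by simp
      have vx: "v x \<in> {1..n}" using Wn_in[OF v_Wn', of x] x by simp
      have "rho (v (inv' w x)) = rho (v x)"
        using r[OF vx] unfolding comp_apply Wn_inv_apply(2)[OF v_Wn'] .
      then have f: "fst (cell (inv' w x)) = fst (cell x)" using rho_v'[OF iw] rho_v'[OF x] by simp
      have g: "snd (cell (inv' w x)) = snd (cell x)"
        using kw[of "inv' w x"] unfolding kap_def Wn_inv_apply(1)[OF wW] by simp
      have "cell (inv' w x) = cell x" using f g by (simp add: prod_eq_iff)
      then show ?thesis using col_tab_cell[OF iw] col_tab_cell[OF x] by metis
    qed
    then have fixed: "w x = x" if "x \<in> {1..n}" for x using Wn_inv_apply(1)[OF wW, of x] that by metis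
    moreover have "w x = x" if "x \<notin> {1..n}" for x
      by (rule permutes_not_in[OF _ that]) (use wW in \<open>simp add: Wn_iff\<close>)
    ultimately have "w = id" by (intro ext) (metis id_apply)
    then show False using w by blast
  qed
  have "at_one (Z ?iv) = (\<Sum>w\<in>Wn n. at_one (Y w) * at_one (X (v \<circ> (inv' w \<circ> ?iv))))"
    unfolding Z_def at_one_sum at_one_mult by (rule sum.cong[OF refl]) (simp only: eval)
  also have "\<dots> = at_one (Y id) * at_one (X (v \<circ> (inv' id \<circ> ?iv)))
      + (\<Sum>w\<in>Wn n - {id}. at_one (Y w) * at_one (X (v \<circ> (inv' w \<circ> ?iv))))"
    by (rule sum.remove) simp_all
  also have "(\<Sum>w\<in>Wn n - {id}. at_one (Y w) * at_one (X (v \<circ> (inv' w \<circ> ?iv)))) = 0"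
    by (rule sum.neutral) (intro ballI zero)
  also have "v \<circ> (inv' id \<circ> ?iv) = id"
    unfolding inv_id id_o by (rule Wn_inv_comp(1)[OF v_Wn'])
  finally have e: "at_one (Z ?iv) = at_one (Y id) * at_one (X id) + 0" .
  have "id \<in> row_stab n lam" unfolding row_stab_iff by (simp only: Wn_id id_apply) simp
  then have "at_one (X id) = 1" unfolding X_def by (simp only: if_True len_id) simp
  moreover have "at_one (Y id) = 1" unfolding Y_def using W_par_id by (simp only: if_True len_id) simp
  ultimately show ?thesis unfolding e by simp
qed

sublocale specht_data n kap rho v Z
proof unfold_locales
  show "rho (v k) = cnt kap (kap k) k" if "1 \<le> k" "k \<le> n" for k
    using rho_v'[of k] cnt_kap[of k] that by simp
qed (assumption | rule rho_mono' v_Wn' lattice_kap Z_row' Z_col' Z_v')+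

section \<open>The basis of the Specht module\<close>

definition col_word :: "tableau \<Rightarrow> nat \<Rightarrow> nat" where
  "col_word t = kap \<circ> inv' (tab_perm n lam t)"

definition specht_basis :: "tableau \<Rightarrow> free_elt set" where
  "specht_basis t = Psi n (word_vec (col_word t))"

lemma STD_col_word:
  assumes t: "t \<in> STD lam"
  shows "tab_perm n lam t \<in> Dset" "col_word t \<in> std_words" "col_word t \<in> words" "word_perm (col_word t) = tab_perm n lam t"
    "tab_perm n lam t \<in> Wn n" "tab_perm n lam t \<circ> col_tab lam = t" "is_tableau lam t"
proof -
  show tt: "is_tableau lam t" using t by (simp add: STD_iff)
  show W: "tab_perm n lam t \<in> Wn n" and e: "tab_perm n lam t \<circ> col_tab lam = t"
    by (rule tab_perm[OF tt])+
  have "tab_perm n lam t \<circ> col_tab lam \<in> STD lam" unfolding e by (rule t)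
  then have d: "tab_perm n lam t \<in> Dset" and l: "lattice_word n (col_word t)"
    unfolding STD_comp_iff[OF W] col_word_def by blast+
  show "tab_perm n lam t \<in> Dset" by (rule d)
  show "col_word t \<in> words" unfolding col_word_def by (rule Dset_words[OF d])
  then show "col_word t \<in> std_words" using l by (simp add: std_words_def)
  show "word_perm (col_word t) = tab_perm n lam t" unfolding col_word_def by (rule word_perm_eq[OF d])
qed

lemma std_words_STD:
  assumes c: "c \<in> std_words"
  shows "word_perm c \<circ> col_tab lam \<in> STD lam" "col_word (word_perm c \<circ> col_tab lam) = c"
proof -
  have cw: "c \<in> words" and cl: "lattice_word n c" using c by (auto simp: std_words_def)
  show "word_perm c \<circ> col_tab lam \<in> STD lam"
    unfolding STD_comp_iff[OF word_perm_Wn[OF cw]] word_perm(2)[OF cw] using word_perm(1)[OF cw] cl by blast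
  show "col_word (word_perm c \<circ> col_tab lam) = c"
    unfolding col_word_def tab_perm_comp[OF word_perm_Wn[OF cw]] by (rule word_perm(2)[OF cw])
qed

lemma col_word_bij: "bij_betw col_word (STD lam) std_words"
proof (rule bij_betwI[where g = "\<lambda>c. word_perm c \<circ> col_tab lam"])
  show "word_perm (col_word t) \<circ> col_tab lam = t" if "t \<in> STD lam" for t
    unfolding STD_col_word(4)[OF that] by (rule STD_col_word(6)[OF that])
qed (use STD_col_word(2) std_words_STD in blast)+

lemma finite_STD: "finite (STD lam)"
  using bij_betw_finite[OF col_word_bij] finite_std_words by simp

lemma word_vec_col_word: "t \<in> STD lam \<Longrightarrow> word_vec (col_word t) = TT n (tab_perm n lam t) Z"
  unfolding word_vec_def by (simp only: STD_col_word(4))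

lemma word_vec_coord_fns: "c \<in> words \<Longrightarrow> word_vec c \<in> coord_fns n"
  unfolding word_vec_def by (rule TT_coord_fns[OF Z_coord_fns])

text \<open>A permutation outside \<open>Dset\<close> has a right descent in the column stabiliser,
  which acts on \<open>Z\<close> by \<open>- q_inv\<close>. Removing such descents one by one leaves
  the representative of the same word.\<close>

lemma TT_reduce: "w \<in> Wn n \<Longrightarrow> \<exists>m. \<forall>u. TT n w Z u = m * word_vec (kap \<circ> inv' w) u"
proof (induction "len n w" arbitrary: w rule: less_induct)
  case less
  note w = less.prems
  show ?case
  proof (cases "w \<in> Dset")
    case True
    have "TT n w Z = word_vec (kap \<circ> inv' w)" unfolding word_vec_def word_perm_eq[OF True] ..
    then show ?thesis by (intro exI[of _ 1]) simp
  next
    case False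
    then obtain k where k: "1 \<le> k" "k < n" "kap k = kap (Suc k)" "\<not> w k < w (Suc k)"
      using Dset_adjacent[OF w] by blast
    then have down: "w (Suc k) < w k" using Wn_adjacent_neq[OF w, of k] by blast
    let ?s = "simple_refl k"
    let ?u = "w \<circ> ?s"
    have l: "len n w = Suc (len n ?u)" by (rule len_comp_right(2)[OF w k(1,2) down])
    have uW: "?u \<in> Wn n" by (rule Wn_comp[OF w simple_refl_Wn[OF k(1,2)]])
    have us: "?u \<circ> ?s = w" unfolding comp_assoc simple_refl_comp by (rule o_id)
    have word: "kap \<circ> inv' ?u = kap \<circ> inv' w"
      unfolding Wn_comp_inv[OF w simple_refl_Wn[OF k(1,2)]] inv_simple_refl
        comp_assoc[symmetric] comp_simple_refl_eq[OF k(3)] ..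
    obtain m where m: "\<And>x. TT n ?u Z x = m * word_vec (kap \<circ> inv' w) x"
      using less.hyps[OF _ uW] l unfolding word by auto
    have "TT n w Z x = - q_inv * TT n ?u Z x" for x
    proof -
      have "TT n ?u (left_op n ?s Z) x = TT n w Z x"
        unfolding TT_left_op[OF simple_refl_in[OF k(1,2)] uW Z_coord_fns] us using l by simp
      moreover have "TT n ?u (left_op n ?s Z) x = - q_inv * TT n ?u Z x"
        unfolding Z_col[OF k(1-3)] by (rule TT_smult)
      ultimately show ?thesis by simp
    qed
    then show ?thesis unfolding m by (intro exI[of _ "- q_inv * m"]) (simp add: mult.assoc)
  qed
qed

lemma finsum_specht_basis:
  "(\<Oplus>\<^bsub>hecke n\<^esub>t\<in>STD lam. a t \<odot>\<^bsub>hecke n\<^esub> specht_basis t) = Psi n (\<lambda>u. \<Sum>t\<in>STD lam. a t * word_vec (col_word t) u)"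
  unfolding specht_basis_def Psi_smult by (rule Psi_finsum[OF finite_STD])

lemma specht_eq:
  "specht n lam = {Psi n (\<lambda>u. \<Sum>w\<in>Wn n. f w * TT n w Z u) | f. f \<in> coord_fns n}"
  unfolding specht_def specht_generator hecke_carrier_Psi
  using Psi_mult_Psi[OF _ Z_coord_fns] by auto

theorem specht_basis_is_basis: "is_basis (hecke n) (specht n lam) (STD lam) specht_basis"
  unfolding is_basis_def
proof (intro conjI allI impI ballI)
  show "finite (STD lam)" by (rule finite_STD)
  have eq: "specht n lam = {\<Oplus>\<^bsub>hecke n\<^esub>t\<in>STD lam. a t \<odot>\<^bsub>hecke n\<^esub> specht_basis t | a. True}"
  proof (intro subset_antisym subsetI)
    fix x assume "x \<in> specht n lam"
    then obtain f where x: "x = Psi n (\<lambda>u. \<Sum>w\<in>Wn n. f w * TT n w Z u)"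
      by (auto simp: specht_eq)
    have "\<forall>w\<in>Wn n. \<exists>m. \<forall>u. TT n w Z u = m * word_vec (kap \<circ> inv' w) u" using TT_reduce by blast
    from bchoice[OF this] obtain m where
      m: "\<forall>w\<in>Wn n. \<forall>u. TT n w Z u = m w * word_vec (kap \<circ> inv' w) u" ..
    define a where "a c = (\<Sum>w\<in>Wn n. f w * m w * coeff (kap \<circ> inv' w) c)" for c
    have "(\<Sum>w\<in>Wn n. f w * TT n w Z u) = (\<Sum>c\<in>std_words. a c * word_vec c u)" for u
    proof -
      have "(\<Sum>w\<in>Wn n. f w * TT n w Z u)
          = (\<Sum>w\<in>Wn n. \<Sum>c\<in>std_words. f w * m w * coeff (kap \<circ> inv' w) c * word_vec c u)"
      proof (rule sum.cong[OF refl])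
        fix w assume w: "w \<in> Wn n"
        then have "kap \<circ> inv' w \<in> words" unfolding words_def by blast
        from word_vec_coeff[OF this, of u] have "TT n w Z u = m w * (\<Sum>c\<in>std_words. coeff (kap \<circ> inv' w) c * word_vec c u)"
          using bspec[OF m w] by simp
        then show "f w * TT n w Z u = (\<Sum>c\<in>std_words. f w * m w * coeff (kap \<circ> inv' w) c * word_vec c u)"
          by (simp add: sum_distrib_left mult.assoc)
      qed
      also have "\<dots> = (\<Sum>c\<in>std_words. a c * word_vec c u)"
        unfolding a_def sum_distrib_right by (rule sum.swap)
      finally show ?thesis .
    qed
    then have "x = Psi n (\<lambda>u. \<Sum>t\<in>STD lam. a (col_word t) * word_vec (col_word t) u)"
      unfolding x using sum.reindex_bij_betw[OF col_word_bij, of "\<lambda>c. a c * word_vec c _"] by simp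
    then show "x \<in> {\<Oplus>\<^bsub>hecke n\<^esub>t\<in>STD lam. a t \<odot>\<^bsub>hecke n\<^esub> specht_basis t | a. True}"
      unfolding finsum_specht_basis by (intro CollectI exI[of _ "\<lambda>t. a (col_word t)"] conjI TrueI)
  next
    fix x assume "x \<in> {\<Oplus>\<^bsub>hecke n\<^esub>t\<in>STD lam. a t \<odot>\<^bsub>hecke n\<^esub> specht_basis t | a. True}"
    then obtain a where x: "x = Psi n (\<lambda>u. \<Sum>t\<in>STD lam. a t * word_vec (col_word t) u)"
      unfolding finsum_specht_basis by blast
    \<comment> \<open>The basis vectors are \<open>T\<^sub>d z\<close> with \<open>d\<close> the
      permutation of the tableau, so the multiplier is the corresponding combination of the
      \<open>T\<^sub>d\<close>.\<close>
    define f where "f w = (\<Sum>t\<in>STD lam. a t * delta (tab_perm n lam t) w)" for w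
    have fF: "f \<in> coord_fns n" unfolding coord_fns_def f_def
      using STD_col_word(5) by (auto simp: delta_def intro!: sum.neutral)
    have fe: "(\<Sum>w\<in>Wn n. f w * TT n w Z u) = (\<Sum>t\<in>STD lam. a t * word_vec (col_word t) u)" for u
    proof -
      have "(\<Sum>w\<in>Wn n. f w * TT n w Z u)
          = (\<Sum>t\<in>STD lam. \<Sum>w\<in>Wn n. a t * delta (tab_perm n lam t) w * TT n w Z u)"
        unfolding f_def sum_distrib_right by (rule sum.swap)
      also have "\<dots> = (\<Sum>t\<in>STD lam. a t * word_vec (col_word t) u)"
      proof (rule sum.cong[OF refl])
        fix t assume t: "t \<in> STD lam"
        have "(\<Sum>w\<in>Wn n. a t * delta (tab_perm n lam t) w * TT n w Z u)
            = (\<Sum>w\<in>Wn n. if w = tab_perm n lam t then a t * TT n w Z u else 0)"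
          by (rule sum.cong) (auto simp: delta_def)
        then show "(\<Sum>w\<in>Wn n. a t * delta (tab_perm n lam t) w * TT n w Z u) = a t * word_vec (col_word t) u"
          using STD_col_word(5)[OF t] by (simp add: word_vec_col_word[OF t])
      qed
      finally show ?thesis .
    qed
    show "x \<in> specht n lam" unfolding x specht_eq mem_Collect_eq fe[symmetric] using fF by blast
  qed
  show "specht n lam = {\<Oplus>\<^bsub>hecke n\<^esub>t\<in>STD lam. a t \<odot>\<^bsub>hecke n\<^esub> specht_basis t | a. True}" by (rule eq)
  show "specht n lam \<subseteq> carrier (hecke n)" unfolding specht_eq using Psi_in by blast
  show "specht_basis \<in> STD lam \<rightarrow> specht n lam"
  proof
    fix t assume t: "t \<in> STD lam"
    have "(\<Sum>u\<in>STD lam. (if u = t then 1 else 0) * word_vec (col_word u) w) = word_vec (col_word t) w" for w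
      using sum_indicator[OF finite_STD t, of 1 "\<lambda>u. word_vec (col_word u) w"] by simp
    then have "specht_basis t = (\<Oplus>\<^bsub>hecke n\<^esub>u\<in>STD lam. (if u = t then 1 else 0) \<odot>\<^bsub>hecke n\<^esub> specht_basis u)"
      unfolding finsum_specht_basis specht_basis_def[of t] by simp
    then show "specht_basis t \<in> specht n lam"
      unfolding eq by (intro CollectI exI[of _ "\<lambda>u. if u = t then 1 else 0"] conjI TrueI)
  qed
  fix a t assume zero: "(\<Oplus>\<^bsub>hecke n\<^esub>t\<in>STD lam. a t \<odot>\<^bsub>hecke n\<^esub> specht_basis t) = \<zero>\<^bsub>hecke n\<^esub>"
    and t: "t \<in> STD lam"
  let ?g = "\<lambda>c. word_perm c \<circ> col_tab lam"
  have "(\<lambda>u. \<Sum>t\<in>STD lam. a t * word_vec (col_word t) u) = (\<lambda>u. 0)"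
  proof (rule Psi_inj)
    show "Psi n (\<lambda>u. \<Sum>t\<in>STD lam. a t * word_vec (col_word t) u) = Psi n (\<lambda>u. 0)"
      using zero unfolding finsum_specht_basis Psi_zero .
    have "word_vec (col_word t) u = 0" if "t \<in> STD lam" "u \<notin> Wn n" for t u
      using word_vec_coord_fns[OF STD_col_word(3)[OF that(1)]] that(2) by (simp add: coord_fns_def)
    then show "(\<lambda>u. \<Sum>t\<in>STD lam. a t * word_vec (col_word t) u) \<in> coord_fns n"
      unfolding coord_fns_def by (auto intro!: sum.neutral)
  qed (simp add: coord_fns_def)
  then have z: "(\<Sum>t\<in>STD lam. a t * word_vec (col_word t) u) = 0" for u by (rule fun_cong)
  have g: "?g (col_word t) = t" if "t \<in> STD lam" for t
    unfolding STD_col_word(4)[OF that] by (rule STD_col_word(6)[OF that])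
  have "(\<Sum>c\<in>std_words. a (?g c) * word_vec c u) = (\<Sum>t\<in>STD lam. a t * word_vec (col_word t) u)" for u
    unfolding sum.reindex_bij_betw[OF col_word_bij, symmetric] by (rule sum.cong[OF refl]) (simp only: g)
  then have "a (?g (col_word t)) = 0"
    by (intro independent[of "\<lambda>c. a (?g c)", OF _ STD_col_word(2)[OF t]]) (simp only: z)
  then show "a t = 0" unfolding g[OF t] .
qed

definition wa_coeff :: "perm \<Rightarrow> tableau \<Rightarrow> tableau \<Rightarrow> laurent" where
  "wa_coeff s u t = (if col_word t \<circ> s \<in> words \<and> \<not> lattice_word n (col_word t \<circ> s) \<and> dominates n (col_word u) (col_word t) \<and> col_word u \<noteq> col_word t
     then - coeff (col_word t \<circ> s) (col_word u) else 0)"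

lemma wa_coeff_q_polys: "u \<in> STD lam \<Longrightarrow> wa_coeff s u t \<in> q_polys"
  unfolding q_polys_val_ge wa_coeff_def
  using coeff_in_q_polys STD_col_word(2) val_ge_uminus by auto

lemma wa_coeff_nonzero:
  assumes u: "u \<in> STD lam" and t: "t \<in> STD lam" and nz: "wa_coeff s u t \<noteq> 0"
  shows "tab_less n lam u t"
proof -
  have d: "dominates n (col_word u) (col_word t)" "col_word u \<noteq> col_word t" using nz by (auto simp: wa_coeff_def split: if_splits)
  have "bruhat_le n (tab_perm n lam u) (tab_perm n lam t)"
    using bruhat_le_if_dom[OF STD_col_word(3)[OF u] STD_col_word(3)[OF t] d(1)]
    unfolding STD_col_word(4)[OF u] STD_col_word(4)[OF t] .
  moreover have "tab_perm n lam u \<noteq> tab_perm n lam t" using d(2) unfolding col_word_def by metis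
  ultimately show ?thesis by (simp add: tab_less_def bruhat_less_def)
qed

lemma bruhat_less_len: "bruhat_less n u w \<Longrightarrow> len n u < len n w"
  using bruhat_le_len[of n u w] by (auto simp: bruhat_less_def)

lemma specht_basis_left:
  assumes t: "t \<in> STD lam" and s: "s \<in> simple_refls n"
  shows "left_op n s (word_vec (col_word t)) u = TT n (s \<circ> tab_perm n lam t) Z u
    + (if len n (s \<circ> tab_perm n lam t) < len n (tab_perm n lam t) then q_diff else 0) * word_vec (col_word t) u"
  unfolding word_vec_col_word[OF t] by (rule left_op_TT[OF s STD_col_word(5)[OF t] Z_coord_fns])

lemma col_word_left:
  assumes t: "t \<in> STD lam" and s: "s \<in> simple_refls n"
  shows "col_word (s \<circ> t) = col_word t \<circ> s"
proof -
  obtain i where i: "s = simple_refl i" "1 \<le> i" "i < n" using s by (rule simple_reflsE)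
  have "inv' (s \<circ> tab_perm n lam t) = inv' (tab_perm n lam t) \<circ> s"
    using inv_comp_left[OF STD_col_word(5)[OF t] i(2,3)] by (simp only: i(1))
  then show ?thesis
    unfolding col_word_def tab_perm_left[OF STD_col_word(7)[OF t] simple_refls_Wn[OF s]]
    by (simp only: comp_assoc)
qed

lemma specht_basis_SA:
  assumes t: "t \<in> STD lam" and s: "s \<in> SA n lam t"
  shows "T_gen n s \<otimes>\<^bsub>hecke n\<^esub> specht_basis t = specht_basis (s \<circ> t)"
proof -
  let ?w = "tab_perm n lam t"
  have s': "s \<in> simple_refls n" "bruhat_less n ?w (s \<circ> ?w)" "s \<circ> t \<in> STD lam"
    using s by (auto simp: SA_def Let_def)
  have "left_op n s (word_vec (col_word t)) = word_vec (col_word (s \<circ> t))"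
    unfolding word_vec_col_word[OF s'(3)] tab_perm_left[OF STD_col_word(7)[OF t] simple_refls_Wn[OF s'(1)]]
    using bruhat_less_len[OF s'(2)] by (intro ext) (simp add: specht_basis_left[OF t s'(1)] del: comp_apply)
  then show ?thesis unfolding specht_basis_def T_gen_Psi[OF s'(1)] by (simp only:)
qed

lemma specht_basis_SD:
  assumes t: "t \<in> STD lam" and s: "s \<in> SD n lam t"
  shows "T_gen n s \<otimes>\<^bsub>hecke n\<^esub> specht_basis t = specht_basis (s \<circ> t) \<oplus>\<^bsub>hecke n\<^esub> (q - q_inv) \<odot>\<^bsub>hecke n\<^esub> specht_basis t"
proof -
  let ?w = "tab_perm n lam t"
  have s': "s \<in> simple_refls n" "bruhat_less n (s \<circ> ?w) ?w"
    using s by (auto simp: SD_def Let_def)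
  obtain i where i: "s = simple_refl i" "1 \<le> i" "i < n" using s'(1) by (rule simple_reflsE)
  have len: "len n (s \<circ> ?w) < len n ?w" by (rule bruhat_less_len[OF s'(2)])
  \<comment> \<open>Equal letters and ascents are excluded because either would make
    \<open>s \<circ> ?w\<close> longer than \<open>?w\<close>.\<close>
  have desc: "col_word t (Suc i) < col_word t i"
  proof -
    have le: "\<not> len n (word_perm (col_word t)) < len n (simple_refl i \<circ> word_perm (col_word t))"
      using len unfolding STD_col_word(4)[OF t] i(1) by simp
    obtain "col_word t i \<noteq> col_word t (Suc i)"
      using word_perm_equal[OF STD_col_word(3)[OF t] i(2,3)] le by metis
    then show ?thesis using word_perm_ascent[OF STD_col_word(3)[OF t] i(2,3)] le by (meson linorder_neqE_nat)
  qed
  have "left_op n s (word_vec (col_word t)) = (\<lambda>u. word_vec (col_word (s \<circ> t)) u + (q - q_inv) * word_vec (col_word t) u)"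
    unfolding col_word_left[OF t s'(1)]
    by (rule ext) (simp only: i(1) word_vec_descent[OF STD_col_word(3)[OF t] i(2,3) desc] q_diff_def)
  then show ?thesis unfolding specht_basis_def T_gen_Psi[OF s'(1)] Psi_smult Psi_add by (simp only:)
qed

lemma specht_basis_WD:
  assumes t: "t \<in> STD lam" and s: "s \<in> WD n lam t"
  shows "T_gen n s \<otimes>\<^bsub>hecke n\<^esub> specht_basis t = (- q_inv) \<odot>\<^bsub>hecke n\<^esub> specht_basis t"
proof -
  let ?w = "tab_perm n lam t"
  have s': "s \<in> simple_refls n" "s \<circ> ?w \<notin> Dset"
    using s by (auto simp: WD_def Let_def D_par_eq)
  obtain i where i: "s = simple_refl i" "1 \<le> i" "i < n" using s'(1) by (rule simple_reflsE)
  have tw: "col_word t \<in> words" by (rule STD_col_word(3)[OF t])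
  have "col_word t i = col_word t (Suc i)"
  proof (rule ccontr)
    assume "col_word t i \<noteq> col_word t (Suc i)"
    from word_perm_swap[OF tw i(2,3) this] have "simple_refl i \<circ> word_perm (col_word t) \<in> Dset"
      using word_perm(1)[OF words_swap[OF tw i(2,3)]] by simp
    then show False using s'(2) unfolding STD_col_word(4)[OF t] i(1) by simp
  qed
  from word_vec_equal[OF tw i(2,3) this] have "left_op n s (word_vec (col_word t)) = (\<lambda>w. - q_inv * word_vec (col_word t) w)"
    by (simp only: i(1))
  then show ?thesis unfolding specht_basis_def T_gen_Psi[OF s'(1)] Psi_smult by (simp only:)
qed

lemma specht_basis_WA:
  assumes t: "t \<in> STD lam" and s: "s \<in> WA n lam t"
  shows "T_gen n s \<otimes>\<^bsub>hecke n\<^esub> specht_basis t = q \<odot>\<^bsub>hecke n\<^esub> specht_basis t \<ominus>\<^bsub>hecke n\<^esub>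
    (\<Oplus>\<^bsub>hecke n\<^esub>u\<in>{u \<in> STD lam. tab_less n lam u t}. wa_coeff s u t \<odot>\<^bsub>hecke n\<^esub> specht_basis u)"
proof -
  let ?w = "tab_perm n lam t"
  have s': "s \<in> simple_refls n" "bruhat_less n ?w (s \<circ> ?w)" "s \<circ> ?w \<in> Dset" "s \<circ> t \<notin> STD lam"
    using s by (auto simp: WA_def Let_def D_par_eq)
  obtain i where i: "s = simple_refl i" "1 \<le> i" "i < n" using s'(1) by (rule simple_reflsE)
  have tw: "col_word t \<in> words" and tL: "col_word t \<in> std_words" by (rule STD_col_word[OF t])+
  have len: "len n (word_perm (col_word t)) < len n (simple_refl i \<circ> word_perm (col_word t))"
    using bruhat_less_len[OF s'(2)] unfolding STD_col_word(4)[OF t] i(1) .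
  have "col_word t i \<noteq> col_word t (Suc i)"
    using word_perm_equal[OF tw i(2,3)] s'(3) unfolding STD_col_word(4)[OF t] i(1) by metis
  then have asc: "col_word t i < col_word t (Suc i)"
    using word_perm_descent[OF tw i(2,3)] len by (meson linorder_neqE_nat less_asym)
  have nl: "\<not> lattice_word n (col_word t \<circ> s)"
  proof
    assume l: "lattice_word n (col_word t \<circ> s)"
    have sW: "s \<circ> ?w \<in> Wn n" by (rule Dset_Wn[OF s'(3)])
    have "kap \<circ> inv' (s \<circ> ?w) = col_word t \<circ> s"
      using col_word_left[OF t s'(1)] unfolding col_word_def[of "s \<circ> t"]
        tab_perm_left[OF STD_col_word(7)[OF t] simple_refls_Wn[OF s'(1)]] .
    then have "s \<circ> ?w \<circ> col_tab lam \<in> STD lam"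
      unfolding STD_comp_iff[OF sW] using s'(3) l by simp
    then show False using s'(4) unfolding comp_assoc STD_col_word(6)[OF t] by blast
  qed
  have sw: "col_word t \<circ> s \<in> words" unfolding i(1) by (rule words_swap[OF tw i(2,3)])
  let ?S = "{u \<in> STD lam. tab_less n lam u t}"
  have fin: "finite ?S" using finite_STD by simp
  have "(\<Sum>u | u \<in> std_words \<and> dominates n u (col_word t) \<and> u \<noteq> col_word t. - coeff (col_word t \<circ> s) u * word_vec u x)
      = (\<Sum>u\<in>?S. wa_coeff s u t * word_vec (col_word u) x)" for x
  proof -
    let ?h = "\<lambda>c. if dominates n c (col_word t) \<and> c \<noteq> col_word t then - coeff (col_word t \<circ> s) c * word_vec c x else 0"
    have "(\<Sum>u | u \<in> std_words \<and> dominates n u (col_word t) \<and> u \<noteq> col_word t. - coeff (col_word t \<circ> s) u * word_vec u x) = (\<Sum>c\<in>std_words. ?h c)"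
      by (rule sum.mono_neutral_cong_left) (use finite_std_words in auto)
    also have "\<dots> = (\<Sum>u\<in>STD lam. ?h (col_word u))"
      by (rule sum.reindex_bij_betw[OF col_word_bij, symmetric])
    also have "\<dots> = (\<Sum>u\<in>STD lam. wa_coeff s u t * word_vec (col_word u) x)"
      by (rule sum.cong[OF refl]) (use sw nl in \<open>simp add: wa_coeff_def\<close>)
    \<comment> \<open>Nonzero coefficients require dominance, which implies the Bruhat relation, so
      only zero terms are dropped.\<close>
    also have "\<dots> = (\<Sum>u\<in>?S. wa_coeff s u t * word_vec (col_word u) x)"
    proof (rule sum.mono_neutral_right)
      show "\<forall>u\<in>STD lam - ?S. wa_coeff s u t * word_vec (col_word u) x = 0" using wa_coeff_nonzero[OF _ t] by fastforce
    qed (use finite_STD in auto)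
    finally show ?thesis .
  qed
  then have "left_op n s (word_vec (col_word t)) = (\<lambda>x. q * word_vec (col_word t) x - (\<Sum>u\<in>?S. wa_coeff s u t * word_vec (col_word u) x))"
    using word_vec_weak_ascent[OF tL i(2,3) asc] nl unfolding i(1) by (intro ext) simp
  then show ?thesis
    unfolding specht_basis_def T_gen_Psi[OF s'(1)] Psi_smult Psi_finsum[OF fin] Psi_diff by (simp only:)
qed

end

theorem mainTheorem4:
  fixes n :: nat and lam :: "nat list"
  assumes "n \<ge> 1" and "is_partition n lam"
  shows "\<exists>(b :: tableau \<Rightarrow> free_elt set) (r :: perm \<Rightarrow> tableau \<Rightarrow> tableau \<Rightarrow> laurent).
     is_basis (hecke n) (specht n lam) (STD lam) b \<and>
     (\<forall>s \<in> simple_refls n. \<forall>u \<in> STD lam. \<forall>t \<in> STD lam. r s u t \<in> q_polys) \<and>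
     (\<forall>s \<in> simple_refls n. \<forall>t \<in> STD lam.
        (s \<in> SA n lam t \<longrightarrow>
           T_gen n s \<otimes>\<^bsub>hecke n\<^esub> b t = b (s \<circ> t)) \<and>
        (s \<in> SD n lam t \<longrightarrow>
           T_gen n s \<otimes>\<^bsub>hecke n\<^esub> b t =
             b (s \<circ> t) \<oplus>\<^bsub>hecke n\<^esub> (q - q_inv) \<odot>\<^bsub>hecke n\<^esub> b t) \<and>
        (s \<in> WD n lam t \<longrightarrow>
           T_gen n s \<otimes>\<^bsub>hecke n\<^esub> b t = (- q_inv) \<odot>\<^bsub>hecke n\<^esub> b t) \<and>
        (s \<in> WA n lam t \<longrightarrow>
           T_gen n s \<otimes>\<^bsub>hecke n\<^esub> b t =
             q \<odot>\<^bsub>hecke n\<^esub> b t \<ominus>\<^bsub>hecke n\<^esub>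
               (\<Oplus>\<^bsub>hecke n\<^esub>u\<in>{u \<in> STD lam. tab_less n lam u t}. r s u t \<odot>\<^bsub>hecke n\<^esub> b u)))"
proof -
  interpret shape n lam by (rule shape.intro[OF assms(2)])
  show ?thesis
    by (intro exI[of _ specht_basis] exI[of _ wa_coeff] conjI ballI impI)
      (simp_all add: specht_basis_is_basis wa_coeff_q_polys specht_basis_SA specht_basis_SD specht_basis_WD specht_basis_WA)
qed

end
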